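(* Let $\Phi=\{\phi_i\}_{i\in\mathcal{D}}$ be a conformal iterated function system satisfying the open set condition, with attractor $X\subset\mathbb{R}^d$, and let $\theta:\mathbb{N}\to\mathbb{R}_{\geq 0}$ be a decreasing function that satisfies $$\sum_{n=1}^{\infty}\sum_{I\in\mathcal{D}^{n}}(Diam(X_I)\theta(n))^{\dim_{H}(X)}=\infty.$$ Then $$\dim_{H}\big(W((Diam(X_{I})\theta(|I|))^{t},z)\big)=\frac{\dim_{H}(X)}{t}$$ for all $z\in X$ and $t\geq 1$.
   Context: An iterated function system (IFS) is a finite set of contractions $\Phi=\{\phi_i\}_{i\in\mathcal{D}}$ of a closed subset of $\mathbb{R}^d$ into itself; its attractor is the unique non-empty compact set $X$ with $X=\bigcup_{i\in\mathcal{D}}\phi_i(X)$. Write $\mathcal{D}^n$ for words of length $n$ over $\mathcal{D}$, $\mathcal{D}^*=\bigcup_{n\ge1}\mathcal{D}^n$; for $I=(i_1,\dots,i_n)$, $|I|=n$, $\phi_I=\phi_{i_1}\circ\cdots\circ\phi_{i_n}$, $X_I=\phi_I(X)$. $\dim_H$ denotes Hausdorff dimension, $Diam$ denotes diameter, $B(x,r)$ is the closed Euclidean ball of centre $x$ and radius $r$. $W((Diam(X_I)\theta(|I|))^t,z)$ is the set of $x\in X$ such that $x\in B(\phi_I(z),(Diam(X_I)\theta(|I|))^t)$ for infinitely many $I\in\mathcal{D}^*$. Conformal IFS: an IFS $\Phi$ on a compact set $Y\subset\mathbb{R}^d$ such that each $\phi_i$ extends to an injective conformal contraction on some open connected neighbourhood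 $V$ of $Y$ (conformal: $C^1$ with $|\phi_i'(x)y|=|\phi_i'(x)||y|$ for all $x\in V$, $y\in\mathbb{R}^d$), with $0<\inf_{x\in V}|\phi_i'(x)|\le\sup_{x\in V}|\phi_i'(x)|<1$, and such that for some $\alpha,c>0$, $||\phi_i'(x)|-|\phi_i'(y)||\le c|x-y|^\alpha$ for all $x,y\in V$, $i\in\mathcal{D}$. Open set condition: there is a non-empty open set $O\subset\mathbb{R}^d$ (in the domain of the maps) with $\phi_i(O)\subset O$ for all $i\in\mathcal{D}$ and $\phi_i(O)\cap\phi_j(O)=\emptyset$ for all $i\ne j$. *)

theory Defs
  imports "HOL-Analysis.Analysis"
begin

section \<open>Hausdorff measure and dimension\<close>

text \<open>The power \<open>x\<^sup>s\<close> for \<open>x, s \<ge> 0\<close> with the convention \<open>0\<^sup>0 = 1\<close>; in contrast, \<open>0 powr 0 = 0\<close>.\<close>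

definition nn_power :: "real \<Rightarrow> real \<Rightarrow> real" where
  "nn_power x s = (if s = 0 then 1 else x powr s)"

text \<open>Boundedness is demanded because the library's \<open>diameter\<close> is an unspecified real number
  on unbounded sets. Finite covers are obtained by letting almost all \<open>U n\<close> be empty.\<close>

definition delta_covers :: "real \<Rightarrow> 'a::metric_space set \<Rightarrow> (nat \<Rightarrow> 'a set) set" where
  "delta_covers \<delta> A = {U. A \<subseteq> (\<Union>n. U n) \<and> (\<forall>n. bounded (U n) \<and> diameter (U n) \<le> \<delta>)}"

definition hausdorff_premeasure :: "real \<Rightarrow> real \<Rightarrow> 'a::metric_space set \<Rightarrow> ennreal" where
  "hausdorff_premeasure s \<delta> A =
     (INF U \<in> delta_covers \<delta> A.
        \<Sum>n. if U n = {} then 0 else ennreal (nn_power (diameter (U n)) s))"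

definition hausdorff_measure :: "real \<Rightarrow> 'a::metric_space set \<Rightarrow> ennreal" where
  "hausdorff_measure s A = (SUP \<delta> \<in> {0<..}. hausdorff_premeasure s \<delta> A)"

definition hausdorff_dim :: "'a::metric_space set \<Rightarrow> ennreal" where
  "hausdorff_dim A = (INF s \<in> {s. 0 \<le> s \<and> hausdorff_measure s A = 0}. ennreal s)"

section \<open>Iterated function systems\<close>

definition ifs :: "'i set \<Rightarrow> ('i \<Rightarrow> 'a \<Rightarrow> 'a) \<Rightarrow> 'a::euclidean_space set \<Rightarrow> bool" where
  "ifs D \<phi> Y \<longleftrightarrow> finite D \<and> closed Y \<and>
     (\<forall>i\<in>D. \<phi> i ` Y \<subseteq> Y \<and> (\<exists>r<1. r-lipschitz_on Y (\<phi> i)))"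

text \<open>For an IFS on \<open>Y\<close> there is at most one such \<open>X\<close> (exactly one if \<open>D\<close> and \<open>Y\<close> are nonempty).\<close>

definition is_attractor ::
  "'i set \<Rightarrow> ('i \<Rightarrow> 'a \<Rightarrow> 'a) \<Rightarrow> 'a::euclidean_space set \<Rightarrow> 'a set \<Rightarrow> bool" where
  "is_attractor D \<phi> Y X \<longleftrightarrow>
     X \<noteq> {} \<and> compact X \<and> X \<subseteq> Y \<and> X = (\<Union>i\<in>D. \<phi> i ` X)"

definition words :: "'i set \<Rightarrow> nat \<Rightarrow> 'i list set" where
  "words D n = {I. set I \<subseteq> D \<and> length I = n}"

definition nonempty_words :: "'i set \<Rightarrow> 'i list set" where
  "nonempty_words D = (\<Union>n\<in>{1..}. words D n)"

primrec word_map :: "('i \<Rightarrow> 'a \<Rightarrow> 'a) \<Rightarrow> 'i list \<Rightarrow> 'a \<Rightarrow> 'a" where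
  "word_map \<phi> [] = id"
| "word_map \<phi> (i # I) = \<phi> i \<circ> word_map \<phi> I"

text \<open>The limsup set \<open>W(\<Psi>, z)\<close>. Words are counted, so distinct words giving the same ball
  contribute separately.\<close>

definition W_set ::
  "'i set \<Rightarrow> ('i \<Rightarrow> 'a \<Rightarrow> 'a) \<Rightarrow> 'a::euclidean_space set \<Rightarrow> ('i list \<Rightarrow> real) \<Rightarrow> 'a \<Rightarrow> 'a set" where
  "W_set D \<phi> X \<Psi> z =
     {x\<in>X. infinite {I \<in> nonempty_words D. x \<in> cball (word_map \<phi> I z) (\<Psi> I)}}"

section \<open>Conformal systems and the open set condition\<close>

text \<open>The derivative is a bounded linear map, so \<open>norm (f' x)\<close> is its operator norm and
  continuity of \<open>f'\<close> says that \<open>f\<close> is \<open>C\<^sup>1\<close>.\<close>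

definition conformal_on ::
  "'a::euclidean_space set \<Rightarrow> ('a \<Rightarrow> 'a) \<Rightarrow> ('a \<Rightarrow> 'a \<Rightarrow>\<^sub>L 'a) \<Rightarrow> bool" where
  "conformal_on V f f' \<longleftrightarrow>
     (\<forall>x\<in>V. (f has_derivative blinfun_apply (f' x)) (at x)) \<and>
     continuous_on V f' \<and>
     (\<forall>x\<in>V. \<forall>y. norm (blinfun_apply (f' x) y) = norm (f' x) * norm y)"

text \<open>As functions are total, \<open>\<phi> i\<close> stands for the extension to \<open>V\<close> of the map on \<open>Y\<close>;
  its values outside \<open>V\<close> are irrelevant. The maps need not send \<open>V\<close> into itself.\<close>

definition conformal_ifs ::
  "'i set \<Rightarrow> ('i \<Rightarrow> 'a \<Rightarrow> 'a) \<Rightarrow> 'a::euclidean_space set \<Rightarrow> 'a set \<Rightarrow> bool" where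
  "conformal_ifs D \<phi> Y V \<longleftrightarrow>
     ifs D \<phi> Y \<and> compact Y \<and> open V \<and> connected V \<and> Y \<subseteq> V \<and>
     (\<forall>i\<in>D. inj_on (\<phi> i) V \<and> (\<exists>r<1. r-lipschitz_on V (\<phi> i))) \<and>
     (\<exists>\<phi>'. (\<forall>i\<in>D. conformal_on V (\<phi> i) (\<phi>' i)) \<and>
           (\<forall>i\<in>D. \<exists>a b. 0 < a \<and> b < 1 \<and> (\<forall>x\<in>V. a \<le> norm (\<phi>' i x) \<and> norm (\<phi>' i x) \<le> b)) \<and>
           (\<exists>\<alpha>>0. \<exists>c>0. \<forall>i\<in>D. \<forall>x\<in>V. \<forall>y\<in>V.
              \<bar>norm (\<phi>' i x) - norm (\<phi>' i y)\<bar> \<le> c * norm (x - y) powr \<alpha>))"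

definition open_set_condition ::
  "'i set \<Rightarrow> ('i \<Rightarrow> 'a \<Rightarrow> 'a) \<Rightarrow> 'a::euclidean_space set \<Rightarrow> bool" where
  "open_set_condition D \<phi> V \<longleftrightarrow>
     (\<exists>U. U \<noteq> {} \<and> open U \<and> U \<subseteq> V \<and> (\<forall>i\<in>D. \<phi> i ` U \<subseteq> U) \<and>
          (\<forall>i\<in>D. \<forall>j\<in>D. i \<noteq> j \<longrightarrow> \<phi> i ` U \<inter> \<phi> j ` U = {}))"

end

theory Submission
  imports Defs
begin

text \<open>
Write \<open>d(I)\<close> for the diameter of \<open>X\<^sub>I\<close> and \<open>s\<close> for the dimension of \<open>X\<close>. If \<open>s = 0\<close>, both sides of the
claim are \<open>0\<close>, because the limsup set lies in \<open>X\<close>; so let \<open>s > 0\<close>.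

A conformal map is, near each point, a similarity up to an error that is summable along an orbit
of contractions. Hence there is one constant \<open>K\<close> such that every \<open>\<phi>\<^sub>I\<close>, for words of any length,
multiplies all distances near \<open>X\<close> by one factor proportional to \<open>d(I)\<close>, up to \<open>K\<close> (\<open>conformal_log_ratio\<close> and
\<open>bounded_distortion\<close>). From then on only this metric fact and the open set condition matter; they
form the locale \<open>distorted_ifs\<close>. The open set condition says that a ball of radius \<open>\<rho>\<close> meets
boundedly many cylinders \<open>X\<^sub>I\<close> of incomparable words and of size comparable to \<open>\<rho>\<close> (\<open>card_cylinders_le\<close>), because
each \<open>\<phi>\<^sub>I(U)\<close> contains a ball of radius comparable to \<open>d(I)\<close> and these sets are disjoint.

The engine is a Cantor construction (\<open>hausdorff_dim_W_set_ge\<close>). Suppose that the map of each letter \<open>a\<close>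
multiplies distances by at least \<open>c\<^sub>a\<close>, with
\<open>\<Sum> c\<^sub>a\<^sup>\<sigma> \<ge> 1\<close>. Distribute a unit mass over the words: usually the letters are independent with probabilities proportional to \<open>c\<^sub>a\<^sup>\<sigma>\<close>, but at sparse lengths \<open>n\<^sub>k\<close> the word
\<open>P\<close> reached there is continued deterministically toward \<open>\<phi>\<^sub>P(z)\<close> until its cylinder lies in the ball
of radius \<open>\<rho>(P)\<close> about that point. Every point that carries mass lies in the limsup set. Before the
\<open>k\<close>-th jump the mass of \<open>P\<close> is at most \<open>d(P)\<^sup>\<sigma>\<close> up to a factor that depends on the earlier stages
alone; choosing \<open>n\<^sub>k\<close> large absorbs this factor, so the mass is at most a constant times
\<open>d(I)\<^sup>\<tau>\<close> for all words \<open>I\<close> provided that \<open>\<rho>(P)\<^sup>\<tau>\<close> dominates \<open>d(P)\<^sup>\<sigma>\<close>. The mass distribution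
principle then gives dimension at least \<open>\<tau>\<close>.

Let \<open>Z n \<sigma>\<close> be the sum of \<open>d(I)\<^sup>\<sigma>\<close> over the words of length \<open>n\<close>. If \<open>Z n s\<close> grew exponentially along a
subsequence, then blocks of \<open>n\<close> letters would satisfy the condition above for some \<open>\<sigma> > s\<close>, and the
construction without effective jumps (\<open>\<rho> = d\<close>) would make the dimension of \<open>X\<close> exceed \<open>s\<close>; thus
\<open>Z n s \<le> e\<^bsup>\<epsilon>n\<^esup>\<close> eventually (\<open>Z_le_exp\<close>). This yields the rest:

\<^item> For \<open>\<sigma> > s\<close> the sums \<open>Z n \<sigma>\<close> decay geometrically, so the balls themselves, whose radii are at
  most a constant times \<open>d(I)\<^sup>t\<close>, show that the dimension of the limsup set is at most \<open>\<sigma>/t\<close>.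

\<^item> If \<open>\<theta>(n) < e\<^bsup>-\<epsilon>n\<^esup>\<close> eventually, the series in the hypothesis would converge. Hence
  \<open>\<theta>(n) \<ge> e\<^bsup>-\<epsilon>n\<^esup>\<close> infinitely often for each \<open>\<epsilon>\<close>, so along these lengths the radius is at
  least \<open>(d(I) e\<^bsup>-\<epsilon>n\<^esup>)\<^sup>t\<close> with \<open>\<epsilon>\<close> as small as desired. For \<open>\<tau> < s/t\<close> pick \<open>\<sigma>\<close> with \<open>t\<tau> < \<sigma> < s\<close>; some block length \<open>N\<close> satisfies the
  condition on the contraction ratios, as otherwise \<open>Z n \<sigma>\<close> is bounded and \<open>X\<close> has dimension below
  \<open>s\<close>. By monotonicity of \<open>\<theta>\<close> the lengths can be taken to be multiples of \<open>N\<close>, and the Cantor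
  construction gives dimension at least \<open>\<tau>\<close>.
\<close>

section \<open>Hausdorff dimension through covers\<close>

lemma hausdorff_dim_mono:
  assumes "A \<subseteq> B"
  shows "hausdorff_dim A \<le> hausdorff_dim B"
proof -
  have "hausdorff_premeasure s \<delta> A \<le> hausdorff_premeasure s \<delta> B" for s \<delta>
    unfolding hausdorff_premeasure_def
    by (rule INF_superset_mono) (use assms in \<open>auto simp: delta_covers_def\<close>)
  then have "hausdorff_measure s A \<le> hausdorff_measure s B" for s
    unfolding hausdorff_measure_def by (intro SUP_mono) auto
  then have "hausdorff_measure s B = 0 \<Longrightarrow> hausdorff_measure s A = 0" for s
    by (metis le_zero_eq)
  then show ?thesis
    unfolding hausdorff_dim_def by (intro INF_superset_mono) auto
qed

lemma hausdorff_dim_le_if_countable_covers: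
  fixes A :: "'a::metric_space set"
  assumes s: "0 < s"
    and cov: "\<And>\<delta> \<eta>. 0 < \<delta> \<Longrightarrow> 0 < \<eta> \<Longrightarrow>
      \<exists>U::nat \<Rightarrow> 'a set. A \<subseteq> (\<Union>n. U n) \<and> (\<forall>n. bounded (U n) \<and> diameter (U n) \<le> \<delta>) \<and>
        (\<Sum>n. ennreal (diameter (U n) powr s)) \<le> ennreal \<eta>"
  shows "hausdorff_dim A \<le> ennreal s"
proof -
  have "hausdorff_premeasure s \<delta> A = 0" if "0 < \<delta>" for \<delta>
  proof -
    have "hausdorff_premeasure s \<delta> A \<le> 0 + ennreal \<eta>" if "0 < \<eta>" for \<eta>
    proof -
      obtain U :: "nat \<Rightarrow> 'a set" where U: "A \<subseteq> (\<Union>n. U n)"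
        "\<forall>n. bounded (U n) \<and> diameter (U n) \<le> \<delta>"
        "(\<Sum>n. ennreal (diameter (U n) powr s)) \<le> ennreal \<eta>"
        using cov[OF \<open>0 < \<delta>\<close> \<open>0 < \<eta>\<close>] by blast
      have "hausdorff_premeasure s \<delta> A
          \<le> (\<Sum>n. if U n = {} then 0 else ennreal (nn_power (diameter (U n)) s))"
        unfolding hausdorff_premeasure_def
        by (rule INF_lower) (use U in \<open>auto simp: delta_covers_def\<close>)
      also have "\<dots> \<le> (\<Sum>n. ennreal (diameter (U n) powr s))"
        by (rule suminf_le) (use s in \<open>auto simp: nn_power_def\<close>)
      finally show ?thesis using U(3) by simp
    qed
    then have "hausdorff_premeasure s \<delta> A \<le> 0"
      by (rule ennreal_le_epsilon) (use \<open>0 < \<delta>\<close> in auto)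
    then show ?thesis by simp
  qed
  then have "hausdorff_measure s A = 0"
    unfolding hausdorff_measure_def by (simp add: SUP_eq_iff bot_ennreal)
  then show ?thesis
    unfolding hausdorff_dim_def using s by (intro INF_lower) auto
qed

text \<open>Natural covers are indexed by words. Bounding the finite partial sums spares the choice of an
enumeration and the summability of the series.\<close>
lemma hausdorff_dim_le_if_covers:
  assumes s: "0 < s"
    and cov: "\<And>\<delta> \<eta>. 0 < \<delta> \<Longrightarrow> 0 < \<eta> \<Longrightarrow>
      \<exists>(J::'b set) (F :: 'b \<Rightarrow> 'a::metric_space set). countable J \<and> A \<subseteq> (\<Union>j\<in>J. F j) \<and>
        (\<forall>j\<in>J. bounded (F j) \<and> diameter (F j) \<le> \<delta>) \<and>
        (\<forall>G\<subseteq>J. finite G \<longrightarrow> (\<Sum>j\<in>G. diameter (F j) powr s) \<le> \<eta>)"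
  shows "hausdorff_dim (A :: 'a set) \<le> ennreal s"
proof (rule hausdorff_dim_le_if_countable_covers[OF s])
  fix \<delta> \<eta> :: real assume d: "0 < \<delta>" and e: "0 < \<eta>"
  obtain J :: "'b set" and F where J: "countable J" "A \<subseteq> (\<Union>j\<in>J. F j)"
    and F: "\<And>j. j \<in> J \<Longrightarrow> bounded (F j)" "\<And>j. j \<in> J \<Longrightarrow> diameter (F j) \<le> \<delta>"
    and G: "\<And>G. G \<subseteq> J \<Longrightarrow> finite G \<Longrightarrow> (\<Sum>j\<in>G. diameter (F j) powr s) \<le> \<eta>"
    using cov[OF d e] by metis
  define U where "U n = (if n \<in> to_nat_on J ` J then F (from_nat_into J n) else {})" for n
  have inj: "inj_on (to_nat_on J) J" using J(1) by (rule inj_on_to_nat_on)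
  have "A \<subseteq> (\<Union>n. U n)"
  proof
    fix x assume "x \<in> A"
    then obtain j where "j \<in> J" "x \<in> F j" using J by auto
    then have "x \<in> U (to_nat_on J j)" using J(1) by (auto simp: U_def)
    then show "x \<in> (\<Union>n. U n)" by blast
  qed
  moreover have "bounded (U n) \<and> diameter (U n) \<le> \<delta>" for n
    using F J(1) d by (auto simp: U_def)
  moreover have "(\<Sum>n. ennreal (diameter (U n) powr s)) \<le> ennreal \<eta>"
  proof (rule suminf_le_const)
    fix N
    define G where "G = {j\<in>J. to_nat_on J j < N}"
    have finG: "finite G"
      by (rule finite_imageD[of "to_nat_on J"])
        (auto simp: G_def intro!: finite_subset[of _ "{..<N}"] inj_on_subset[OF inj])
    have "(\<Sum>n<N. diameter (U n) powr s) = (\<Sum>n\<in>to_nat_on J ` G. diameter (U n) powr s)"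
      by (rule sum.mono_neutral_right) (auto simp: G_def U_def)
    also have "\<dots> = (\<Sum>j\<in>G. diameter (F j) powr s)"
      using J(1) by (subst sum.reindex) (auto simp: G_def U_def intro!: inj_on_subset[OF inj] sum.cong)
    also have "\<dots> \<le> \<eta>" using finG by (intro G) (auto simp: G_def)
    finally show "(\<Sum>n<N. ennreal (diameter (U n) powr s)) \<le> ennreal \<eta>"
      by (simp add: ennreal_leI)
  qed simp
  ultimately show "\<exists>U::nat \<Rightarrow> 'a set. A \<subseteq> (\<Union>n. U n) \<and> (\<forall>n. bounded (U n) \<and> diameter (U n) \<le> \<delta>) \<and>
        (\<Sum>n. ennreal (diameter (U n) powr s)) \<le> ennreal \<eta>" by blast
qed

text \<open>A cover by open balls of positive radius is what a compactness argument can use. A set of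
diameter \<open>d\<close> lies in a ball about one of its points of any radius beyond \<open>d\<close>; the excess, which is
unavoidable for singletons, costs at most a geometric series because \<open>\<tau> > 0\<close>.\<close>
lemma ball_cover_if_hausdorff_dim_less:
  fixes A :: "'a::metric_space set"
  assumes less: "hausdorff_dim A < ennreal \<tau>" and \<eta>: "0 < \<eta>"
  shows "\<exists>(x::nat \<Rightarrow> 'a) r. (\<forall>n. 0 < r n) \<and> A \<subseteq> (\<Union>n. ball (x n) (r n)) \<and>
           (\<forall>N. (\<Sum>n<N. r n powr \<tau>) \<le> \<eta>)"
proof -
  obtain s where s: "0 \<le> s" "hausdorff_measure s A = 0" "ennreal s < ennreal \<tau>"
    using less unfolding hausdorff_dim_def by (auto simp: INF_less_iff)
  then have \<tau>: "0 < \<tau>" "s < \<tau>" by (auto simp: ennreal_less_iff)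
  have "hausdorff_premeasure s 1 A \<le> hausdorff_measure s A"
    unfolding hausdorff_measure_def by (rule SUP_upper) simp
  then have "hausdorff_premeasure s 1 A < ennreal (\<eta>/2)"
    using s(2) \<eta> by (simp add: ennreal_zero_less_divide)
  then obtain U where U: "U \<in> delta_covers 1 A"
    and sum: "(\<Sum>n. if U n = {} then 0 else ennreal (nn_power (diameter (U n)) s)) < ennreal (\<eta>/2)"
    unfolding hausdorff_premeasure_def by (auto simp: INF_less_iff)
  define d where "d n = (if U n = {} then 0 else diameter (U n))" for n
  have d0: "0 \<le> d n" for n using U by (auto simp: d_def delta_covers_def diameter_ge_0)
  have d1: "d n \<le> 1" for n using U by (auto simp: d_def delta_covers_def)
  have dU: "ennreal (d n powr \<tau>) \<le> (if U n = {} then 0 else ennreal (nn_power (diameter (U n)) s))" for n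
  proof (cases "U n = {}")
    case False
    have "d n powr \<tau> \<le> nn_power (d n) s"
    proof (cases "d n = 0")
      case True then show ?thesis by (simp add: nn_power_def)
    next
      case False
      then have "0 < d n" using d0[of n] by simp
      then show ?thesis using d1[of n] \<tau> s(1)
        by (auto simp: nn_power_def powr_le1 intro!: powr_mono')
    qed
    then show ?thesis using False by (auto simp: d_def intro: ennreal_leI)
  qed (simp add: d_def)
  have sumd: "(\<Sum>n<N. d n powr \<tau>) \<le> \<eta>/2" for N
  proof -
    have "ennreal (\<Sum>n<N. d n powr \<tau>) = (\<Sum>n<N. ennreal (d n powr \<tau>))" by simp
    also have "\<dots> \<le> (\<Sum>n<N. if U n = {} then 0 else ennreal (nn_power (diameter (U n)) s))"
      by (rule sum_mono) (rule dU)
    also have "\<dots> \<le> (\<Sum>n. if U n = {} then 0 else ennreal (nn_power (diameter (U n)) s))"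
      by (rule sum_le_suminf) auto
    also have "\<dots> \<le> ennreal (\<eta>/2)" using sum by simp
    finally show ?thesis using \<eta> by (subst (asm) ennreal_le_iff) auto
  qed
  have "\<exists>r>d n. r powr \<tau> \<le> d n powr \<tau> + (\<eta>/2) * (1/2)^Suc n" for n
  proof -
    have e: "0 < (\<eta>/2) * (1/2)^Suc n" using \<eta> by simp
    define r where "r = (d n powr \<tau> + (\<eta>/2) * (1/2)^Suc n) powr (1/\<tau>)"
    have "d n = (d n powr \<tau>) powr (1/\<tau>)" using \<tau> d0[of n] by (simp add: powr_powr)
    also have "\<dots> < r" unfolding r_def using \<tau> e by (intro powr_less_mono2) auto
    finally have "d n < r" .
    moreover have "r powr \<tau> = d n powr \<tau> + (\<eta>/2) * (1/2)^Suc n"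
      unfolding r_def using \<tau> e by (simp add: powr_powr add_nonneg_nonneg del: power_Suc)
    ultimately show ?thesis by auto
  qed
  then obtain r where r: "\<And>n. d n < r n"
    "\<And>n. r n powr \<tau> \<le> d n powr \<tau> + (\<eta>/2) * (1/2)^Suc n" by metis
  define x where "x n = (SOME y. y \<in> U n)" for n
  have "U n \<subseteq> ball (x n) (r n)" for n
  proof
    fix y assume y: "y \<in> U n"
    then have x: "x n \<in> U n" unfolding x_def by (metis someI)
    have "dist (x n) y \<le> diameter (U n)"
      using x y U by (intro diameter_bounded_bound) (auto simp: delta_covers_def)
    also have "\<dots> < r n" using r(1)[of n] y by (auto simp: d_def split: if_splits)
    finally show "y \<in> ball (x n) (r n)" by simp
  qed
  then have "A \<subseteq> (\<Union>n. ball (x n) (r n))" using U by (fastforce simp: delta_covers_def)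
  moreover have "0 < r n" for n using r(1) d0 by (meson le_less_trans)
  moreover have "(\<Sum>n<N. r n powr \<tau>) \<le> \<eta>" for N
  proof -
    have "(\<Sum>n<N. (1/2::real)^Suc n) \<le> 1"
    proof -
      have "(\<Sum>n<N. (1/2::real)^Suc n) = 1 - (1/2)^N" by (induction N) auto
      then show ?thesis by simp
    qed
    then have "(\<eta>/2) * (\<Sum>n<N. (1/2::real)^Suc n) \<le> \<eta>/2"
      using \<eta> by (intro mult_left_le) auto
    moreover have "(\<Sum>n<N. r n powr \<tau>) \<le> (\<Sum>n<N. d n powr \<tau> + (\<eta>/2) * (1/2)^Suc n)"
      by (intro sum_mono r)
    ultimately show ?thesis using sumd[of N]
      unfolding sum.distrib sum_distrib_left[symmetric] by linarith
  qed
  ultimately show ?thesis by blast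
qed

section \<open>Separated points in balls\<close>

text \<open>After rescaling the ball to a fixed one, this is total boundedness: two points in the same ball
of radius \<open>c/2\<close> are closer than \<open>c\<close>.\<close>
lemma card_separated_le:
  fixes c C :: real
  assumes c: "0 < c"
  shows "\<exists>M::nat. \<forall>r (x::'a::euclidean_space) P. 0 < r \<longrightarrow> finite P \<longrightarrow> P \<subseteq> cball x (C * r) \<longrightarrow>
     (\<forall>p\<in>P. \<forall>q\<in>P. p \<noteq> q \<longrightarrow> c * r \<le> dist p q) \<longrightarrow> card P \<le> M"
proof -
  have "\<forall>e>0. \<exists>k. finite k \<and> cball (0::'a) C \<subseteq> (\<Union>y\<in>k. ball y e)"
    using compact_cball[of "0::'a" C] unfolding compact_eq_totally_bounded by (rule conjunct2)
  then obtain k :: "'a set" where k: "finite k" "cball 0 C \<subseteq> (\<Union>y\<in>k. ball y (c/2))"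
    using c half_gt_zero by metis
  show ?thesis
  proof (intro exI[of _ "card k"] allI impI)
    fix r :: real and x :: 'a and P
    assume r: "0 < r" and P: "finite P" "P \<subseteq> cball x (C * r)"
      and sep: "\<forall>p\<in>P. \<forall>q\<in>P. p \<noteq> q \<longrightarrow> c * r \<le> dist p q"
    define h where "h p = (p - x) /\<^sub>R r" for p
    have hd: "dist (h p) (h q) = dist p q / r" for p q
      using r by (simp add: h_def dist_norm divide_inverse mult.commute
          flip: scaleR_diff_right)
    have "\<forall>p\<in>P. \<exists>y\<in>k. dist y (h p) < c/2"
    proof
      fix p assume "p \<in> P"
      then have "dist x p \<le> C * r" using P by auto
      then have "norm (h p) \<le> C"
        using r by (simp add: h_def dist_norm norm_minus_commute[of x p] pos_divide_le_eq
            divide_inverse_commute[symmetric])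
      then show "\<exists>y\<in>k. dist y (h p) < c/2" using k(2) by (force simp: subset_iff)
    qed
    then obtain g where g: "\<And>p. p \<in> P \<Longrightarrow> g p \<in> k" "\<And>p. p \<in> P \<Longrightarrow> dist (g p) (h p) < c/2"
      by metis
    have "inj_on g P"
    proof (rule inj_onI, rule ccontr)
      fix p q assume pq: "p \<in> P" "q \<in> P" "g p = g q" "p \<noteq> q"
      have "dist (h p) (h q) \<le> dist (g p) (h p) + dist (g q) (h q)"
        using pq(3) by (metis dist_commute dist_triangle)
      also have "\<dots> < c" using g(2)[OF pq(1)] g(2)[OF pq(2)] by simp
      finally have "dist p q < c * r" using r by (simp add: hd field_simps)
      then show False using sep pq by fastforce
    qed
    then show "card P \<le> card k" using g(1) k(1) by (intro card_inj_on_le) auto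
  qed
qed

section \<open>Words\<close>

lemma word_map_append: "word_map f (I @ J) = word_map f I \<circ> word_map f J"
  by (induction I) auto

lemma finite_words: "finite D \<Longrightarrow> finite (words D n)"
  unfolding words_def by (rule finite_lists_length_eq)

lemma words_0: "words D 0 = {[]}"
  by (auto simp: words_def)

lemma words_take: "I \<in> words D n \<Longrightarrow> k \<le> n \<Longrightarrow> take k I \<in> words D k"
  using set_take_subset by (fastforce simp: words_def)

lemma words_Suc_snoc: "words D (Suc n) = (\<lambda>(I, i). I @ [i]) ` (words D n \<times> D)"
proof (intro equalityI subsetI)
  fix I assume I: "I \<in> words D (Suc n)"
  then have "I = butlast I @ [last I]"
    by (intro append_butlast_last_id[symmetric]) (auto simp: words_def)
  moreover have "butlast I \<in> words D n"
    using I by (auto simp: words_def dest: in_set_butlastD)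
  moreover have "last I \<in> D"
    using I last_in_set[of I] by (cases I) (auto simp: words_def)
  ultimately show "I \<in> (\<lambda>(I, i). I @ [i]) ` (words D n \<times> D)" by force
qed (auto simp: words_def)

lemma sum_words_Suc:
  "(\<Sum>I\<in>words D (Suc n). g I) = (\<Sum>I\<in>words D n. \<Sum>i\<in>D. g (I @ [i]))"
  by (simp add: words_Suc_snoc sum.cartesian_product sum.reindex inj_on_def split_beta)

section \<open>Bounded distortion of conformal maps\<close>

lemma ln_diff_le:
  fixes a p q :: real
  assumes "0 < a" "a \<le> p" "a \<le> q"
  shows "ln p - ln q \<le> \<bar>p - q\<bar> / a"
proof -
  have "ln p - ln q = ln (p / q)" using assms by (simp add: ln_div)
  also have "\<dots> \<le> p / q - 1" using assms by (intro ln_le_minus_one) auto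
  also have "\<dots> = (p - q) / q" using assms by (simp add: field_simps)
  also have "\<dots> \<le> \<bar>p - q\<bar> / q" using assms by (intro divide_right_mono) auto
  also have "\<dots> \<le> \<bar>p - q\<bar> / a" using assms by (intro divide_left_mono) auto
  finally show ?thesis .
qed

lemma conformal_on_inverse_derivative:
  fixes f :: "'a::euclidean_space \<Rightarrow> 'a"
  assumes conf: "conformal_on V f f'" and V: "open V" and inj: "inj_on f V"
    and w: "w \<in> V" and pos: "0 < norm (f' w)"
  obtains h' where "(inv_into V f has_derivative h') (at (f w))" "onorm h' \<le> 1 / norm (f' w)"
proof -
  let ?L = "blinfun_apply (f' w)"
  have der: "\<And>x. x \<in> V \<Longrightarrow> (f has_derivative blinfun_apply (f' x)) (at x)"
    and nrm: "\<And>y. norm (?L y) = norm (f' w) * norm y"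
    using conf w by (auto simp: conformal_on_def)
  have lin: "linear ?L" by (simp add: blinfun.bounded_linear_right bounded_linear.linear)
  have "inj ?L"
  proof (rule injI)
    fix x y assume "?L x = ?L y"
    then have "norm (f' w) * norm (x - y) = 0"
      by (metis nrm blinfun.diff_right diff_self norm_zero)
    then show "x = y" using pos by simp
  qed
  then obtain h' where h': "linear h'" "\<And>x. h' (?L x) = x" "\<And>x. ?L (h' x) = x"
    using linear_injective_isomorphism[OF lin] by auto
  have "(inv_into V f has_derivative h') (at (f w))"
  proof (rule has_derivative_inverse_strong[OF V w])
    show "continuous_on V f"
      using der has_derivative_continuous by (intro continuous_at_imp_continuous_on) blast
    show "inv_into V f (f x) = x" if "x \<in> V" for x using inj that by simp
    show "(f has_derivative ?L) (at w)" using der w by simp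
    show "?L \<circ> h' = id" using h' by auto
  qed
  moreover have "onorm h' \<le> 1 / norm (f' w)"
  proof (rule onorm_le)
    fix y
    have "norm (f' w) * norm (h' y) = norm y" using nrm[of "h' y"] h'(3) by simp
    then show "norm (h' y) \<le> 1 / norm (f' w) * norm y" using pos by (simp add: field_simps)
  qed
  ultimately show ?thesis using that by blast
qed

text \<open>The quotient of distances differs from \<open>\<bar>f'\<bar>\<close> by at most the oscillation of \<open>\<bar>f'\<bar>\<close> near \<open>x\<close>. The
upper estimate is the mean value inequality for \<open>f\<close> on the segment from \<open>x\<close> to \<open>y\<close>, the lower one is
that for the inverse of \<open>f\<close> on the segment from \<open>f x\<close> to \<open>f y\<close>. Both segments must stay in the
domains \<open>V\<close> and \<open>f ` V\<close>, which are open; by compactness of \<open>S\<close> this holds below a uniform distance.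
For points farther apart both quantities are bounded above and below, so a large \<open>C\<close> suffices.\<close>
lemma conformal_log_ratio:
  fixes f :: "'a::euclidean_space \<Rightarrow> 'a"
  assumes conf: "conformal_on V f f'" and V: "open V" and inj: "inj_on f V"
    and lip: "1-lipschitz_on V f"
    and a: "0 < a" and bds: "\<And>x. x \<in> V \<Longrightarrow> a \<le> norm (f' x) \<and> norm (f' x) \<le> 1"
    and \<alpha>: "0 < \<alpha>" and c: "0 \<le> c"
    and hol: "\<And>x y. x \<in> V \<Longrightarrow> y \<in> V \<Longrightarrow> \<bar>norm (f' x) - norm (f' y)\<bar> \<le> c * norm (x - y) powr \<alpha>"
    and S: "compact S" "S \<subseteq> V"
  shows "\<exists>C\<ge>0. \<forall>x\<in>S. \<forall>y\<in>S. x \<noteq> y \<longrightarrow>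
     \<bar>ln (dist (f x) (f y) / dist x y) - ln (norm (f' x))\<bar> \<le> C * dist x y powr \<alpha>"
proof -
  define g where "g x = norm (f' x)" for x
  have der: "\<And>x. x \<in> V \<Longrightarrow> (f has_derivative blinfun_apply (f' x)) (at x)"
    using conf by (auto simp: conformal_on_def)
  have cont: "continuous_on V f"
    using der has_derivative_continuous by (intro continuous_at_imp_continuous_on) blast
  have ga: "\<And>x. x \<in> V \<Longrightarrow> a \<le> g x" "\<And>x. x \<in> V \<Longrightarrow> g x \<le> 1" "\<And>x. x \<in> V \<Longrightarrow> 0 < g x"
    using bds a by (force simp: g_def)+
  have lnhol: "ln (g x) - ln (g y) \<le> c / a * dist x y powr \<alpha>" if "x \<in> V" "y \<in> V" for x y
  proof -
    have "ln (g x) - ln (g y) \<le> \<bar>g x - g y\<bar> / a" using that a ga by (intro ln_diff_le) auto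
    also have "\<dots> \<le> (c * dist x y powr \<alpha>) / a"
      using hol[OF that] a by (intro divide_right_mono) (auto simp: g_def dist_norm)
    finally show ?thesis by simp
  qed
  obtain \<rho> where \<rho>: "0 < \<rho>" "(\<Union>x\<in>S. cball x \<rho>) \<subseteq> V"
    using compact_subset_open_imp_cball_epsilon_subset[OF S(1) V S(2)] by blast
  have ofV: "open (f ` V)" by (rule invariance_of_domain[OF cont V inj])
  have "compact (f ` S)" using S cont by (intro compact_continuous_image) (auto intro: continuous_on_subset)
  then obtain \<eta> where \<eta>: "0 < \<eta>" "(\<Union>x\<in>f ` S. cball x \<eta>) \<subseteq> f ` V"
    using compact_subset_open_imp_cball_epsilon_subset[OF _ ofV] S(2) by (metis image_mono)
  define \<Delta> where "\<Delta> = max (diameter S) 1"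
  have \<Delta>: "dist x y \<le> \<Delta>" "1 \<le> \<Delta>" if "x \<in> S" "y \<in> S" for x y
    using diameter_bounded_bound[OF compact_imp_bounded[OF S(1)] that] by (auto simp: \<Delta>_def)
  \<comment> \<open>one summand for each of the cases: near and far points, upper and lower estimate\<close>
  define C where "C = c / a + c / a * (1/a) powr \<alpha> + \<bar>ln a\<bar> / \<rho> powr \<alpha> + \<bar>ln (\<eta> / \<Delta>)\<bar> / \<eta> powr \<alpha>"
  have Cge: "c / a \<le> C" "c / a * (1/a) powr \<alpha> \<le> C" "\<bar>ln a\<bar> / \<rho> powr \<alpha> \<le> C" "\<bar>ln (\<eta> / \<Delta>)\<bar> / \<eta> powr \<alpha> \<le> C"
    using a c \<rho>(1) \<eta>(1) unfolding C_def by auto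
  have C0: "0 \<le> C" using Cge(1) a c by (meson divide_nonneg_pos order_trans)
  show ?thesis
  proof (intro exI[of _ C] conjI ballI impI C0)
    fix x y assume xS: "x \<in> S" and yS: "y \<in> S" and ne: "x \<noteq> y"
    define \<delta> where "\<delta> = dist x y"
    have \<delta>: "0 < \<delta>" using ne by (simp add: \<delta>_def)
    have xV: "x \<in> V" and yV: "y \<in> V" using xS yS S by auto
    define e where "e = dist (f x) (f y)"
    have e0: "0 < e" using inj xV yV ne by (auto simp: e_def inj_on_def)
    have e\<delta>: "e \<le> \<delta>" using lipschitz_onD[OF lip xV yV] by (simp add: e_def \<delta>_def)
    have upper: "ln (e / \<delta>) - ln (g x) \<le> C * \<delta> powr \<alpha>"
    proof (cases "\<delta> \<le> \<rho>")
      case True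
      have sub: "closed_segment x y \<subseteq> cball x \<rho>"
        using True \<rho>(1) by (intro closed_segment_subset) (auto simp: \<delta>_def)
      have sV: "closed_segment x y \<subseteq> V" using sub \<rho>(2) xS by blast
      define B where "B = g x * exp (c / a * \<delta> powr \<alpha>)"
      have "norm (f x - f y) \<le> B * norm (x - y)"
      proof (rule differentiable_bound[of "closed_segment x y" f "\<lambda>w. blinfun_apply (f' w)"])
        fix w assume w: "w \<in> closed_segment x y"
        then have wV: "w \<in> V" using sV by auto
        show "(f has_derivative blinfun_apply (f' w)) (at w within closed_segment x y)"
          using der[OF wV] has_derivative_at_withinI by blast
        have "dist w x \<le> \<delta>"
          using w dist_in_closed_segment[of w x y] by (simp add: \<delta>_def dist_commute)
        then have "c / a * dist w x powr \<alpha> \<le> c / a * \<delta> powr \<alpha>"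
          using a c \<alpha> by (intro mult_left_mono powr_mono2) auto
        then have "ln (g w) \<le> ln (g x) + c / a * \<delta> powr \<alpha>"
          using lnhol[OF wV xV] by simp
        also have "\<dots> = ln B" using ga(3)[OF xV] by (simp add: B_def ln_mult)
        finally have "g w \<le> B" using ga(3)[OF xV] ga(3)[OF wV] by (subst (asm) ln_le_cancel_iff) (auto simp: B_def)
        then show "onorm (blinfun_apply (f' w)) \<le> B" by (simp add: g_def norm_blinfun.rep_eq)
      qed auto
      then have "e / \<delta> \<le> B" using \<delta> by (simp add: e_def \<delta>_def dist_norm pos_divide_le_eq)
      then have "ln (e / \<delta>) \<le> ln B" using e0 \<delta> by (intro ln_mono) auto
      also have "ln B = ln (g x) + c / a * \<delta> powr \<alpha>" using ga(3)[OF xV] by (simp add: B_def ln_mult)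
      finally show ?thesis using mult_right_mono[OF Cge(1), of "\<delta> powr \<alpha>"] by simp
    next
      case False
      have "ln (e / \<delta>) \<le> 0" using e\<delta> e0 \<delta> by simp
      moreover have "ln a \<le> ln (g x)" using ga(1)[OF xV] a by (intro ln_mono) auto
      ultimately have "ln (e / \<delta>) - ln (g x) \<le> \<bar>ln a\<bar> / \<rho> powr \<alpha> * \<rho> powr \<alpha>" using \<rho>(1) by simp
      also have "\<dots> \<le> C * \<delta> powr \<alpha>"
        using False \<rho>(1) \<alpha> C0 Cge by (intro mult_mono powr_mono2) auto
      finally show ?thesis .
    qed
    have lower: "ln (g x) - ln (e / \<delta>) \<le> C * \<delta> powr \<alpha>"
    proof (cases "e \<le> \<eta>")
      case True
      define h where "h = inv_into V f"
      have sub: "closed_segment (f x) (f y) \<subseteq> cball (f x) \<eta>"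
        using True \<eta>(1) by (intro closed_segment_subset) (auto simp: e_def)
      have sV: "closed_segment (f x) (f y) \<subseteq> f ` V" using sub \<eta>(2) xS by blast
      have hx: "h (f x) = x" "h (f y) = y" using inj xV yV by (auto simp: h_def)
      have "\<forall>p\<in>f ` V. \<exists>h'. (h has_derivative h') (at p) \<and> onorm h' \<le> 1 / g (h p)"
      proof
        fix p assume "p \<in> f ` V"
        then obtain w where w: "w \<in> V" "p = f w" by auto
        then show "\<exists>h'. (h has_derivative h') (at p) \<and> onorm h' \<le> 1 / g (h p)"
          using conformal_on_inverse_derivative[OF conf V inj w(1)] ga(3)[OF w(1)] inj
          unfolding h_def g_def by (metis inv_into_f_f)
      qed
      then obtain h' where h': "\<And>p. p \<in> f ` V \<Longrightarrow> (h has_derivative h' p) (at p)"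
        "\<And>p. p \<in> f ` V \<Longrightarrow> onorm (h' p) \<le> 1 / g (h p)" by metis
      have hV: "h p \<in> V" if "p \<in> f ` V" for p using that by (simp add: h_def inv_into_into)
      \<comment> \<open>a first, crude use of the mean value inequality locates the preimage of the segment\<close>
      have near: "dist (h p) x \<le> \<delta> / a" if p: "p \<in> closed_segment (f x) (f y)" for p
      proof -
        have "norm (h p - h (f x)) \<le> (1 / a) * norm (p - f x)"
        proof (rule differentiable_bound[of "closed_segment (f x) (f y)" h h'])
          fix q assume "q \<in> closed_segment (f x) (f y)"
          then have q: "q \<in> f ` V" using sV by auto
          then show "(h has_derivative h' q) (at q within closed_segment (f x) (f y))"
            using h'(1) has_derivative_at_withinI by blast
          have "1 / g (h q) \<le> 1 / a" using ga[OF hV[OF q]] a by (intro divide_left_mono) auto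
          then show "onorm (h' q) \<le> 1 / a" using h'(2)[OF q] by simp
        qed (use p in auto)
        also have "norm (p - f x) \<le> e"
          using p dist_in_closed_segment[of p "f x" "f y"] by (simp add: e_def dist_norm norm_minus_commute)
        finally show ?thesis using a e\<delta> hx by (simp add: dist_norm field_simps mult_left_mono)
      qed
      define t where "t = c / a * (1/a) powr \<alpha> * \<delta> powr \<alpha>"
      have "norm (h (f x) - h (f y)) \<le> (exp t / g x) * norm (f x - f y)"
      proof (rule differentiable_bound[of "closed_segment (f x) (f y)" h h'])
        fix p assume p: "p \<in> closed_segment (f x) (f y)"
        then have pV: "p \<in> f ` V" using sV by auto
        then show "(h has_derivative h' p) (at p within closed_segment (f x) (f y))"
          using h'(1) has_derivative_at_withinI by blast
        have "ln (g x) - ln (g (h p)) \<le> c / a * dist x (h p) powr \<alpha>"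
          by (rule lnhol[OF xV hV[OF pV]])
        also have "\<dots> \<le> c / a * (\<delta> / a) powr \<alpha>"
          using near[OF p] a c \<alpha> by (intro mult_left_mono powr_mono2) (auto simp: dist_commute)
        also have "\<dots> = t" using a \<delta> by (simp add: t_def powr_divide)
        finally have "ln (g x) \<le> ln (exp t * g (h p))"
          using ga(3)[OF hV[OF pV]] by (simp add: ln_mult)
        then have "g x \<le> exp t * g (h p)"
          using ga(3)[OF xV] ga(3)[OF hV[OF pV]] by (subst (asm) ln_le_cancel_iff) auto
        then have "1 / g (h p) \<le> exp t / g x"
          using ga(3)[OF xV] ga(3)[OF hV[OF pV]] by (simp add: field_simps)
        then show "onorm (h' p) \<le> exp t / g x" using h'(2)[OF pV] by simp
      qed auto
      then have "\<delta> \<le> exp t / g x * e" by (simp add: hx e_def \<delta>_def dist_norm)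
      then have "g x \<le> exp t * (e / \<delta>)" using ga(3)[OF xV] \<delta> by (simp add: field_simps)
      then have "ln (g x) \<le> ln (exp t * (e / \<delta>))" using ga(3)[OF xV] by (intro ln_mono) auto
      also have "\<dots> = t + ln (e / \<delta>)" using e0 \<delta> by (subst ln_mult) auto
      finally show ?thesis using mult_right_mono[OF Cge(2), of "\<delta> powr \<alpha>"] by (simp add: t_def)
    next
      case False
      have "\<eta> / \<Delta> \<le> e / \<delta>"
        using False \<Delta>[OF xS yS] e0 \<delta> \<eta>(1) by (intro frac_le) (auto simp: \<delta>_def)
      then have "ln (\<eta> / \<Delta>) \<le> ln (e / \<delta>)" using \<eta>(1) \<Delta>(2)[OF xS yS] by (intro ln_mono) auto
      moreover have "ln (g x) \<le> 0" using ga[OF xV] by simp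
      ultimately have "ln (g x) - ln (e / \<delta>) \<le> \<bar>ln (\<eta> / \<Delta>)\<bar> / \<eta> powr \<alpha> * \<eta> powr \<alpha>" using \<eta>(1) by simp
      also have "\<dots> \<le> C * \<delta> powr \<alpha>"
        using False e\<delta> \<eta>(1) \<alpha> C0 Cge by (intro mult_mono powr_mono2) auto
      finally show ?thesis .
    qed
    show "\<bar>ln (dist (f x) (f y) / dist x y) - ln (norm (f' x))\<bar> \<le> C * dist x y powr \<alpha>"
      using upper lower by (simp add: e_def \<delta>_def g_def abs_le_iff)
  qed
qed

lemma word_map_in: "(\<And>i. i \<in> D \<Longrightarrow> f i ` S \<subseteq> S) \<Longrightarrow> set I \<subseteq> D \<Longrightarrow> x \<in> S \<Longrightarrow> word_map f I x \<in> S"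
  by (induction I) auto

lemma dist_word_map_le:
  assumes "\<And>i. i \<in> D \<Longrightarrow> f i ` S \<subseteq> S" "0 \<le> r"
    and "\<And>i x y. i \<in> D \<Longrightarrow> x \<in> S \<Longrightarrow> y \<in> S \<Longrightarrow> dist (f i x) (f i y) \<le> r * dist x y"
    and "set I \<subseteq> D" "x \<in> S" "y \<in> S"
  shows "dist (word_map f I x) (word_map f I y) \<le> r ^ length I * dist x y"
  using assms(4)
proof (induction I)
  case (Cons i I)
  have "dist (word_map f (i # I) x) (word_map f (i # I) y)
      \<le> r * dist (word_map f I x) (word_map f I y)"
    using Cons.prems assms word_map_in[of D f S I] by auto
  also have "\<dots> \<le> r * (r ^ length I * dist x y)"
    using Cons assms(2) by (intro mult_left_mono) auto
  finally show ?case by simp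
qed simp

text \<open>The logarithm of the ratio of distances telescopes along the word. After \<open>j\<close> maps the points are
within \<open>r\<^sup>j\<close> times the diameter of \<open>S\<close>, so the errors \<open>C * dist powr \<alpha>\<close> sum to a geometric series and
the ratio is \<open>GI I x\<close> up to a bounded error \<open>C'\<close>. The ratio is symmetric in its two points, so \<open>GI I\<close>
varies by at most \<open>2 * C'\<close>, which allows one to compare two arbitrary pairs.\<close>
lemma bounded_distortion:
  fixes f :: "'i \<Rightarrow> 'a::metric_space \<Rightarrow> 'a"
  assumes maps: "\<And>i. i \<in> D \<Longrightarrow> f i ` S \<subseteq> S" and inj: "\<And>i. i \<in> D \<Longrightarrow> inj_on (f i) S"
    and r: "0 < r" "r < 1"
    and contr: "\<And>i x y. i \<in> D \<Longrightarrow> x \<in> S \<Longrightarrow> y \<in> S \<Longrightarrow> dist (f i x) (f i y) \<le> r * dist x y"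
    and bdd: "bounded S" and \<alpha>: "0 < \<alpha>" and C: "0 \<le> C"
    and G: "\<And>i x y. i \<in> D \<Longrightarrow> x \<in> S \<Longrightarrow> y \<in> S \<Longrightarrow> x \<noteq> y \<Longrightarrow>
       \<bar>ln (dist (f i x) (f i y) / dist x y) - G i x\<bar> \<le> C * dist x y powr \<alpha>"
  shows "\<exists>K\<ge>1. \<forall>I x y x' y'. set I \<subseteq> D \<longrightarrow> x \<in> S \<longrightarrow> y \<in> S \<longrightarrow> x' \<in> S \<longrightarrow> y' \<in> S \<longrightarrow>
     dist (word_map f I x) (word_map f I y) * dist x' y'
       \<le> K * dist (word_map f I x') (word_map f I y') * dist x y"
proof -
  define \<Delta> where "\<Delta> = diameter S"
  have \<Delta>: "dist x y \<le> \<Delta>" if "x \<in> S" "y \<in> S" for x y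
    using diameter_bounded_bound[OF bdd that] by (simp add: \<Delta>_def)
  have \<Delta>0: "0 \<le> \<Delta>" using bdd by (simp add: \<Delta>_def diameter_ge_0)
  define GI where "GI = rec_list (\<lambda>_. 0) (\<lambda>i I R x. G i (word_map f I x) + R x)"
  have GI[simp]: "GI [] x = 0" "GI (i # I) x = G i (word_map f I x) + GI I x" for i I x
    by (auto simp: GI_def)
  define q where "q = r powr \<alpha>"
  have q: "0 < q" "q < 1" using r \<alpha> powr_less_mono2[of \<alpha> r 1] by (auto simp: q_def)
  define C' where "C' = C * \<Delta> powr \<alpha> / (1 - q)"
  define R where "R I x y = ln (dist (word_map f I x) (word_map f I y) / dist x y)" for I x y
  have wS: "word_map f I x \<in> S" if "set I \<subseteq> D" "x \<in> S" for I x
    using word_map_in[of D f S I x] maps that by auto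
  have ne: "word_map f I x \<noteq> word_map f I y" if "set I \<subseteq> D" "x \<in> S" "y \<in> S" "x \<noteq> y" for I x y
    using that(1)
  proof (induction I)
    case (Cons i I)
    then show ?case using inj[of i] wS[of I x] wS[of I y] that by (auto simp: inj_on_def)
  qed (use that in simp)
  have main: "\<bar>R I x y - GI I x\<bar> \<le> C * \<Delta> powr \<alpha> * (\<Sum>j<length I. q ^ j)"
    if "set I \<subseteq> D" "x \<in> S" "y \<in> S" "x \<noteq> y" for I x y
    using that(1)
  proof (induction I)
    case Nil then show ?case using that by (simp add: R_def)
  next
    case (Cons i I)
    let ?x = "word_map f I x" and ?y = "word_map f I y"
    have I: "set I \<subseteq> D" "i \<in> D" using Cons.prems by auto
    have S: "?x \<in> S" "?y \<in> S" "?x \<noteq> ?y" "f i ?x \<noteq> f i ?y"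
      using wS ne[of I x y] ne[of "i # I" x y] I that by auto
    have "R (i # I) x y = ln (dist (f i ?x) (f i ?y) / dist ?x ?y * (dist ?x ?y / dist x y))"
      using S by (simp add: R_def)
    also have "\<dots> = ln (dist (f i ?x) (f i ?y) / dist ?x ?y) + R I x y"
      unfolding R_def using S that by (intro ln_mult_pos) auto
    finally have "\<bar>R (i # I) x y - GI (i # I) x\<bar>
        \<le> \<bar>ln (dist (f i ?x) (f i ?y) / dist ?x ?y) - G i ?x\<bar> + \<bar>R I x y - GI I x\<bar>" by simp
    also have "\<dots> \<le> C * dist ?x ?y powr \<alpha> + C * \<Delta> powr \<alpha> * (\<Sum>j<length I. q ^ j)"
      using G[OF I(2) S(1-3)] Cons.IH[OF I(1)] by simp
    finally have step: "\<bar>R (i # I) x y - GI (i # I) x\<bar>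
        \<le> C * dist ?x ?y powr \<alpha> + C * \<Delta> powr \<alpha> * (\<Sum>j<length I. q ^ j)" .
    have "dist ?x ?y powr \<alpha> \<le> (r ^ length I * \<Delta>) powr \<alpha>"
    proof (rule powr_mono2)
      have "dist ?x ?y \<le> r ^ length I * dist x y"
        using dist_word_map_le[of D f S r I x y] maps contr r I(1) that by auto
      also have "\<dots> \<le> r ^ length I * \<Delta>" using \<Delta>[OF that(2,3)] r by (intro mult_left_mono) auto
      finally show "dist ?x ?y \<le> r ^ length I * \<Delta>" .
    qed (use \<alpha> in auto)
    also have "(r ^ length I * \<Delta>) powr \<alpha> = q ^ length I * \<Delta> powr \<alpha>"
      using r \<Delta>0 by (simp add: powr_mult q_def powr_powr powr_realpow[symmetric] mult.commute)
    finally have "C * dist ?x ?y powr \<alpha> \<le> C * (q ^ length I * \<Delta> powr \<alpha>)"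
      using C by (rule mult_left_mono)
    then show ?case using step by (simp add: algebra_simps)
  qed
  have main': "\<bar>R I x y - GI I x\<bar> \<le> C'" if "set I \<subseteq> D" "x \<in> S" "y \<in> S" "x \<noteq> y" for I x y
  proof -
    have "(\<Sum>j<length I. q ^ j) = (1 - q ^ length I) / (1 - q)" using q by (simp add: sum_gp_strict)
    also have "\<dots> \<le> 1 / (1 - q)" using q by (intro divide_right_mono) auto
    finally have "C * \<Delta> powr \<alpha> * (\<Sum>j<length I. q ^ j) \<le> C * \<Delta> powr \<alpha> * (1 / (1 - q))"
      using C by (intro mult_left_mono) auto
    then show ?thesis using main[OF that] by (simp add: C'_def)
  qed
  have sym: "R I x y = R I y x" for I x y by (simp add: R_def dist_commute)
  have C'0: "0 \<le> C'" using C q by (simp add: C'_def)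
  show ?thesis
  proof (intro exI[of _ "exp (4 * C')"] conjI allI impI)
    show "1 \<le> exp (4 * C')" using C'0 by simp
    fix I x y x' y'
    assume *: "set I \<subseteq> D" "x \<in> S" "y \<in> S" "x' \<in> S" "y' \<in> S"
    show "dist (word_map f I x) (word_map f I y) * dist x' y'
       \<le> exp (4 * C') * dist (word_map f I x') (word_map f I y') * dist x y"
    proof (cases "x = y \<or> x' = y'")
      case False
      have "\<bar>GI I x - GI I x'\<bar> \<le> 2 * C'"
      proof (cases "x = x'")
        case False
        then show ?thesis using main'[of I x x'] main'[of I x' x] sym[of I x x'] * by simp
      qed (use C'0 in simp)
      then have "R I x y \<le> 4 * C' + R I x' y'"
        using main'[of I x y] main'[of I x' y'] * False by linarith
      then have "exp (R I x y) \<le> exp (4 * C') * exp (R I x' y')"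
        by (simp flip: exp_add)
      then have "dist (word_map f I x) (word_map f I y) / dist x y
          \<le> exp (4 * C') * (dist (word_map f I x') (word_map f I y') / dist x' y')"
        using ne[of I x y] ne[of I x' y'] * False by (simp add: R_def)
      then show ?thesis using False by (simp add: field_simps)
    qed auto
  qed
qed

section \<open>Iterated function systems with bounded distortion\<close>

text \<open>The set \<open>S\<close>, in applications a neighbourhood of \<open>X\<close>, is where distances are controlled. The
assumption \<open>distort\<close> compares the ratios \<open>dist (\<phi>\<^sub>I x) (\<phi>\<^sub>I y) / dist x y\<close> of two pairs of points; it is
multiplied out so that coinciding points need no exception. The set \<open>U\<close> witnesses the open set
condition, and the ball about \<open>u\<close> is the seed whose images \<open>\<phi>\<^sub>I(u)\<close> are well separated.\<close>
locale distorted_ifs =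
  fixes A :: "'b set" and f :: "'b \<Rightarrow> 'a \<Rightarrow> 'a::euclidean_space"
    and X S U :: "'a set" and r K a\<^sub>0 :: real and u :: 'a
  assumes finA: "finite A"
    and compact_X: "compact X" and X_ne: "X \<noteq> {}" and X_eq: "X = (\<Union>a\<in>A. f a ` X)"
    and diam_X: "0 < diameter X" and XS: "X \<subseteq> S" and bdd_S: "bounded S"
    and maps_S: "a \<in> A \<Longrightarrow> f a ` S \<subseteq> S" and inj_S: "a \<in> A \<Longrightarrow> inj_on (f a) S"
    and r_pos: "0 < r" and r_less: "r < 1"
    and contr: "a \<in> A \<Longrightarrow> x \<in> S \<Longrightarrow> y \<in> S \<Longrightarrow> dist (f a x) (f a y) \<le> r * dist x y"
    and K_ge: "1 \<le> K"
    and distort: "set I \<subseteq> A \<Longrightarrow> x \<in> S \<Longrightarrow> y \<in> S \<Longrightarrow> x' \<in> S \<Longrightarrow> y' \<in> S \<Longrightarrow>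
      dist (word_map f I x) (word_map f I y) * dist x' y'
        \<le> K * dist (word_map f I x') (word_map f I y') * dist x y"
    and maps_U: "a \<in> A \<Longrightarrow> f a ` U \<subseteq> U"
    and disj_U: "a \<in> A \<Longrightarrow> b \<in> A \<Longrightarrow> a \<noteq> b \<Longrightarrow> f a ` U \<inter> f b ` U = {}"
    and inj_U: "a \<in> A \<Longrightarrow> inj_on (f a) U"
    and a0_pos: "0 < a\<^sub>0" and seed: "cball u a\<^sub>0 \<subseteq> U \<inter> S"
begin

abbreviation "F \<equiv> word_map f"
abbreviation "cyl I \<equiv> F I ` X"
definition "d I = diameter (cyl I)"

lemma K_pos: "0 < K" using K_ge by simp

lemma A_ne: "A \<noteq> {}" using X_ne X_eq by auto

lemma F_S: "set I \<subseteq> A \<Longrightarrow> x \<in> S \<Longrightarrow> F I x \<in> S"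
  using word_map_in[of A f S I x] maps_S by auto

lemma F_X: "set I \<subseteq> A \<Longrightarrow> x \<in> X \<Longrightarrow> F I x \<in> X"
  using word_map_in[of A f X I x] X_eq by auto

lemma F_U: "set I \<subseteq> A \<Longrightarrow> x \<in> U \<Longrightarrow> F I x \<in> U"
  using word_map_in[of A f U I x] maps_U by auto

lemma F_inj: "set I \<subseteq> A \<Longrightarrow> inj_on (F I) S"
proof (induction I)
  case (Cons i I)
  have "F I ` S \<subseteq> S" using Cons.prems F_S[of I] by auto
  then have "inj_on (f i) (F I ` S)" using Cons.prems inj_S[of i] by (auto intro: inj_on_subset)
  moreover have "inj_on (F I) S" using Cons by simp
  ultimately show ?case unfolding word_map.simps by (intro comp_inj_on)
qed simp

lemma F_contr: "set I \<subseteq> A \<Longrightarrow> x \<in> S \<Longrightarrow> y \<in> S \<Longrightarrow> dist (F I x) (F I y) \<le> r ^ length I * dist x y"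
  using dist_word_map_le[of A f S r I x y] maps_S contr r_pos by auto

lemma F_cont: "set I \<subseteq> A \<Longrightarrow> continuous_on S (F I)"
  by (rule lipschitz_on_continuous_on[of "r ^ length I"])
    (use F_contr r_pos in \<open>auto intro!: lipschitz_onI\<close>)

lemma compact_cyl: "set I \<subseteq> A \<Longrightarrow> compact (cyl I)"
  using compact_X F_cont XS by (meson compact_continuous_image continuous_on_subset)

lemma cyl_append: "set J \<subseteq> A \<Longrightarrow> cyl (I @ J) \<subseteq> cyl I"
  using F_X[of J] by (auto simp: word_map_append)

lemma cyl_take: "set I \<subseteq> A \<Longrightarrow> cyl I \<subseteq> cyl (take n I)"
  using cyl_append[of "drop n I" "take n I"] set_drop_subset[of n I] by auto

lemma cyl_X: "set I \<subseteq> A \<Longrightarrow> cyl I \<subseteq> X"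
  using F_X by auto

lemma cyl_split: "cyl I = (\<Union>a\<in>A. cyl (I @ [a]))"
proof -
  have "cyl I = F I ` (\<Union>a\<in>A. f a ` X)" using X_eq by simp
  also have "\<dots> = (\<Union>a\<in>A. cyl (I @ [a]))" by (auto simp: word_map_append)
  finally show ?thesis .
qed

lemma X_words: "X = (\<Union>I\<in>words A n. cyl I)"
proof (induction n)
  case (Suc n)
  have "(\<Union>I\<in>words A (Suc n). cyl I) = (\<Union>I\<in>words A n. \<Union>a\<in>A. cyl (I @ [a]))"
    by (force simp: words_Suc_snoc)
  also have "\<dots> = (\<Union>I\<in>words A n. cyl I)" by (simp only: cyl_split[symmetric])
  finally show ?case using Suc by simp
qed (simp add: words_0)

lemma dist_le_d: "set I \<subseteq> A \<Longrightarrow> x \<in> cyl I \<Longrightarrow> y \<in> cyl I \<Longrightarrow> dist x y \<le> d I"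
  unfolding d_def by (rule diameter_bounded_bound) (auto intro: compact_imp_bounded compact_cyl)

lemma d_attained:
  assumes "set I \<subseteq> A"
  obtains x y where "x \<in> X" "y \<in> X" "dist (F I x) (F I y) = d I"
proof -
  have "cyl I \<noteq> {}" using X_ne by auto
  then have "\<exists>p\<in>cyl I. \<exists>q\<in>cyl I. dist p q = d I"
    using diameter_compact_attained[of "cyl I"] compact_cyl[OF assms] unfolding d_def by metis
  then show ?thesis using that by auto
qed

lemma d_mono: "set I \<subseteq> A \<Longrightarrow> cyl J \<subseteq> cyl I \<Longrightarrow> d J \<le> d I"
  unfolding d_def by (rule diameter_subset) (auto intro: compact_imp_bounded compact_cyl)

lemma d_Nil: "d [] = diameter X"
  by (simp add: d_def)

lemma d_Nil_pos: "0 < d []"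
  using diam_X by (simp add: d_Nil)

lemma d_pos:
  assumes "set I \<subseteq> A" shows "0 < d I"
proof -
  obtain x y where xy: "x \<in> X" "y \<in> X" "dist x y = d []" using d_attained[of "[]"] by auto
  then have "x \<in> S" "y \<in> S" "x \<noteq> y" using XS d_Nil_pos by auto
  then have "F I x \<noteq> F I y" using F_inj[OF assms] by (auto simp: inj_on_def)
  then show ?thesis using dist_le_d[OF assms, of "F I x" "F I y"] xy(1,2)
    by (metis image_eqI less_le_trans zero_less_dist_iff)
qed

lemma d_le: "set I \<subseteq> A \<Longrightarrow> d I \<le> r ^ length I * d []"
proof -
  assume I: "set I \<subseteq> A"
  then obtain x y where xy: "x \<in> X" "y \<in> X" "dist (F I x) (F I y) = d I" by (rule d_attained)
  have "dist x y \<le> d []" using dist_le_d[of "[]" x y] xy by simp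
  then have "r ^ length I * dist x y \<le> r ^ length I * d []" using r_pos by (intro mult_left_mono) auto
  moreover have "x \<in> S" "y \<in> S" using xy XS by auto
  ultimately show ?thesis using F_contr[OF I, of x y] xy by auto
qed

text \<open>Together with the next lemma: \<open>F I\<close> multiplies distances in \<open>S\<close> by \<open>d I / d []\<close>, up to the factor \<open>K\<close>.\<close>
lemma dist_F_le:
  assumes "set I \<subseteq> A" "x \<in> S" "y \<in> S"
  shows "dist (F I x) (F I y) * d [] \<le> K * d I * dist x y"
proof -
  obtain p q where pq: "p \<in> X" "q \<in> X" "dist p q = d []" using d_attained[of "[]"] by auto
  have "dist (F I x) (F I y) * d [] \<le> K * dist (F I p) (F I q) * dist x y"
    using distort[OF assms, of p q] pq XS by auto
  also have "\<dots> \<le> K * d I * dist x y"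
    using dist_le_d[OF assms(1)] pq K_pos by (intro mult_right_mono mult_left_mono) auto
  finally show ?thesis .
qed

lemma dist_F_ge:
  assumes "set I \<subseteq> A" "x \<in> S" "y \<in> S"
  shows "d I * dist x y \<le> K * d [] * dist (F I x) (F I y)"
proof -
  obtain p q where pq: "p \<in> X" "q \<in> X" "dist (F I p) (F I q) = d I"
    using d_attained[OF assms(1)] by auto
  have "dist p q \<le> d []" using dist_le_d[of "[]" p q] pq by auto
  have "d I * dist x y \<le> K * dist (F I x) (F I y) * dist p q"
    using distort[OF assms(1), of p q x y] assms pq XS by auto
  also have "\<dots> \<le> K * dist (F I x) (F I y) * d []"
    using \<open>dist p q \<le> d []\<close> K_pos by (intro mult_left_mono) auto
  finally show ?thesis by (simp add: mult.commute mult.left_commute)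
qed

lemma d_append_ge:
  assumes "set I \<subseteq> A" "set J \<subseteq> A"
  shows "d I * d J \<le> K * d [] * d (I @ J)"
proof -
  obtain x y where xy: "x \<in> X" "y \<in> X" "dist (F J x) (F J y) = d J"
    using d_attained[OF assms(2)] by auto
  have "d I * d J \<le> K * d [] * dist (F I (F J x)) (F I (F J y))"
    using dist_F_ge[OF assms(1), of "F J x" "F J y"] xy F_S[OF assms(2)] XS by auto
  also have "\<dots> \<le> K * d [] * d (I @ J)"
    using dist_le_d[of "I @ J" "F (I @ J) x" "F (I @ J) y"] xy assms K_pos d_Nil_pos
    by (intro mult_left_mono) (auto simp: word_map_append)
  finally show ?thesis .
qed

text \<open>Thus the first prefix of a word whose cylinder has size at most \<open>\<rho>\<close> has size comparable to \<open>\<rho>\<close>.\<close>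
lemma letter_loss: "\<exists>\<kappa>. 0 < \<kappa> \<and> (\<forall>I a. set I \<subseteq> A \<longrightarrow> a \<in> A \<longrightarrow> \<kappa> * d I \<le> d (I @ [a]))"
proof -
  define \<kappa> where "\<kappa> = Min ((\<lambda>a. d [a]) ` A) / (K * d [])"
  have "0 < \<kappa>" unfolding \<kappa>_def using finA A_ne d_pos K_pos d_Nil_pos by auto
  moreover have "\<kappa> * d I \<le> d (I @ [a])" if I: "set I \<subseteq> A" "a \<in> A" for I a
  proof -
    have "\<kappa> * d I \<le> d [a] / (K * d []) * d I"
      unfolding \<kappa>_def using finA I d_pos[OF I(1)] K_pos d_Nil_pos
      by (intro mult_right_mono divide_right_mono) auto
    also have "\<dots> \<le> d (I @ [a])"
      using d_append_ge[OF I(1), of "[a]"] I K_pos d_Nil_pos by (simp add: field_simps)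
    finally show ?thesis .
  qed
  ultimately show ?thesis by blast
qed

lemma d_small:
  assumes "0 < e"
  shows "\<exists>n. \<forall>I. set I \<subseteq> A \<longrightarrow> n \<le> length I \<longrightarrow> d I \<le> e"
proof -
  obtain n where n: "r ^ n < e / d []"
    using real_arch_pow_inv[of "e / d []" r] assms d_Nil_pos r_less by auto
  have "d I \<le> e" if "set I \<subseteq> A" "n \<le> length I" for I
  proof -
    have "d I \<le> r ^ length I * d []" using d_le that by simp
    also have "\<dots> \<le> r ^ n * d []"
      using that r_pos r_less d_Nil_pos by (intro mult_right_mono power_decreasing) auto
    also have "\<dots> \<le> e" using n d_Nil_pos by (simp add: field_simps)
    finally show ?thesis .
  qed
  then show ?thesis by blast
qed

lemma small_power:
  assumes "\<tau> < \<sigma>"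
  shows "\<exists>m. \<forall>I. set I \<subseteq> A \<longrightarrow> m \<le> length I \<longrightarrow> E * d I powr \<sigma> \<le> d I powr \<tau>"
proof -
  define e where "e = (1 / max E 1) powr (1 / (\<sigma> - \<tau>))"
  have "0 < e" by (simp add: e_def)
  then obtain m where m: "\<And>I. set I \<subseteq> A \<Longrightarrow> m \<le> length I \<Longrightarrow> d I \<le> e"
    using d_small by blast
  have "E * d I powr \<sigma> \<le> d I powr \<tau>" if I: "set I \<subseteq> A" "m \<le> length I" for I
  proof -
    have "d I powr (\<sigma> - \<tau>) \<le> e powr (\<sigma> - \<tau>)"
      using m[OF I] d_pos[OF I(1)] assms by (intro powr_mono2) auto
    also have "\<dots> = 1 / max E 1" using assms by (simp add: e_def powr_powr)
    finally have "max E 1 * d I powr (\<sigma> - \<tau>) \<le> 1" by (simp add: field_simps)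
    then have "max E 1 * d I powr (\<sigma> - \<tau>) * d I powr \<tau> \<le> 1 * d I powr \<tau>"
      by (intro mult_right_mono) auto
    also have "max E 1 * d I powr (\<sigma> - \<tau>) * d I powr \<tau> = max E 1 * d I powr \<sigma>"
      by (simp add: powr_add[symmetric] mult.assoc)
    finally have "max E 1 * d I powr \<sigma> \<le> d I powr \<tau>" by simp
    then show ?thesis by (meson max.cobounded1 mult_right_mono order_trans powr_ge_zero)
  qed
  then show ?thesis by blast
qed

subsection \<open>Counting cylinders near a ball\<close>

lemma F_U_disjoint:
  assumes "set I \<subseteq> A" "set J \<subseteq> A" "\<nexists>L. J = I @ L" "\<nexists>L. I = J @ L"
  shows "F I ` U \<inter> F J ` U = {}"
  using assms
proof (induction I arbitrary: J)
  case (Cons i I)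
  then obtain j J' where J: "J = j # J'" by (cases J) auto
  show ?case
  proof (cases "i = j")
    case False
    have "F (i # I) ` U \<subseteq> f i ` U" "F J ` U \<subseteq> f j ` U"
      using Cons.prems F_U[of I] F_U[of J'] by (auto simp: J)
    then show ?thesis using disj_U[of i j] False Cons.prems by (auto simp: J)
  next
    case True
    have "F I ` U \<inter> F J' ` U = {}"
      using Cons.prems by (intro Cons.IH) (auto simp: J True)
    moreover have "F I ` U \<subseteq> U" "F J' ` U \<subseteq> U" using Cons.prems F_U by (auto simp: J)
    ultimately have "f i ` (F I ` U) \<inter> f i ` (F J' ` U) = {}"
      using inj_on_image_Int[OF inj_U[of i], of "F I ` U" "F J' ` U"] Cons.prems by auto
    then show ?thesis by (simp add: J True image_comp)
  qed
qed simp

text \<open>The lower distance estimate keeps the image of the sphere about \<open>u\<close> out of the ball on the left.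
Hence the image of the open ball, open by invariance of domain, is also relatively closed there, and
connectedness finishes.\<close>
lemma ball_in_F_U:
  assumes I: "set I \<subseteq> A"
  shows "ball (F I u) (d I * a\<^sub>0 / (K * d [])) \<subseteq> F I ` U"
proof -
  let ?B = "ball (F I u) (d I * a\<^sub>0 / (K * d []))"
  have cS: "cball u a\<^sub>0 \<subseteq> S" using seed by auto
  then have bS: "ball u a\<^sub>0 \<subseteq> S" using ball_subset_cball by blast
  have uS: "u \<in> S" using cS a0_pos by auto
  have op: "open (F I ` ball u a\<^sub>0)"
    using invariance_of_domain[of "ball u a\<^sub>0" "F I"] F_cont[OF I] F_inj[OF I] bS
    by (meson continuous_on_subset inj_on_subset open_ball)
  have "compact (F I ` cball u a\<^sub>0)"
    using F_cont[OF I] cS by (meson compact_cball compact_continuous_image continuous_on_subset)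
  then have cl: "closed (F I ` cball u a\<^sub>0)" by (rule compact_imp_closed)
  have eq: "?B \<inter> F I ` ball u a\<^sub>0 = ?B \<inter> F I ` cball u a\<^sub>0"
  proof -
    have "w \<in> ball u a\<^sub>0" if w: "w \<in> cball u a\<^sub>0" "F I w \<in> ?B" for w
    proof -
      have "d I * dist u w \<le> K * d [] * dist (F I u) (F I w)"
        using dist_F_ge[OF I uS] w cS by auto
      also have "\<dots> < K * d [] * (d I * a\<^sub>0 / (K * d []))"
        using w(2) K_pos d_Nil_pos by (intro mult_strict_left_mono) auto
      also have "\<dots> = d I * a\<^sub>0" using K_pos d_Nil_pos by simp
      finally show ?thesis using d_pos[OF I] by simp
    qed
    then show ?thesis using ball_subset_cball by blast
  qed
  have "connected ?B" by simp
  then have "?B \<inter> F I ` ball u a\<^sub>0 = {} \<or> ?B \<subseteq> F I ` ball u a\<^sub>0"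
  proof -
    have o: "open (- F I ` cball u a\<^sub>0)" using cl by auto
    have "F I ` ball u a\<^sub>0 \<inter> - F I ` cball u a\<^sub>0 \<inter> ?B = {}" using ball_subset_cball[of u a\<^sub>0] by blast
    moreover have "?B \<subseteq> F I ` ball u a\<^sub>0 \<union> - F I ` cball u a\<^sub>0" using eq by blast
    ultimately have "F I ` ball u a\<^sub>0 \<inter> ?B = {} \<or> - F I ` cball u a\<^sub>0 \<inter> ?B = {}"
      using connectedD[OF \<open>connected ?B\<close> op o] by blast
    then show ?thesis using eq by blast
  qed
  moreover have "F I u \<in> ?B \<inter> F I ` ball u a\<^sub>0"
    using d_pos[OF I] a0_pos K_pos d_Nil_pos by auto
  ultimately have "?B \<subseteq> F I ` ball u a\<^sub>0" by blast
  then show ?thesis using seed ball_subset_cball[of u a\<^sub>0] by blast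
qed

text \<open>The points \<open>F I u\<close> lie within a multiple of \<open>\<rho>\<close> of \<open>x\<close>. They are separated by a multiple of
\<open>\<rho>\<close>, because \<open>F I ` U\<close> contains a ball of comparable radius about \<open>F I u\<close> and is disjoint from
\<open>F J ` U\<close> for incomparable words.\<close>
lemma card_cylinders_le:
  assumes \<kappa>: "0 < \<kappa>"
  shows "\<exists>M::nat. \<forall>\<rho> x P. 0 < \<rho> \<longrightarrow> finite P \<longrightarrow>
    (\<forall>I\<in>P. set I \<subseteq> A \<and> \<kappa> * \<rho> \<le> d I \<and> d I \<le> \<rho> \<and> cyl I \<inter> ball x \<rho> \<noteq> {}) \<longrightarrow>
    (\<forall>I\<in>P. \<forall>J\<in>P. I \<noteq> J \<longrightarrow> (\<nexists>L. J = I @ L)) \<longrightarrow> card P \<le> M"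
proof -
  define c where "c = \<kappa> * a\<^sub>0 / (K * d [])"
  define C where "C = 1 + K * diameter S / d []"
  have c: "0 < c" using \<kappa> a0_pos K_pos d_Nil_pos by (simp add: c_def)
  have uS: "u \<in> S" using seed a0_pos by auto
  obtain M :: nat where M: "\<And>\<rho> (x::'a) P. 0 < \<rho> \<Longrightarrow> finite P \<Longrightarrow> P \<subseteq> cball x (C * \<rho>) \<Longrightarrow>
     (\<forall>p\<in>P. \<forall>q\<in>P. p \<noteq> q \<longrightarrow> c * \<rho> \<le> dist p q) \<Longrightarrow> card P \<le> M"
    using card_separated_le[OF c, where 'a = 'a, of C] by metis
  show ?thesis
  proof (intro exI[of _ M] allI impI)
    fix \<rho> x P
    assume \<rho>: "0 < (\<rho>::real)" and P: "finite P"
      "\<forall>I\<in>P. set I \<subseteq> A \<and> \<kappa> * \<rho> \<le> d I \<and> d I \<le> \<rho> \<and> cyl I \<inter> ball x \<rho> \<noteq> {}"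
      and anti: "\<forall>I\<in>P. \<forall>J\<in>P. I \<noteq> J \<longrightarrow> (\<nexists>L. J = I @ L)"
    have sep: "c * \<rho> \<le> dist (F I u) (F J u)" if IJ: "I \<in> P" "J \<in> P" "I \<noteq> J" for I J
    proof (rule ccontr)
      assume "\<not> ?thesis"
      moreover have "c * \<rho> \<le> d I * a\<^sub>0 / (K * d [])"
      proof -
        have "\<kappa> * \<rho> * a\<^sub>0 / (K * d []) \<le> d I * a\<^sub>0 / (K * d [])"
          using P(2) IJ a0_pos K_pos d_Nil_pos by (intro divide_right_mono mult_right_mono) auto
        then show ?thesis by (simp add: c_def mult_ac)
      qed
      ultimately have "F J u \<in> ball (F I u) (d I * a\<^sub>0 / (K * d []))" by simp
      then have "F J u \<in> F I ` U" using ball_in_F_U[of I] P(2) IJ by blast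
      moreover have "u \<in> U" using seed a0_pos by auto
      then have "F J u \<in> F J ` U" by (rule imageI)
      moreover have "F I ` U \<inter> F J ` U = {}"
        using P(2) IJ anti by (intro F_U_disjoint) auto
      ultimately show False by blast
    qed
    have inj: "inj_on (\<lambda>I. F I u) P"
    proof (rule inj_onI, rule ccontr)
      fix I J assume "I \<in> P" "J \<in> P" "F I u = F J u" "I \<noteq> J"
      then have "c * \<rho> \<le> 0" using sep[of I J] by simp
      then show False using c \<rho> by (simp add: mult_le_0_iff)
    qed
    have "card ((\<lambda>I. F I u) ` P) \<le> M"
    proof (rule M[OF \<rho>])
      show "(\<lambda>I. F I u) ` P \<subseteq> cball x (C * \<rho>)"
      proof (clarify)
        fix I assume I: "I \<in> P"
        then have "cyl I \<inter> ball x \<rho> \<noteq> {}" using P(2) by blast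
        then obtain y where y: "y \<in> X" "dist x (F I y) < \<rho>" by auto
        have "dist (F I y) (F I u) * d [] \<le> K * d I * dist y u"
          using dist_F_le[of I y u] I P(2) y uS XS by auto
        also have "\<dots> \<le> K * \<rho> * diameter S"
          using I P(2) y uS XS K_pos bdd_S \<rho>
          by (intro mult_mono mult_left_mono diameter_bounded_bound) auto
        finally have "dist (F I y) (F I u) \<le> K * diameter S / d [] * \<rho>"
          using d_Nil_pos by (simp add: field_simps)
        then have "dist x (F I u) \<le> \<rho> + K * diameter S / d [] * \<rho>"
          using y(2) dist_triangle[of x "F I u" "F I y"] by simp
        then show "F I u \<in> cball x (C * \<rho>)" by (simp add: C_def algebra_simps)
      qed
      show "\<forall>p\<in>(\<lambda>I. F I u) ` P. \<forall>q\<in>(\<lambda>I. F I u) ` P. p \<noteq> q \<longrightarrow> c * \<rho> \<le> dist p q"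
        using sep by force
    qed (use P in auto)
    then show "card P \<le> M" using inj by (simp add: card_image)
  qed
qed

subsection \<open>The mass distribution principle\<close>

lemma sum_mass_extensions:
  fixes m :: "'b list \<Rightarrow> real"
  assumes add: "\<And>I. set I \<subseteq> A \<Longrightarrow> (\<Sum>a\<in>A. m (I @ [a])) = m I" and I: "set I \<subseteq> A"
  shows "(\<Sum>J\<in>words A n. m (I @ J)) = m I"
proof (induction n)
  case (Suc n)
  have "(\<Sum>J\<in>words A (Suc n). m (I @ J)) = (\<Sum>J\<in>words A n. \<Sum>a\<in>A. m ((I @ J) @ [a]))"
    by (simp add: sum_words_Suc)
  also have "\<dots> = (\<Sum>J\<in>words A n. m (I @ J))"
    by (rule sum.cong) (use I in \<open>auto simp: words_def simp del: append_assoc intro!: add\<close>)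
  finally show ?case using Suc by simp
qed (simp add: words_0)

text \<open>Cut every word at its first prefix of size at most \<open>\<rho>\<close>. These prefixes are incomparable and of size
comparable to \<open>\<rho>\<close>, so boundedly many of them have cylinders that meet the ball, and each has mass at
most \<open>C * \<rho> powr \<tau>\<close>. The assumption \<open>\<rho> < d []\<close> makes these prefixes nonempty, so that the cut can be
compared with the preceding prefix.\<close>
lemma mass_near_ball_le:
  fixes m :: "'b list \<Rightarrow> real"
  assumes nonneg: "\<And>I. set I \<subseteq> A \<Longrightarrow> 0 \<le> m I"
    and add: "\<And>I. set I \<subseteq> A \<Longrightarrow> (\<Sum>a\<in>A. m (I @ [a])) = m I"
    and bound: "\<And>I. set I \<subseteq> A \<Longrightarrow> m I \<le> C * d I powr \<tau>" and \<tau>: "0 < \<tau>" and C: "0 < C"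
  shows "\<exists>M::nat. \<forall>\<rho> x n. 0 < \<rho> \<longrightarrow> \<rho> < d [] \<longrightarrow> (\<forall>I\<in>words A n. d I \<le> \<rho>) \<longrightarrow>
    (\<Sum>I\<in>{I\<in>words A n. cyl I \<inter> ball x \<rho> \<noteq> {}}. m I) \<le> real M * C * \<rho> powr \<tau>"
proof -
  obtain \<kappa> where \<kappa>: "0 < \<kappa>" "\<And>I a. set I \<subseteq> A \<Longrightarrow> a \<in> A \<Longrightarrow> \<kappa> * d I \<le> d (I @ [a])"
    using letter_loss by metis
  obtain M :: nat where M': "\<forall>\<rho> x P. 0 < \<rho> \<longrightarrow> finite P \<longrightarrow>
    (\<forall>I\<in>P. set I \<subseteq> A \<and> \<kappa> * \<rho> \<le> d I \<and> d I \<le> \<rho> \<and> cyl I \<inter> ball x \<rho> \<noteq> {}) \<longrightarrow>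
    (\<forall>I\<in>P. \<forall>J\<in>P. I \<noteq> J \<longrightarrow> (\<nexists>L. J = I @ L)) \<longrightarrow> card P \<le> M"
    using card_cylinders_le[OF \<kappa>(1)] by (rule exE)
  note M = M'[rule_format]
  show ?thesis
  proof (intro exI[of _ M] allI impI)
    fix \<rho> :: real and x n
    assume \<rho>: "0 < \<rho>" "\<rho> < d []" and small: "\<forall>I\<in>words A n. d I \<le> \<rho>"
    define W where "W = {I\<in>words A n. cyl I \<inter> ball x \<rho> \<noteq> {}}"
    define j where "j I = (LEAST j. d (take j I) \<le> \<rho>)" for I
    define g where "g I = take (j I) I" for I
    have finW: "finite W" using finite_words[OF finA] by (simp add: W_def)
    have WA: "set I \<subseteq> A" "length I = n" if "I \<in> W" for I using that by (auto simp: W_def words_def)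
    have gA: "set (g I) \<subseteq> A" if "I \<in> W" for I
      using WA[OF that] set_take_subset[of "j I" I] by (auto simp: g_def)
    have j: "d (g I) \<le> \<rho>" "j I \<le> n" "0 < j I" if "I \<in> W" for I
    proof -
      have *: "d (take n I) \<le> \<rho>" using small that WA[OF that] by (auto simp: W_def)
      show "d (g I) \<le> \<rho>" unfolding g_def j_def by (rule LeastI, rule *)
      show "j I \<le> n" unfolding j_def by (rule Least_le, rule *)
      show "0 < j I"
      proof (rule ccontr)
        assume "\<not> 0 < j I"
        then have "d [] \<le> \<rho>" using \<open>d (g I) \<le> \<rho>\<close> by (simp add: g_def)
        then show False using \<rho> by simp
      qed
    qed
    have lg: "length (g I) = j I" if "I \<in> W" for I using j[OF that] WA[OF that] by (simp add: g_def)
    have lower: "\<kappa> * \<rho> \<le> d (g I)" if I: "I \<in> W" for I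
    proof -
      have "j I - 1 < j I" using j[OF I] by simp
      then have "\<not> d (take (j I - 1) I) \<le> \<rho>" unfolding j_def by (rule not_less_Least)
      then have "\<kappa> * \<rho> \<le> \<kappa> * d (take (j I - 1) I)" using \<kappa>(1) by simp
      also have "\<dots> \<le> d (take (j I - 1) I @ [I ! (j I - 1)])"
        using WA[OF I] j[OF I] set_take_subset[of "j I - 1" I] by (intro \<kappa>(2)) auto
      also have "take (j I - 1) I @ [I ! (j I - 1)] = g I"
        using j[OF I] WA[OF I] take_Suc_conv_app_nth[of "j I - 1" I] by (simp add: g_def)
      finally show ?thesis .
    qed
    have "card (g ` W) \<le> M"
    proof (rule M[OF \<rho>(1)])
      show "finite (g ` W)" using finW by simp
      fix I assume "I \<in> g ` W"
      then obtain J where J: "J \<in> W" "I = g J" by auto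
      have "cyl J \<subseteq> cyl I" using cyl_take[of J "j J"] WA[OF J(1)] by (simp add: J g_def)
      then have "cyl I \<inter> ball x \<rho> \<noteq> {}" using J(1) by (auto simp: W_def)
      then show "set I \<subseteq> A \<and> \<kappa> * \<rho> \<le> d I \<and> d I \<le> \<rho> \<and> cyl I \<inter> ball x \<rho> \<noteq> {}"
        using gA j lower J by simp
    next
      fix I J assume "I \<in> g ` W" "J \<in> g ` W" "I \<noteq> J"
      then obtain I' J' where *: "I' \<in> W" "I = g I'" "J' \<in> W" "J = g J'" by auto
      show "\<nexists>L. J = I @ L"
      proof
        assume "\<exists>L. J = I @ L"
        then obtain L where J: "J = I @ L" ..
        have "J = take (j J') J'" using * by (simp add: g_def)
        then have "take (length I) J' = I" using J
          by (metis append_eq_conv_conj append_take_drop_id append.assoc)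
        then have "d (take (length I) J') \<le> \<rho>" using j *(1,2) by simp
        then have "j J' \<le> length I" unfolding j_def by (rule Least_le)
        then have "length J \<le> length I" using lg * by simp
        then show False using J \<open>I \<noteq> J\<close> by simp
      qed
    qed
    moreover have "(\<Sum>I\<in>W. m I) = (\<Sum>P\<in>g ` W. \<Sum>I\<in>{I\<in>W. g I = P}. m I)"
      by (rule sum.image_gen[OF finW])
    moreover have "(\<Sum>P\<in>g ` W. \<Sum>I\<in>{I\<in>W. g I = P}. m I) \<le> (\<Sum>P\<in>g ` W. C * \<rho> powr \<tau>)"
    proof (rule sum_mono)
      fix P assume P: "P \<in> g ` W"
      then have PA: "set P \<subseteq> A" using gA by auto
      have sub: "{I\<in>W. g I = P} \<subseteq> (\<lambda>J. P @ J) ` words A (n - length P)"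
      proof
        fix I assume "I \<in> {I\<in>W. g I = P}"
        then have I: "I \<in> W" "P = take (j I) I" by (auto simp: g_def)
        then have "I = P @ drop (j I) I" by simp
        moreover have "drop (j I) I \<in> words A (n - length P)"
          using I WA[OF I(1)] j[OF I(1)] set_drop_subset[of "j I" I] by (auto simp: words_def)
        ultimately show "I \<in> (\<lambda>J. P @ J) ` words A (n - length P)" by blast
      qed
      have "(\<Sum>I\<in>{I\<in>W. g I = P}. m I) \<le> (\<Sum>I\<in>(\<lambda>J. P @ J) ` words A (n - length P). m I)"
        by (rule sum_mono2[OF _ sub]) (use finite_words[OF finA] PA in \<open>auto intro!: nonneg simp: words_def\<close>)
      also have "\<dots> = (\<Sum>J\<in>words A (n - length P). m (P @ J))"
        by (subst sum.reindex) (auto simp: inj_on_def)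
      also have "\<dots> = m P" by (rule sum_mass_extensions[OF add PA])
      also have "\<dots> \<le> C * d P powr \<tau>" by (rule bound[OF PA])
      also have "\<dots> \<le> C * \<rho> powr \<tau>"
        using P j(1) d_pos[OF PA] \<tau> C by (intro mult_left_mono powr_mono2) auto
      finally show "(\<Sum>I\<in>{I\<in>W. g I = P}. m I) \<le> C * \<rho> powr \<tau>" .
    qed
    moreover have "(\<Sum>P\<in>g ` W. C * \<rho> powr \<tau>) = real (card (g ` W)) * (C * \<rho> powr \<tau>)" by simp
    moreover have "real (card (g ` W)) * (C * \<rho> powr \<tau>) \<le> real M * (C * \<rho> powr \<tau>)"
      using \<open>card (g ` W) \<le> M\<close> C by (intro mult_right_mono) auto
    ultimately show "(\<Sum>I\<in>{I\<in>words A n. cyl I \<inter> ball x \<rho> \<noteq> {}}. m I) \<le> real M * C * \<rho> powr \<tau>"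
      by (simp add: W_def mult.assoc)
  qed
qed

text \<open>The function \<open>m\<close> plays the part of a measure on infinite words, but no measure is constructed: the
union of the cylinders of length \<open>n\<close> and positive mass is compact and decreases with \<open>n\<close>, so finitely
many balls of an open cover of the limit set already cover it for some \<open>n\<close>. There the total mass \<open>1\<close>
is a finite sum, and it is bounded by the masses near the balls.\<close>
lemma mass_distribution_principle:
  fixes m :: "'b list \<Rightarrow> real"
  assumes m0: "m [] = 1" and nonneg: "\<And>I. set I \<subseteq> A \<Longrightarrow> 0 \<le> m I"
    and add: "\<And>I. set I \<subseteq> A \<Longrightarrow> (\<Sum>a\<in>A. m (I @ [a])) = m I"
    and bound: "\<And>I. set I \<subseteq> A \<Longrightarrow> m I \<le> C * d I powr \<tau>" and \<tau>: "0 < \<tau>"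
    and T: "\<And>x. (\<And>n. \<exists>I\<in>words A n. 0 < m I \<and> x \<in> cyl I) \<Longrightarrow> x \<in> T"
  shows "ennreal \<tau> \<le> hausdorff_dim T"
proof (rule ccontr)
  assume "\<not> ?thesis"
  then have less: "hausdorff_dim T < ennreal \<tau>" by simp
  have "0 < C * d [] powr \<tau>" using bound[of "[]"] m0 by simp
  then have C: "0 < C" by (simp add: zero_less_mult_iff)
  have "\<exists>M::nat. \<forall>\<rho> x n. 0 < \<rho> \<longrightarrow> \<rho> < d [] \<longrightarrow> (\<forall>I\<in>words A n. d I \<le> \<rho>) \<longrightarrow>
    (\<Sum>I\<in>{I\<in>words A n. cyl I \<inter> ball x \<rho> \<noteq> {}}. m I) \<le> real M * C * \<rho> powr \<tau>"
    by (rule mass_near_ball_le) (use nonneg add bound \<tau> C in auto)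
  then obtain M :: nat where M': "\<forall>\<rho> x n. 0 < \<rho> \<longrightarrow> \<rho> < d [] \<longrightarrow> (\<forall>I\<in>words A n. d I \<le> \<rho>) \<longrightarrow>
    (\<Sum>I\<in>{I\<in>words A n. cyl I \<inter> ball x \<rho> \<noteq> {}}. m I) \<le> real M * C * \<rho> powr \<tau>" by (rule exE)
  note M = M'[rule_format]
  \<comment> \<open>small enough for all radii to be below \<open>d []\<close> and for the total mass to come out below \<open>1\<close>\<close>
  define \<eta> where "\<eta> = min (d [] powr \<tau> / 2) (1 / (2 * (real M + 1) * C))"
  have \<eta>: "0 < \<eta>" using C d_Nil_pos by (simp add: \<eta>_def)
  obtain x :: "nat \<Rightarrow> 'a" and \<rho> where \<rho>: "\<And>n. 0 < \<rho> n"
    and cov: "T \<subseteq> (\<Union>n. ball (x n) (\<rho> n))" and sum: "\<And>N. (\<Sum>n<N. \<rho> n powr \<tau>) \<le> \<eta>"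
    using ball_cover_if_hausdorff_dim_less[OF less \<eta>] by metis
  have \<rho>_less: "\<rho> n < d []" for n
  proof -
    have "\<rho> n powr \<tau> \<le> (\<Sum>i<Suc n. \<rho> i powr \<tau>)" by (rule member_le_sum) auto
    also have "\<dots> \<le> \<eta>" by (rule sum)
    also have "\<dots> \<le> d [] powr \<tau> / 2" by (simp add: \<eta>_def)
    also have "\<dots> < d [] powr \<tau>" using d_Nil_pos by simp
    finally show ?thesis using \<tau> d_Nil_pos by (meson less_eq_real_def linorder_not_less powr_mono2)
  qed
  define Q where "Q n = (\<Union>I\<in>{I\<in>words A n. 0 < m I}. cyl I)" for n
  have "compact (Q n)" for n
    unfolding Q_def
  proof (rule compact_UN)
    show "finite {I \<in> words A n. 0 < m I}" using finite_words[OF finA] by simp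
  qed (auto intro: compact_cyl simp: words_def)
  have Q_Suc: "Q (Suc n) \<subseteq> Q n" for n
  proof
    fix y assume "y \<in> Q (Suc n)"
    then obtain I a where I: "I \<in> words A n" "a \<in> A" "0 < m (I @ [a])" "y \<in> cyl (I @ [a])"
      by (auto simp: Q_def words_Suc_snoc)
    then have IA: "set I \<subseteq> A" by (simp add: words_def)
    have "m (I @ [a]) \<le> (\<Sum>a\<in>A. m (I @ [a]))"
      using I IA finA nonneg by (intro member_le_sum) auto
    then have "0 < m I" using add[OF IA] I by simp
    moreover have "y \<in> cyl I" using I cyl_append[of "[a]" I] by auto
    ultimately show "y \<in> Q n" using I by (auto simp: Q_def)
  qed
  have Q_dec: "Q n \<subseteq> Q n'" if "n' \<le> n" for n n'
    using lift_Suc_antimono_le[of Q, OF Q_Suc that] .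
  have Q_T: "(\<Inter>n. Q n) \<subseteq> T"
  proof (rule subsetI, rule T)
    fix y n assume "y \<in> (\<Inter>n. Q n)"
    then have "y \<in> Q n" by blast
    then show "\<exists>I\<in>words A n. 0 < m I \<and> y \<in> cyl I" unfolding Q_def by blast
  qed
  obtain n0 where n0: "Q n0 \<subseteq> (\<Union>n. ball (x n) (\<rho> n))"
  proof (rule ccontr)
    assume "\<not> thesis"
    then have ne: "Q n - (\<Union>n. ball (x n) (\<rho> n)) \<noteq> {}" for n using that by blast
    have "(\<Inter>n. Q n - (\<Union>n. ball (x n) (\<rho> n))) \<noteq> {}"
    proof (rule compact_nest)
      show "compact (Q n - (\<Union>n. ball (x n) (\<rho> n)))" for n
        using \<open>compact (Q n)\<close> by (rule compact_diff) auto
      show "Q n - (\<Union>n. ball (x n) (\<rho> n)) \<noteq> {}" for n by (rule ne)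
      show "Q n - (\<Union>n. ball (x n) (\<rho> n)) \<subseteq> Q m - (\<Union>n. ball (x n) (\<rho> n))" if "m \<le> n" for m n
        using Q_dec[OF that] by blast
    qed
    then obtain y where y: "y \<in> (\<Inter>n. Q n - (\<Union>n. ball (x n) (\<rho> n)))" by blast
    have yn: "y \<in> Q n - (\<Union>n. ball (x n) (\<rho> n))" for n using y by (rule INT_D) (rule UNIV_I)
    have "y \<in> (\<Inter>n. Q n)"
    proof (rule INT_I)
      show "y \<in> Q n" for n using yn[of n] by (rule DiffD1)
    qed
    then have "y \<in> T" by (rule subsetD[OF Q_T])
    then have "y \<in> (\<Union>n. ball (x n) (\<rho> n))" by (rule subsetD[OF cov])
    then show False by (rule DiffD2[OF yn])
  qed
  obtain H where H: "finite H" "Q n0 \<subseteq> (\<Union>n\<in>H. ball (x n) (\<rho> n))"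
    using compactE_image[OF \<open>compact (Q n0)\<close>, of UNIV "\<lambda>n. ball (x n) (\<rho> n)"] n0 by auto
  obtain N where N: "H \<subseteq> {..<N}" using finite_nat_bounded[OF H(1)] by blast
  define e where "e = Min (\<rho> ` {..N})"
  have e: "0 < e" using \<rho> by (simp add: e_def)
  have e_le: "e \<le> \<rho> i" if "i < N" for i using that by (simp add: e_def)
  obtain n1 where n1: "\<And>I. set I \<subseteq> A \<Longrightarrow> n1 \<le> length I \<Longrightarrow> d I \<le> e" using d_small[OF e] by metis
  define n where "n = max n0 n1"
  have "1 = (\<Sum>I\<in>words A n. m I)" using sum_mass_extensions[of m "[]", OF add] m0 by simp
  also have "\<dots> \<le> (\<Sum>I\<in>words A n. \<Sum>i<N. if cyl I \<inter> ball (x i) (\<rho> i) \<noteq> {} then m I else 0)"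
  proof (rule sum_mono)
    fix I assume I: "I \<in> words A n"
    then have IA: "set I \<subseteq> A" by (simp add: words_def)
    have nn: "0 \<le> (if cyl I \<inter> ball (x i) (\<rho> i) \<noteq> {} then m I else 0)" for i
      using nonneg[OF IA] by simp
    show "m I \<le> (\<Sum>i<N. if cyl I \<inter> ball (x i) (\<rho> i) \<noteq> {} then m I else 0)"
    proof (cases "0 < m I")
      case True
      obtain y where y: "y \<in> cyl I" using X_ne by auto
      then have "y \<in> Q n" using I True by (auto simp: Q_def)
      then have "y \<in> Q n0" using Q_dec[of n0 n] by (auto simp: n_def)
      then obtain i where i: "i \<in> H" "y \<in> ball (x i) (\<rho> i)" using H(2) by blast
      then have "cyl I \<inter> ball (x i) (\<rho> i) \<noteq> {}" using y by blast
      then have "m I = (if cyl I \<inter> ball (x i) (\<rho> i) \<noteq> {} then m I else 0)" by simp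
      also have "\<dots> \<le> (\<Sum>i<N. if cyl I \<inter> ball (x i) (\<rho> i) \<noteq> {} then m I else 0)"
        using i(1) N nn by (intro member_le_sum) auto
      finally show ?thesis .
    next
      case False
      then have "m I \<le> 0" by simp
      also have "0 \<le> (\<Sum>i<N. if cyl I \<inter> ball (x i) (\<rho> i) \<noteq> {} then m I else 0)"
        by (rule sum_nonneg) (rule nn)
      finally show ?thesis .
    qed
  qed
  also have "\<dots> = (\<Sum>i<N. \<Sum>I\<in>words A n. if cyl I \<inter> ball (x i) (\<rho> i) \<noteq> {} then m I else 0)"
    by (rule sum.swap)
  also have "\<dots> = (\<Sum>i<N. \<Sum>I\<in>{I\<in>words A n. cyl I \<inter> ball (x i) (\<rho> i) \<noteq> {}}. m I)"
    by (simp only: sum.inter_filter[OF finite_words[OF finA]])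
  also have "\<dots> \<le> (\<Sum>i<N. real M * C * \<rho> i powr \<tau>)"
  proof (rule sum_mono, rule M)
    fix i I assume "i \<in> {..<N}" "I \<in> words A n"
    then show "d I \<le> \<rho> i" using n1[of I] e_le[of i] by (auto simp: n_def words_def)
  qed (use \<rho> \<rho>_less in auto)
  also have "\<dots> = real M * C * (\<Sum>i<N. \<rho> i powr \<tau>)" by (simp add: sum_distrib_left)
  also have "\<dots> \<le> real M * C * \<eta>" using C sum by (intro mult_left_mono) auto
  also have "\<dots> \<le> real M * C * (1 / (2 * (real M + 1) * C))"
    using C by (intro mult_left_mono) (auto simp: \<eta>_def)
  also have "\<dots> = real M / (2 * (real M + 1))" using C by simp
  also have "\<dots> < 1" by (simp add: divide_less_eq)
  finally show False by simp
qed

subsection \<open>Limsup sets of balls\<close>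

text \<open>The Cantor construction. The last assumption says that \<open>d P powr \<sigma>\<close>, essentially the mass of \<open>P\<close> for
independent letters, is negligible against \<open>\<rho> P powr \<tau>\<close>, the mass that a cylinder inside the ball of
radius \<open>\<rho> P\<close> may have, for all words of certain arbitrarily large lengths. The constant \<open>E\<close> absorbs what
happened at earlier stages.\<close>
theorem hausdorff_dim_W_set_ge:
  assumes c_pos: "\<And>a. a \<in> A \<Longrightarrow> 0 < c a"
    and c_low: "\<And>a x y. a \<in> A \<Longrightarrow> x \<in> X \<Longrightarrow> y \<in> X \<Longrightarrow> c a * dist x y \<le> dist (f a x) (f a y)"
    and c_sum: "1 \<le> (\<Sum>a\<in>A. c a powr \<sigma>)"
    and \<tau>: "0 < \<tau>" "\<tau> < \<sigma>" and z: "z \<in> X"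
    and \<rho>_pos: "\<And>P. set P \<subseteq> A \<Longrightarrow> 0 < \<rho> P"
    and \<rho>_big: "\<And>E m. \<exists>n\<ge>m. \<forall>P\<in>words A n. E * d P powr \<sigma> \<le> \<rho> P powr \<tau>"
  shows "ennreal \<tau> \<le> hausdorff_dim (W_set A f X \<rho> z)"
proof -
  define Z where "Z = (\<Sum>a\<in>A. c a powr \<sigma>)"
  define p where "p a = c a powr \<sigma> / Z" for a
  have Z: "1 \<le> Z" using c_sum by (simp add: Z_def)
  have p_sum: "(\<Sum>a\<in>A. p a) = 1" using Z by (simp add: p_def Z_def flip: sum_divide_distrib)
  have p0: "0 \<le> p a" for a using Z by (simp add: p_def)
  have p_le: "p a \<le> c a powr \<sigma>" for a using Z by (simp add: p_def divide_le_eq mult_le_cancel_left1)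
  have p1: "p a \<le> 1" if "a \<in> A" for a
    using member_le_sum[of a A p] that finA p0 p_sum by auto

  \<comment> \<open>the map of the word \<open>J\<close> multiplies distances by at least \<open>cw J\<close>\<close>
  define cw where "cw J = prod_list (map c J)" for J
  have cw_simps[simp]: "cw [] = 1" "cw (a # J) = c a * cw J" "cw (I @ J) = cw I * cw J" for a I J
    by (auto simp: cw_def)
  have cw_pos: "0 < cw J" if "set J \<subseteq> A" for J
    using that by (induction J) (auto simp: c_pos)
  have cw_d: "cw J * d [] \<le> d J" if J: "set J \<subseteq> A" for J
  proof -
    have *: "cw J * dist x y \<le> dist (F J x) (F J y)" if "x \<in> X" "y \<in> X" for x y
      using J
    proof (induction J)
      case (Cons a J)
      have "cw (a # J) * dist x y \<le> c a * dist (F J x) (F J y)"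
        using Cons c_pos[of a] by (auto simp: mult.assoc)
      also have "\<dots> \<le> dist (f a (F J x)) (f a (F J y))"
        using Cons.prems that F_X by (intro c_low) auto
      finally show ?case by simp
    qed simp
    obtain x y where "x \<in> X" "y \<in> X" "dist (F [] x) (F [] y) = d []" using d_attained[of "[]"] by auto
    then show ?thesis using *[of x y] dist_le_d[OF J, of "F J x" "F J y"] by simp
  qed
  have cw_append: "d I * cw J \<le> K * d (I @ J)" if "set I \<subseteq> A" "set J \<subseteq> A" for I J
  proof -
    have "d I * (cw J * d []) \<le> d I * d J"
      using cw_d[OF that(2)] d_pos[OF that(1)] by (intro mult_left_mono) auto
    also have "\<dots> \<le> K * d [] * d (I @ J)" by (rule d_append_ge[OF that])
    finally have "(d I * cw J) * d [] \<le> (K * d (I @ J)) * d []" by (simp add: mult_ac)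
    then show ?thesis using d_Nil_pos by simp
  qed
  obtain \<kappa> where \<kappa>: "0 < \<kappa>" "\<And>I a. set I \<subseteq> A \<Longrightarrow> a \<in> A \<Longrightarrow> \<kappa> * d I \<le> d (I @ [a])"
    using letter_loss by blast

  \<comment> \<open>\<open>Lf n\<close>: length by which a jump begun at length \<open>n\<close> is certainly over\<close>
  have "\<exists>L\<ge>n. \<forall>P\<in>words A n. \<forall>I. set I \<subseteq> A \<longrightarrow> L \<le> length I \<longrightarrow> d I \<le> \<rho> P" for n
  proof -
    have ne: "words A n \<noteq> {}" using X_words[of n] X_ne by auto
    define e where "e = Min (\<rho> ` words A n)"
    have "0 < e" using ne finite_words[OF finA, of n] \<rho>_pos by (auto simp: e_def words_def)
    then obtain L where L: "\<And>I. set I \<subseteq> A \<Longrightarrow> L \<le> length I \<Longrightarrow> d I \<le> e" using d_small by blast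
    have "d I \<le> \<rho> P" if "P \<in> words A n" "set I \<subseteq> A" "max n L \<le> length I" for P I
    proof -
      have "d I \<le> e" using L that by simp
      also have "e \<le> \<rho> P" using that finite_words[OF finA, of n] by (simp add: e_def)
      finally show ?thesis .
    qed
    then show ?thesis by (intro exI[of _ "max n L"]) auto
  qed
  then obtain Lf where Lf: "\<And>n. n \<le> Lf n"
    "\<And>n P I. P \<in> words A n \<Longrightarrow> set I \<subseteq> A \<Longrightarrow> Lf n \<le> length I \<Longrightarrow> d I \<le> \<rho> P" by metis

  \<comment> \<open>\<open>E L\<close>: cost of forgetting the first \<open>L\<close> letters, whose mass is only bounded by \<open>1\<close>\<close>
  have "\<exists>E. \<forall>I\<in>words A L. \<forall>J. set J \<subseteq> A \<longrightarrow> cw J powr \<sigma> \<le> E * d (I @ J) powr \<sigma>" for L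
  proof -
    have ne: "words A L \<noteq> {}" using X_words[of L] X_ne by auto
    define e where "e = Min (d ` words A L)"
    have e: "0 < e" using ne finite_words[OF finA, of L] d_pos by (auto simp: e_def words_def)
    have "cw J powr \<sigma> \<le> (K / e) powr \<sigma> * d (I @ J) powr \<sigma>" if I: "I \<in> words A L" "set J \<subseteq> A" for I J
    proof -
      have IA: "set I \<subseteq> A" using I by (simp add: words_def)
      have "e \<le> d I" using I finite_words[OF finA, of L] by (simp add: e_def)
      then have "e * cw J \<le> d I * cw J" using cw_pos[OF I(2)] by (intro mult_right_mono) auto
      also have "\<dots> \<le> K * d (I @ J)" by (rule cw_append[OF IA I(2)])
      finally have "cw J \<le> K / e * d (I @ J)" using e by (simp add: field_simps)
      then have "cw J powr \<sigma> \<le> (K / e * d (I @ J)) powr \<sigma>"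
        using cw_pos[OF I(2)] \<tau> by (intro powr_mono2) auto
      then show ?thesis by (simp add: powr_mult del: times_divide_eq_left)
    qed
    then show ?thesis by blast
  qed
  then obtain E where E: "\<And>L I J. I \<in> words A L \<Longrightarrow> set J \<subseteq> A \<Longrightarrow>
      cw J powr \<sigma> \<le> E L * d (I @ J) powr \<sigma>" by metis

  \<comment> \<open>\<open>nxt L\<close>: a length at which the next jump is affordable after free choice from length \<open>L\<close> on\<close>
  have "\<exists>n>L. \<forall>P\<in>words A n. E L * d P powr \<sigma> \<le> (\<kappa> * \<rho> P) powr \<tau> \<and> E L * d P powr \<sigma> \<le> d P powr \<tau>" for L
  proof -
    obtain m where m: "\<And>I. set I \<subseteq> A \<Longrightarrow> m \<le> length I \<Longrightarrow> E L * d I powr \<sigma> \<le> d I powr \<tau>"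
      using small_power[OF \<tau>(2)] by blast
    obtain n where n: "n \<ge> max (Suc L) m" "\<And>P. P \<in> words A n \<Longrightarrow> E L / \<kappa> powr \<tau> * d P powr \<sigma> \<le> \<rho> P powr \<tau>"
      using \<rho>_big by blast
    have "E L * d P powr \<sigma> \<le> (\<kappa> * \<rho> P) powr \<tau>" if "P \<in> words A n" for P
      using n(2)[OF that] \<kappa>(1) by (simp add: powr_mult field_simps)
    moreover have "E L * d P powr \<sigma> \<le> d P powr \<tau>" if "P \<in> words A n" for P
      using m[of P] that n(1) by (auto simp: words_def)
    ultimately show ?thesis using n(1) by (intro exI[of _ n]) auto
  qed
  then obtain nxt where nxt: "\<And>L. L < nxt L"
    "\<And>L P. P \<in> words A (nxt L) \<Longrightarrow> E L * d P powr \<sigma> \<le> (\<kappa> * \<rho> P) powr \<tau>"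
    "\<And>L P. P \<in> words A (nxt L) \<Longrightarrow> E L * d P powr \<sigma> \<le> d P powr \<tau>" by metis

  define ns where "ns = rec_nat (nxt 0) (\<lambda>_ n. nxt (Lf n))"
  have ns_0: "ns 0 = nxt 0" and ns_Suc: "ns (Suc k) = nxt (Lf (ns k))" for k
    by (simp_all add: ns_def)
  have Lf_less: "Lf (ns k) < ns (Suc k)" for k using nxt(1) by (simp add: ns_Suc)
  have ns_less: "ns k < ns (Suc k)" for k using Lf(1)[of "ns k"] Lf_less[of k] by simp
  have ns_mono: "strict_mono ns" using ns_less by (rule strict_monoI_Suc)
  have ns_pos: "0 < ns k" for k
  proof -
    have "0 < ns 0" using nxt(1)[of 0] by (simp add: ns_0)
    also have "ns 0 \<le> ns k" using ns_mono by (simp add: strict_mono_less_eq)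
    finally show ?thesis .
  qed

  \<comment> \<open>jumps start at the lengths \<open>ns k\<close>; a word of length in \<open>{ns k..<ns (Suc k)}\<close> is in stage \<open>k\<close>\<close>
  define stage where "stage n = (THE k. ns k \<le> n \<and> n < ns (Suc k))" for n
  have stage: "stage n = k" if "ns k \<le> n" "n < ns (Suc k)" for n k
    unfolding stage_def
  proof (rule the_equality)
    fix k' assume k': "ns k' \<le> n \<and> n < ns (Suc k')"
    then have "ns k' < ns (Suc k)" "ns k < ns (Suc k')" using that by auto
    then show "k' = k" using ns_mono by (simp add: strict_mono_less)
  qed (use that in auto)
  have stage_ex: "\<exists>k. ns k \<le> n \<and> n < ns (Suc k)" if "ns 0 \<le> n" for n
  proof -
    define k where "k = (LEAST k. n < ns (Suc k))"
    have "n < ns (Suc n)" using strict_mono_imp_increasing[OF ns_mono, of "Suc n"] by simp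
    then have k: "n < ns (Suc k)" unfolding k_def by (rule LeastI)
    have "ns k \<le> n"
    proof (cases k)
      case (Suc j)
      then have "\<not> n < ns (Suc j)" unfolding k_def using not_less_Least by (metis lessI)
      then show ?thesis using Suc by simp
    qed (use that in simp)
    then show ?thesis using k by blast
  qed

  \<comment> \<open>\<open>base I\<close> is the prefix at which the current stage began. As long as its cylinder is too
    large, \<open>I\<close> is continued by the letter \<open>tgt I\<close>, which keeps \<open>F (base I) z\<close> in the cylinder; otherwise
    the next letter has distribution \<open>p\<close>. The mass \<open>m I\<close> is the product of these transition weights.\<close>
  define base where "base I = take (ns (stage (length I))) I" for I :: "'b list"
  define forced where "forced I \<longleftrightarrow> ns 0 \<le> length I \<and> \<rho> (base I) < d I" for I
  define tgt where "tgt I = (SOME a. a \<in> A \<and> (F (base I) z \<in> cyl I \<longrightarrow> F (base I) z \<in> cyl (I @ [a])))" for I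
  define q where "q I a = (if forced I then (if a = tgt I then 1 else 0) else p a)" for I a
  define m where "m I = (\<Prod>j<length I. q (take j I) (I ! j))" for I

  have tgt: "tgt I \<in> A" "F (base I) z \<in> cyl I \<Longrightarrow> F (base I) z \<in> cyl (I @ [tgt I])" for I
  proof -
    have "\<exists>a. a \<in> A \<and> (F (base I) z \<in> cyl I \<longrightarrow> F (base I) z \<in> cyl (I @ [a]))"
      using cyl_split[of I] A_ne by blast
    then have "tgt I \<in> A \<and> (F (base I) z \<in> cyl I \<longrightarrow> F (base I) z \<in> cyl (I @ [tgt I]))"
      unfolding tgt_def by (rule someI_ex)
    then show "tgt I \<in> A" "F (base I) z \<in> cyl I \<Longrightarrow> F (base I) z \<in> cyl (I @ [tgt I])" by auto
  qed
  have q0: "0 \<le> q I a" for I a using p0 by (simp add: q_def)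
  have q1: "q I a \<le> 1" if "a \<in> A" for I a using p1[OF that] by (simp add: q_def)
  have q_sum: "(\<Sum>a\<in>A. q I a) = 1" for I
    using tgt(1)[of I] finA p_sum by (cases "forced I") (simp_all add: q_def sum.delta)
  have m_Nil: "m [] = 1" by (simp add: m_def)
  have m_snoc: "m (I @ [a]) = m I * q I a" for I a by (simp add: m_def nth_append)
  have m0: "0 \<le> m I" for I unfolding m_def by (intro prod_nonneg) (auto intro: q0)
  have m_add: "(\<Sum>a\<in>A. m (I @ [a])) = m I" for I
    by (simp add: m_snoc q_sum flip: sum_distrib_left)
  have m_append: "m (I @ J) \<le> m I" if "set J \<subseteq> A" for I J
    using that
  proof (induction J rule: rev_induct)
    case (snoc a J)
    have "m (I @ J @ [a]) = m (I @ J) * q (I @ J) a" using m_snoc[of "I @ J" a] by simp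
    also have "\<dots> \<le> m (I @ J)" using q1[of a "I @ J"] snoc.prems m0[of "I @ J"] by (simp add: mult_left_le)
    also have "\<dots> \<le> m I" using snoc by simp
    finally show ?case by simp
  qed simp
  have m_le1: "m I \<le> 1" if "set I \<subseteq> A" for I using m_append[OF that, of "[]"] m_Nil by simp
  have m_free: "m (I @ J) \<le> m I * cw J powr \<sigma>"
    if "set J \<subseteq> A" "\<And>j. j < length J \<Longrightarrow> \<not> forced (I @ take j J)" for I J
    using that
  proof (induction J rule: rev_induct)
    case (snoc a J)
    have "\<not> forced (I @ J)" using snoc.prems(2)[of "length J"] by simp
    then have "q (I @ J) a = p a" by (simp add: q_def)
    then have "m (I @ J @ [a]) = m (I @ J) * p a" using m_snoc[of "I @ J" a] by simp
    also have "\<dots> \<le> (m I * cw J powr \<sigma>) * c a powr \<sigma>"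
    proof (intro mult_mono p_le)
      show "m (I @ J) \<le> m I * cw J powr \<sigma>"
      proof (rule snoc.IH)
        show "\<not> forced (I @ take j J)" if "j < length J" for j
          using snoc.prems(2)[of j] that by simp
      qed (use snoc.prems in auto)
    qed (use m0 p0 in auto)
    also have "\<dots> = m I * cw (J @ [a]) powr \<sigma>"
      using snoc.prems(1) cw_pos[of J] c_pos[of a] by (simp add: powr_mult)
    finally show ?case by simp
  qed simp

  have free_start: "\<not> forced I" if "length I < ns 0" for I using that by (simp add: forced_def)
  have free_late: "\<not> forced I" if "set I \<subseteq> A" "Lf (ns k) \<le> length I" "length I < ns (Suc k)" for I k
  proof -
    have k: "ns k \<le> length I" using that(2) Lf(1)[of "ns k"] by simp
    then have "base I = take (ns k) I" using stage[OF k that(3)] by (simp add: base_def)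
    moreover have "take (ns k) I \<in> words A (ns k)"
      using that(1) k set_take_subset[of "ns k" I] by (auto simp: words_def)
    ultimately have "d I \<le> \<rho> (base I)" using Lf(2) that by metis
    then show ?thesis by (simp add: forced_def)
  qed
  \<comment> \<open>the affordability of the jump at length \<open>ns k\<close>: its last free run began at length \<open>L\<close>\<close>
  have at_ns: "m P \<le> (\<kappa> * \<rho> P) powr \<tau> \<and> m P \<le> d P powr \<tau>" if P: "P \<in> words A (ns k)" for P k
  proof -
    define L where "L = (case k of 0 \<Rightarrow> 0 | Suc j \<Rightarrow> Lf (ns j))"
    have nsL: "ns k = nxt L" by (cases k) (simp_all add: L_def ns_0 ns_Suc)
    have PA: "set P \<subseteq> A" "length P = ns k" using P by (auto simp: words_def)
    have L: "L \<le> ns k" using nxt(1)[of L] nsL by simp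
    define I J where "I = take L P" and "J = drop L P"
    have IJ: "P = I @ J" "I \<in> words A L" "set J \<subseteq> A" "set I \<subseteq> A"
      using PA L set_take_subset[of L P] set_drop_subset[of L P] by (auto simp: I_def J_def words_def)
    have "m (I @ J) \<le> m I * cw J powr \<sigma>"
    proof (rule m_free[OF IJ(3)])
      fix j assume j: "j < length J"
      have len: "length (I @ take j J) = L + j" using j PA L by (simp add: I_def)
      have less: "L + j < ns k" using j PA by (simp add: J_def)
      have sA: "set (I @ take j J) \<subseteq> A" using IJ set_take_subset[of j J] by auto
      show "\<not> forced (I @ take j J)"
      proof (cases k)
        case 0
        then show ?thesis using free_start[of "I @ take j J"] len less by simp
      next
        case (Suc i)
        then show ?thesis using free_late[OF sA, of i] len less by (simp add: L_def)
      qed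
    qed
    also have "\<dots> \<le> 1 * cw J powr \<sigma>" using m_le1[OF IJ(4)] by (intro mult_right_mono) auto
    also have "\<dots> \<le> E L * d P powr \<sigma>" using E[OF IJ(2,3)] IJ(1) by simp
    finally have "m P \<le> E L * d P powr \<sigma>" using IJ(1) by simp
    then show ?thesis using nxt(2,3)[of P L] P nsL by fastforce
  qed
  \<comment> \<open>during a jump the mass does not grow and the cylinder stays above \<open>\<kappa> * \<rho> (base J)\<close>\<close>
  have while_forced: "m J \<le> d J powr \<tau>"
    if J: "set J \<subseteq> A" "ns k \<le> length J" "length J \<le> ns (Suc k)"
      and all: "\<And>j. ns k \<le> j \<Longrightarrow> j < length J \<Longrightarrow> forced (take j J)" for J k
  proof (cases "length J = ns k")
    case True
    then show ?thesis using at_ns[of J k] J by (simp add: words_def)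
  next
    case False
    define I where "I = butlast J"
    define a where "a = last J"
    have Jne: "J \<noteq> []" using False J(2) ns_pos[of k] by auto
    then have JI: "J = I @ [a]" by (simp add: I_def a_def)
    then have IA: "set I \<subseteq> A" "a \<in> A" and len: "ns k \<le> length I" "length I < ns (Suc k)"
      using J False by auto
    have "forced I" using all[of "length I"] len JI by simp
    moreover have base: "base I = take (ns k) I" using stage[OF len] by (simp add: base_def)
    ultimately have less: "\<rho> (take (ns k) I) < d I" by (simp add: forced_def)
    let ?P = "take (ns k) I"
    have P: "?P \<in> words A (ns k)" using IA len set_take_subset[of "ns k" I] by (auto simp: words_def)
    have J': "J = ?P @ (drop (ns k) I @ [a])" by (simp add: JI)
    have "m J \<le> m ?P" 
      using m_append[of "drop (ns k) I @ [a]" ?P] J' IA set_drop_subset[of "ns k" I] by auto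
    also have "\<dots> \<le> (\<kappa> * \<rho> ?P) powr \<tau>" using at_ns[OF P] by simp
    also have "\<dots> \<le> (\<kappa> * d I) powr \<tau>"
      using less \<kappa>(1) \<tau> \<rho>_pos[of ?P] P by (intro powr_mono2) (auto simp: words_def)
    also have "\<dots> \<le> d J powr \<tau>"
      using \<kappa> \<tau> IA d_pos[OF IA(1)] unfolding JI by (intro powr_mono2) auto
    finally show ?thesis .
  qed
  have cw_le1: "cw J \<le> 1" if "set J \<subseteq> A" for J
  proof -
    have "d J \<le> d []" using d_mono[of "[]" J] cyl_X[OF that] by simp
    then have "cw J * d [] \<le> 1 * d []" using cw_d[OF that] by simp
    then show ?thesis using d_Nil_pos by simp
  qed
  have cw_\<tau>: "cw J powr \<sigma> \<le> cw J powr \<tau>" if "set J \<subseteq> A" for J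
    using cw_le1[OF that] cw_pos[OF that] \<tau> by (intro powr_mono') auto
  have m_bound: "m I \<le> ((K / d []) powr \<tau> + K powr \<tau>) * d I powr \<tau>" if I: "set I \<subseteq> A" for I
  proof (cases "length I < ns 0")
    case True
    have "m ([] @ I) \<le> m [] * cw I powr \<sigma>"
      by (rule m_free[OF I]) (use True in \<open>auto intro!: free_start\<close>)
    also have "\<dots> \<le> cw I powr \<tau>" using cw_\<tau>[OF I] m_Nil by simp
    also have "\<dots> \<le> (K / d [] * d I) powr \<tau>"
    proof (rule powr_mono2)
      show "cw I \<le> K / d [] * d I"
        using cw_append[of "[]" I] I d_Nil_pos by (simp add: field_simps)
    qed (use \<tau> cw_pos[OF I] in auto)
    finally have "m I \<le> (K / d []) powr \<tau> * d I powr \<tau>"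
      by (simp add: powr_mult del: times_divide_eq_left)
    then show ?thesis unfolding distrib_right by (simp add: add_increasing2)
  next
    case False
    then have "ns 0 \<le> length I" by simp
    then obtain k where k: "ns k \<le> length I" "length I < ns (Suc k)" using stage_ex by blast
    show ?thesis
    proof (cases "\<forall>j. ns k \<le> j \<longrightarrow> j < length I \<longrightarrow> forced (take j I)")
      case True
      then have "m I \<le> d I powr \<tau>" using while_forced[of I k] I k by simp
      also have "\<dots> \<le> K powr \<tau> * d I powr \<tau>"
        using K_ge \<tau> by (simp add: ge_one_powr_ge_zero mult_le_cancel_right1)
      finally show ?thesis unfolding distrib_right by (simp add: add_increasing)
    next
      case False
      \<comment> \<open>the jump ends at the prefix \<open>J\<close> of length \<open>j\<close>, and the letters \<open>H\<close> after it are free\<close>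
      define j where "j = (LEAST j. ns k \<le> j \<and> j < length I \<and> \<not> forced (take j I))"
      have j: "ns k \<le> j" "j < length I" "\<not> forced (take j I)"
        using LeastI_ex[of "\<lambda>j. ns k \<le> j \<and> j < length I \<and> \<not> forced (take j I)"] False
        unfolding j_def by blast+
      have j_least: "forced (take i I)" if "ns k \<le> i" "i < j" for i
        using not_less_Least[of i "\<lambda>j. ns k \<le> j \<and> j < length I \<and> \<not> forced (take j I)"] that j
        unfolding j_def by fastforce
      define J H where "J = take j I" and "H = drop j I"
      have JH: "I = J @ H" "set J \<subseteq> A" "set H \<subseteq> A" "length J = j"
        using I j set_take_subset[of j I] set_drop_subset[of j I] by (auto simp: J_def H_def)
      have base_eq: "base (J @ take i H) = take (ns k) J" if "i < length H" for i
      proof -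
        have "length (J @ take i H) = j + i" using that JH by simp
        moreover have "j + i < ns (Suc k)" using that k JH by simp
        ultimately show ?thesis using stage[of k "j + i"] j JH by (simp add: base_def)
      qed
      have mJ: "m J \<le> d J powr \<tau>"
      proof (rule while_forced[of J k])
        show "forced (take i J)" if "ns k \<le> i" "i < length J" for i
        proof -
          have "take i J = take i I" using that(2) JH(4) by (simp add: J_def)
          then show ?thesis using j_least[of i] that JH(4) by simp
        qed
        show "set J \<subseteq> A" "ns k \<le> length J" "length J \<le> ns (Suc k)"
          using JH(2,4) j k by simp_all
      qed
      have "m (J @ H) \<le> m J * cw H powr \<sigma>"
      proof (rule m_free[OF JH(3)])
        fix i assume i: "i < length H"
        have "0 < length H" using i by linarith
        have "ns 0 \<le> j" using j(1) ns_mono strict_mono_less_eq[of ns 0 k] by simp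
        then have "d J \<le> \<rho> (take (ns k) J)"
          using j(3) base_eq[OF \<open>0 < length H\<close>] JH by (simp add: forced_def flip: J_def)
        moreover have "d (J @ take i H) \<le> d J"
          using JH set_take_subset[of i H] by (intro d_mono cyl_append) auto
        ultimately show "\<not> forced (J @ take i H)" using base_eq[OF i] by (simp add: forced_def)
      qed
      also have "\<dots> \<le> d J powr \<tau> * cw H powr \<tau>"
        using mJ cw_\<tau>[OF JH(3)] by (intro mult_mono) auto
      also have "\<dots> = (d J * cw H) powr \<tau>"
        using d_pos[OF JH(2)] cw_pos[OF JH(3)] by (simp add: powr_mult)
      also have "\<dots> \<le> (K * d I) powr \<tau>"
        using cw_append[OF JH(2,3)] JH(1) \<tau> d_pos[OF JH(2)] cw_pos[OF JH(3)]
        by (intro powr_mono2) auto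
      also have "\<dots> = K powr \<tau> * d I powr \<tau>" using K_pos d_pos[OF I] by (simp add: powr_mult)
      finally have "m I \<le> K powr \<tau> * d I powr \<tau>" using JH(1) by simp
      then show ?thesis unfolding distrib_right by (simp add: add_increasing)
    qed
  qed

  show ?thesis
  proof (rule mass_distribution_principle[OF m_Nil m0 m_add m_bound \<tau>(1)])
    fix x assume x: "\<And>n. \<exists>I\<in>words A n. 0 < m I \<and> x \<in> cyl I"
    have hit: "\<exists>P\<in>words A (ns k). x \<in> cball (F P z) (\<rho> P)" for k
    proof -
      obtain I where I: "I \<in> words A (Lf (ns k))" "0 < m I" "x \<in> cyl I" using x by blast
      have IA: "set I \<subseteq> A" and len: "length I = Lf (ns k)" using I by (auto simp: words_def)
      define P where "P = take (ns k) I"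
      have P: "P \<in> words A (ns k)" using I(1) Lf(1) by (simp add: P_def words_take)
      \<comment> \<open>\<open>j\<close> is where the jump from \<open>P\<close> ends: until then the letters of \<open>I\<close> are the forced ones\<close>
      define j where "j = (LEAST j. ns k \<le> j \<and> d (take j I) \<le> \<rho> P)"
      have *: "ns k \<le> Lf (ns k) \<and> d (take (Lf (ns k)) I) \<le> \<rho> P"
        using Lf(2)[OF P IA] len Lf(1)[of "ns k"] by simp
      have j: "ns k \<le> j" "d (take j I) \<le> \<rho> P" "j \<le> Lf (ns k)"
        using LeastI[of "\<lambda>j. ns k \<le> j \<and> d (take j I) \<le> \<rho> P", OF *]
          Least_le[of "\<lambda>j. ns k \<le> j \<and> d (take j I) \<le> \<rho> P", OF *] by (auto simp: j_def)
      have in_cyl: "F P z \<in> cyl (take i I)" if "ns k \<le> i" "i \<le> j" for i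
        using that
      proof (induction i rule: dec_induct)
        case base
        then show ?case using z by (simp add: P_def)
      next
        case (step i)
        have i: "i < length I" using step.prems j len by simp
        have leni: "length (take i I) = i" using i by simp
        have bs: "base (take i I) = P"
        proof -
          have "i < ns (Suc k)" using i len Lf_less[of k] by simp
          then show ?thesis using stage[of k i] step.hyps leni by (simp add: base_def P_def min_def)
        qed
        have "\<not> (ns k \<le> i \<and> d (take i I) \<le> \<rho> P)"
          using not_less_Least[of i "\<lambda>j. ns k \<le> j \<and> d (take j I) \<le> \<rho> P"] step.prems
          by (simp add: j_def)
        moreover have "ns 0 \<le> i" using step.hyps ns_mono strict_mono_less_eq[of ns 0 k] by simp
        ultimately have forc: "forced (take i I)" using step.hyps bs leni by (simp add: forced_def)
        have eq: "take (Suc i) I = take i I @ [I ! i]" using i by (simp add: take_Suc_conv_app_nth)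
        have "0 < m (take (Suc i) I)"
        proof -
          have "set (drop (Suc i) I) \<subseteq> A" using IA set_drop_subset[of "Suc i" I] by (rule order_trans[rotated])
          then have "m I \<le> m (take (Suc i) I)"
            using m_append[of "drop (Suc i) I" "take (Suc i) I"] by simp
          then show ?thesis using I(2) by simp
        qed
        then have "q (take i I) (I ! i) \<noteq> 0" by (auto simp: eq m_snoc)
        then have "I ! i = tgt (take i I)" using forc by (simp add: q_def split: if_splits)
        then show ?case using tgt(2)[of "take i I"] step bs eq by simp
      qed
      have "F P z \<in> cyl (take j I)" using in_cyl j by simp
      moreover have "x \<in> cyl (take j I)" using I(3) cyl_take[OF IA] by blast
      moreover have "set (take j I) \<subseteq> A" using IA set_take_subset[of j I] by blast
      ultimately have "dist (F P z) x \<le> \<rho> P" using dist_le_d[of "take j I"] j(2) by fastforce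
      then show ?thesis using P by auto
    qed
    have "infinite {I \<in> nonempty_words A. x \<in> cball (F I z) (\<rho> I)}" (is "infinite ?H")
    proof
      assume "finite ?H"
      then have "finite (length ` ?H)" by simp
      moreover have "range ns \<subseteq> length ` ?H"
      proof clarify
        fix k
        obtain P where P: "P \<in> words A (ns k)" "x \<in> cball (F P z) (\<rho> P)" using hit by blast
        then have "P \<in> nonempty_words A" using ns_pos[of k] by (auto simp: nonempty_words_def)
        then show "ns k \<in> length ` ?H" using P by (auto simp: words_def image_iff)
      qed
      ultimately have "finite (range ns)" by (rule rev_finite_subset)
      then show False using ns_mono by (simp add: finite_image_iff strict_mono_imp_inj_on)
    qed
    moreover have "x \<in> X" using x[of 0] by (auto simp: words_0)
    ultimately show "x \<in> W_set A f X \<rho> z" by (simp add: W_set_def)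
  qed
qed

end

section \<open>Blocks of letters as letters\<close>

lemma word_map_concat: "word_map (word_map f) Is = word_map f (concat Is)"
  by (induction Is) (auto simp: word_map_append)

lemma concat_words: "Is \<in> words (words A N) q \<Longrightarrow> concat Is \<in> words A (q * N)"
  by (induction Is arbitrary: q) (auto simp: words_def)

lemma set_concat_blocks: "set Is \<subseteq> words A N \<Longrightarrow> set (concat Is) \<subseteq> A"
  by (auto simp: words_def)

lemma length_concat_blocks: "set Is \<subseteq> words A N \<Longrightarrow> length (concat Is) = length Is * N"
  by (induction Is) (auto simp: words_def)

lemma inj_on_concat_blocks:
  assumes "0 < N" shows "inj_on concat {Is. set Is \<subseteq> words A N}"
proof (rule inj_onI, clarify)
  fix Is Js assume "set Is \<subseteq> words A N" "set Js \<subseteq> words A N" "concat Is = concat Js"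
  then show "Is = Js"
  proof (induction Is arbitrary: Js)
    case Nil
    have "concat Js = []" using Nil.prems by simp
    then have "length Js * N = 0"
      using length_concat_blocks[of Js A N] Nil.prems(2) by (metis list.size(3))
    then show ?case using assms by simp
  next
    case (Cons I Is)
    have "length (concat (I # Is)) = length (I # Is) * N"
      using Cons.prems(1) by (rule length_concat_blocks)
    then have "concat (I # Is) \<noteq> []" using assms by (metis length_0_conv list.distinct(1) mult_is_0 not_gr_zero)
    then have "Js \<noteq> []" using Cons.prems(3) by (metis concat.simps(1))
    then obtain J Js' where J: "Js = J # Js'" by (cases Js) auto
    have "length I = length J" using Cons.prems J by (auto simp: words_def)
    moreover have "I @ concat Is = J @ concat Js'" using Cons.prems(3) J by simp
    ultimately have "I = J" "concat Is = concat Js'" by simp_all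
    moreover have "set Is \<subseteq> words A N" "set Js' \<subseteq> words A N" using Cons.prems(1,2) J by simp_all
    ultimately show ?case using Cons.IH[of Js'] J by simp
  qed
qed

context distorted_ifs
begin

text \<open>Products of letterwise contraction bounds lose a factor for every letter, whereas the distortion
constant \<open>K\<close> is uniform over all words. Passing to long blocks makes the loss per letter negligible, and
the constant \<open>K\<close> serves the block system as well.\<close>
lemma blocks_distorted_ifs:
  assumes N: "0 < N"
  shows "distorted_ifs (words A N) (word_map f) X S U r K a\<^sub>0 u"
proof
  show "finite (words A N)" by (rule finite_words[OF finA])
  show "X = (\<Union>I\<in>words A N. F I ` X)" by (rule X_words)
  fix I assume "I \<in> words A N"
  then have I: "set I \<subseteq> A" "length I = N" by (auto simp: words_def)
  show "F I ` S \<subseteq> S" using F_S[OF I(1)] by auto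
  show "inj_on (F I) S" by (rule F_inj[OF I(1)])
  show "F I ` U \<subseteq> U" using F_U[OF I(1)] by auto
  show "inj_on (F I) U" using I(1)
  proof (induction I)
    case (Cons i I)
    have "F I ` U \<subseteq> U" using Cons.prems F_U[of I] by auto
    then have "inj_on (f i) (F I ` U)" using Cons.prems inj_U[of i] by (auto intro: inj_on_subset)
    moreover have "inj_on (F I) U" using Cons by simp
    ultimately show ?case unfolding word_map.simps by (intro comp_inj_on)
  qed simp
  show "dist (F I x) (F I y) \<le> r * dist x y" if "x \<in> S" "y \<in> S" for x y
  proof -
    have "r ^ N \<le> r ^ 1" using N r_pos r_less by (intro power_decreasing) auto
    then have "r ^ N * dist x y \<le> r * dist x y" by (intro mult_right_mono) auto
    then show ?thesis using F_contr[OF I(1) that] I(2) by simp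
  qed
  fix J assume J: "J \<in> words A N" "I \<noteq> J"
  then have "length J = length I" using I(2) by (simp add: words_def)
  then have "\<nexists>L. J = I @ L" "\<nexists>L. I = J @ L" using J(2) by force+
  then show "F I ` U \<inter> F J ` U = {}"
    using I(1) J(1) by (intro F_U_disjoint) (simp_all add: words_def)
next
  fix Is x y x' y' assume "set Is \<subseteq> words A N" "x \<in> S" "y \<in> S" "x' \<in> S" "y' \<in> S"
  then show "dist (word_map (word_map f) Is x) (word_map (word_map f) Is y) * dist x' y'
        \<le> K * dist (word_map (word_map f) Is x') (word_map (word_map f) Is y') * dist x y"
    unfolding word_map_concat by (intro distort set_concat_blocks)
qed (rule compact_X X_ne diam_X XS bdd_S r_pos r_less K_ge a0_pos seed)+

definition "Z n s = (\<Sum>I\<in>words A n. d I powr s)"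

lemma Z_nonneg: "0 \<le> Z n s"
  by (simp add: Z_def sum_nonneg)

text \<open>The map of a block \<open>I\<close> multiplies distances by at least \<open>d I / (K * d [])\<close>, so the assumption on \<open>Z\<close> is the one on contraction
ratios of blocks. Concatenation is injective on sequences of blocks of equal length; hence infinitely
many block words give infinitely many words.\<close>
lemma hausdorff_dim_W_set_ge_blocks:
  assumes N: "0 < N" and Z: "(K * d []) powr \<sigma> \<le> Z N \<sigma>"
    and \<tau>: "0 < \<tau>" "\<tau> < \<sigma>" and z: "z \<in> X"
    and \<rho>_pos: "\<And>P. set P \<subseteq> A \<Longrightarrow> 0 < \<rho> P"
    and \<rho>_big: "\<And>E m. \<exists>q\<ge>m. \<forall>P\<in>words A (q * N). E * d P powr \<sigma> \<le> \<rho> P powr \<tau>"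
  shows "ennreal \<tau> \<le> hausdorff_dim (W_set A f X \<rho> z)"
proof -
  interpret B: distorted_ifs "words A N" "word_map f" X S U r K a\<^sub>0 u
    by (rule blocks_distorted_ifs[OF N])
  have Bd: "B.d Is = d (concat Is)" for Is
    by (simp add: B.d_def d_def word_map_concat)
  have Kd: "0 < K * d []" using K_pos d_Nil_pos by simp
  have "ennreal \<tau> \<le> hausdorff_dim (W_set (words A N) (word_map f) X (\<lambda>Is. \<rho> (concat Is)) z)"
  proof (rule B.hausdorff_dim_W_set_ge[of "\<lambda>I. d I / (K * d [])" \<sigma> \<tau>])
    show "0 < d I / (K * d [])" if "I \<in> words A N" for I
      using that d_pos[of I] Kd by (auto simp: words_def)
    show "d I / (K * d []) * dist x y \<le> dist (F I x) (F I y)" if "I \<in> words A N" "x \<in> X" "y \<in> X" for I x y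
      using dist_F_ge[of I x y] that XS Kd by (auto simp: words_def pos_divide_le_eq mult.commute)
    have "(\<Sum>I\<in>words A N. (d I / (K * d [])) powr \<sigma>) = Z N \<sigma> / (K * d []) powr \<sigma>"
      by (simp add: Z_def powr_divide sum_divide_distrib)
    moreover have "0 < (K * d []) powr \<sigma>" using K_pos d_Nil_pos by simp
    ultimately show "1 \<le> (\<Sum>I\<in>words A N. (d I / (K * d [])) powr \<sigma>)"
      using Z by (simp add: pos_le_divide_eq del: mult_pos_pos)
    show "0 < \<rho> (concat Is)" if "set Is \<subseteq> words A N" for Is
      using \<rho>_pos set_concat_blocks[OF that] .
    show "\<exists>n\<ge>m. \<forall>Is\<in>words (words A N) n. E * B.d Is powr \<sigma> \<le> \<rho> (concat Is) powr \<tau>" for E m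
      using \<rho>_big[of m E] concat_words unfolding Bd by blast
  qed (use \<tau> z in auto)
  also have "\<dots> \<le> hausdorff_dim (W_set A f X \<rho> z)"
  proof (rule hausdorff_dim_mono, rule subsetI)
    fix x assume "x \<in> W_set (words A N) (word_map f) X (\<lambda>Is. \<rho> (concat Is)) z"
    then have x: "x \<in> X" and inf: "infinite {Is \<in> nonempty_words (words A N).
        x \<in> cball (word_map (word_map f) Is z) (\<rho> (concat Is))}" (is "infinite ?H")
      by (auto simp: W_set_def)
    have sub: "?H \<subseteq> {Is. set Is \<subseteq> words A N}" by (auto simp: nonempty_words_def words_def[of "words A N"])
    have "infinite (concat ` ?H)"
      using inf finite_imageD[OF _ inj_on_subset[OF inj_on_concat_blocks[OF N] sub]] by blast
    moreover have "concat ` ?H \<subseteq> {I \<in> nonempty_words A. x \<in> cball (F I z) (\<rho> I)}"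
    proof (rule image_subsetI)
      fix Is assume "Is \<in> ?H"
      then obtain q where q: "Is \<in> words (words A N) q" "1 \<le> q"
        and xI: "x \<in> cball (F (concat Is) z) (\<rho> (concat Is))"
        unfolding nonempty_words_def word_map_concat by blast
      have "concat Is \<in> words A (q * N)" by (rule concat_words[OF q(1)])
      moreover have "1 \<le> q * N" using q(2) N by simp
      ultimately have "concat Is \<in> nonempty_words A" unfolding nonempty_words_def by blast
      then show "concat Is \<in> {I \<in> nonempty_words A. x \<in> cball (F I z) (\<rho> I)}" using xI by blast
    qed
    ultimately have "infinite {I \<in> nonempty_words A. x \<in> cball (F I z) (\<rho> I)}"
      using infinite_super by blast
    then show "x \<in> W_set A f X \<rho> z" using x by (simp add: W_set_def)
  qed
  finally show ?thesis .
qed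

section \<open>Growth of the sums of diameters\<close>

lemma Z_shift:
  assumes "s \<le> \<sigma>" shows "Z n \<sigma> \<le> Z n s * (r ^ n * d []) powr (\<sigma> - s)"
  unfolding Z_def sum_distrib_right
proof (rule sum_mono)
  fix I assume "I \<in> words A n"
  then have I: "set I \<subseteq> A" "length I = n" by (auto simp: words_def)
  have "d I powr \<sigma> = d I powr s * d I powr (\<sigma> - s)" by (simp flip: powr_add)
  also have "\<dots> \<le> d I powr s * (r ^ n * d []) powr (\<sigma> - s)"
    using d_le[OF I(1)] d_pos[OF I(1)] I(2) assms by (intro mult_left_mono powr_mono2) auto
  finally show "d I powr \<sigma> \<le> d I powr s * (r ^ n * d []) powr (\<sigma> - s)" .
qed

text \<open>The cylinders of length \<open>n\<close> cover \<open>X\<close>, and raising the exponent from \<open>\<sigma>\<close> to \<open>\<sigma>'\<close> multiplies \<open>Z n\<close> by a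
factor that tends to \<open>0\<close>.\<close>
lemma hausdorff_dim_X_le:
  assumes \<sigma>: "\<sigma> < \<sigma>'" "0 < \<sigma>'" and Z: "\<And>n. 0 < n \<Longrightarrow> Z n \<sigma> \<le> C"
  shows "hausdorff_dim X \<le> ennreal \<sigma>'"
proof (rule hausdorff_dim_le_if_covers[OF \<sigma>(2)])
  fix \<delta> \<eta> :: real assume \<delta>: "0 < \<delta>" and \<eta>: "0 < \<eta>"
  define \<beta> where "\<beta> = \<sigma>' - \<sigma>"
  have \<beta>: "0 < \<beta>" using \<sigma> by (simp add: \<beta>_def)
  have C: "0 \<le> C" using Z[of 1] Z_nonneg[of 1 \<sigma>] by simp
  define e where "e = (\<eta> / (C + 1)) powr (1 / \<beta>)"
  have e: "0 < e" using \<eta> C by (simp add: e_def)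
  obtain n where n: "r ^ n < min \<delta> e / d []"
    using real_arch_pow_inv[of "min \<delta> e / d []" r] \<delta> e d_Nil_pos r_less by auto
  define n' where "n' = Suc n"
  have "r ^ n' \<le> r ^ n" using r_pos r_less unfolding n'_def by (intro power_decreasing) auto
  then have "r ^ n' * d [] \<le> min \<delta> e / d [] * d []"
    using n d_Nil_pos by (intro mult_right_mono) auto
  then have n': "r ^ n' * d [] \<le> min \<delta> e" using d_Nil_pos by simp
  show "\<exists>(J::'b list set) F. countable J \<and> X \<subseteq> (\<Union>j\<in>J. F j) \<and>
        (\<forall>j\<in>J. bounded (F j) \<and> diameter (F j) \<le> \<delta>) \<and>
        (\<forall>G\<subseteq>J. finite G \<longrightarrow> (\<Sum>j\<in>G. diameter (F j) powr \<sigma>') \<le> \<eta>)"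
  proof (intro exI[of _ "words A n'"] exI[of _ "\<lambda>I. cyl I"] conjI ballI allI impI)
    show "countable (words A n')" using finite_words[OF finA] by (rule countable_finite)
    show "X \<subseteq> (\<Union>I\<in>words A n'. cyl I)" using X_words[of n'] by simp
    fix I assume "I \<in> words A n'"
    then have I: "set I \<subseteq> A" "length I = n'" by (auto simp: words_def)
    show "bounded (cyl I)" using compact_cyl[OF I(1)] by (rule compact_imp_bounded)
    show "diameter (cyl I) \<le> \<delta>" using d_le[OF I(1)] I(2) n' by (simp add: d_def)
  next
    fix G assume G: "G \<subseteq> words A n'" "finite G"
    have "(\<Sum>I\<in>G. diameter (cyl I) powr \<sigma>') \<le> Z n' \<sigma>'"
      unfolding Z_def d_def using G finite_words[OF finA] by (intro sum_mono2) auto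
    also have "\<dots> \<le> Z n' \<sigma> * (r ^ n' * d []) powr \<beta>"
      using Z_shift[of \<sigma> \<sigma>' n'] \<sigma> by (simp add: \<beta>_def)
    also have "\<dots> \<le> C * e powr \<beta>"
      using Z[of n'] n' \<beta> C r_pos d_Nil_pos Z_nonneg
      by (intro mult_mono powr_mono2) (auto simp: n'_def)
    also have "e powr \<beta> = \<eta> / (C + 1)" using \<beta> \<eta> C by (simp add: e_def powr_powr)
    also have "C * (\<eta> / (C + 1)) \<le> \<eta>" using C \<eta> by (simp add: field_simps)
    finally show "(\<Sum>I\<in>G. diameter (cyl I) powr \<sigma>') \<le> \<eta>" by simp
  qed
qed

lemma hausdorff_dim_X_finite: "hausdorff_dim X < \<infinity>"
proof -
  \<comment> \<open>the similarity dimension of a system of \<open>card A\<close> maps of ratio \<open>r\<close>\<close>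
  define \<sigma> where "\<sigma> = ln (card A) / - ln r"
  have cA: "1 \<le> real (card A)" using finA A_ne by (simp add: Suc_le_eq card_gt_0_iff)
  have lr: "ln r < 0" using r_pos r_less by simp
  have \<sigma>: "0 \<le> \<sigma>" using cA lr by (simp add: \<sigma>_def divide_nonneg_neg)
  have *: "card A * r powr \<sigma> = 1"
  proof -
    have "r powr \<sigma> = exp (- ln (card A))" using r_pos lr by (simp add: powr_def \<sigma>_def)
    then show ?thesis using cA by (simp add: exp_minus)
  qed
  have "Z n \<sigma> \<le> d [] powr \<sigma>" for n
  proof -
    have "Z n \<sigma> \<le> (\<Sum>I\<in>words A n. (r powr \<sigma>) ^ n * d [] powr \<sigma>)"
      unfolding Z_def
    proof (rule sum_mono)
      fix I assume "I \<in> words A n"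
      then have I: "set I \<subseteq> A" "length I = n" by (auto simp: words_def)
      have "d I powr \<sigma> \<le> (r ^ n * d []) powr \<sigma>"
        using d_le[OF I(1)] d_pos[OF I(1)] I(2) \<sigma> by (intro powr_mono2) auto
      also have "\<dots> = (r powr \<sigma>) ^ n * d [] powr \<sigma>"
        using r_pos d_Nil_pos by (simp add: powr_mult powr_powr mult.commute flip: powr_realpow)
      finally show "d I powr \<sigma> \<le> (r powr \<sigma>) ^ n * d [] powr \<sigma>" .
    qed
    also have "\<dots> = real (card (words A n)) * ((r powr \<sigma>) ^ n * d [] powr \<sigma>)" by simp
    also have "card (words A n) = card A ^ n" unfolding words_def by (rule card_lists_length_eq[OF finA])
    also have "real (card A ^ n) * ((r powr \<sigma>) ^ n * d [] powr \<sigma>) = (card A * r powr \<sigma>) ^ n * d [] powr \<sigma>"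
      by (simp add: power_mult_distrib)
    finally show ?thesis by (simp add: *)
  qed
  then have "hausdorff_dim X \<le> ennreal (\<sigma> + 1)" using \<sigma> by (intro hausdorff_dim_X_le[of \<sigma>]) auto
  also have "\<dots> < \<infinity>" by simp
  finally show ?thesis .
qed

text \<open>Diameters decay at most exponentially, so a small power of them decays at an arbitrarily slow rate.\<close>
lemma d_exp_lower:
  fixes \<epsilon> :: real
  assumes "0 < \<epsilon>"
  shows "\<exists>\<delta>>0. \<forall>I. set I \<subseteq> A \<longrightarrow> exp (- \<epsilon> * length I) * d [] powr \<delta> \<le> d I powr \<delta>"
proof -
  obtain \<kappa> where \<kappa>: "0 < \<kappa>" "\<And>I a. set I \<subseteq> A \<Longrightarrow> a \<in> A \<Longrightarrow> \<kappa> * d I \<le> d (I @ [a])"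
    using letter_loss by blast
  define \<delta> where "\<delta> = \<epsilon> / (\<bar>ln \<kappa>\<bar> + 1)"
  have \<delta>: "0 < \<delta>" using assms by (simp add: \<delta>_def)
  have "\<delta> * - ln \<kappa> \<le> \<delta> * (\<bar>ln \<kappa>\<bar> + 1)" using \<delta> by (intro mult_left_mono) auto
  also have "\<dots> = \<epsilon>" by (simp add: \<delta>_def add_nonneg_eq_0_iff)
  finally have "- \<epsilon> \<le> \<delta> * ln \<kappa>" by simp
  then have \<kappa>\<delta>: "exp (- \<epsilon>) \<le> \<kappa> powr \<delta>" using \<kappa>(1) by (simp add: powr_def)
  have "exp (- \<epsilon> * length I) * d [] powr \<delta> \<le> d I powr \<delta>" if "set I \<subseteq> A" for I
    using that
  proof (induction I rule: rev_induct)
    case (snoc a I)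
    have "exp (- \<epsilon> * length (I @ [a])) * d [] powr \<delta> = exp (- \<epsilon>) * (exp (- \<epsilon> * length I) * d [] powr \<delta>)"
      by (simp add: algebra_simps flip: exp_add)
    also have "\<dots> \<le> \<kappa> powr \<delta> * d I powr \<delta>"
      using snoc \<kappa>\<delta> by (intro mult_mono) auto
    also have "\<dots> = (\<kappa> * d I) powr \<delta>" by (simp add: powr_mult)
    also have "\<dots> \<le> d (I @ [a]) powr \<delta>"
      using \<kappa> snoc.prems d_pos[of I] \<delta> by (intro powr_mono2) auto
    finally show ?case .
  qed simp
  then show ?thesis using \<delta> by blast
qed

text \<open>Otherwise take a large \<open>n\<close> with \<open>Z n s > exp (\<epsilon> * n)\<close>. Raising the exponent slightly to \<open>\<sigma> > s\<close> costs a factor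
\<open>exp (- \<epsilon>/2 * n)\<close> at most, so \<open>Z n \<sigma>\<close> is still large enough for the Cantor construction with blocks of
length \<open>n\<close> and \<open>\<rho> = d\<close>. It yields a subset of \<open>X\<close> of dimension above \<open>s\<close>.\<close>
lemma Z_le_exp:
  fixes \<epsilon> :: real
  assumes s: "0 < s" "hausdorff_dim X \<le> ennreal s" and \<epsilon>: "0 < \<epsilon>"
  shows "\<exists>n\<^sub>0. \<forall>n\<ge>n\<^sub>0. Z n s \<le> exp (\<epsilon> * n)"
proof (rule ccontr)
  assume "\<not> ?thesis"
  then have big: "\<And>n\<^sub>0. \<exists>n\<ge>n\<^sub>0. exp (\<epsilon> * n) < Z n s" by (metis not_le)
  obtain \<delta> where \<delta>: "0 < \<delta>"
    "\<And>I. set I \<subseteq> A \<Longrightarrow> exp (- (\<epsilon>/2) * length I) * d [] powr \<delta> \<le> d I powr \<delta>"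
    using d_exp_lower[of "\<epsilon>/2"] \<epsilon> by auto
  define \<sigma> where "\<sigma> = s + \<delta>"
  define \<tau> where "\<tau> = s + \<delta> / 2"
  obtain n\<^sub>0 :: nat where n0: "(K * d []) powr \<sigma> / d [] powr \<delta> / (\<epsilon> / 2) \<le> n\<^sub>0"
    using real_arch_simple by blast
  obtain n where n: "n \<ge> Suc n\<^sub>0" "exp (\<epsilon> * n) < Z n s" using big by blast
  have "(K * d []) powr \<sigma> / d [] powr \<delta> \<le> \<epsilon> / 2 * n\<^sub>0"
    using n0 \<epsilon> by (metis half_gt_zero pos_divide_le_eq mult.commute)
  also have "\<dots> \<le> \<epsilon> / 2 * n" using n \<epsilon> by simp
  also have "\<dots> \<le> exp (\<epsilon> / 2 * n)" using exp_ge_add_one_self[of "\<epsilon> / 2 * n"] by linarith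
  finally have "(K * d []) powr \<sigma> \<le> exp (\<epsilon> / 2 * n) * d [] powr \<delta>"
    using d_Nil_pos by (simp add: field_simps)
  also have "\<dots> = exp (\<epsilon> * n) * (exp (- (\<epsilon>/2) * n) * d [] powr \<delta>)"
    by (simp flip: exp_add mult.assoc)
  also have "\<dots> \<le> Z n s * (exp (- (\<epsilon>/2) * n) * d [] powr \<delta>)"
    using n(2) by (intro mult_right_mono) auto
  also have "\<dots> \<le> Z n \<sigma>"
    unfolding Z_def sum_distrib_right
  proof (rule sum_mono)
    fix I assume "I \<in> words A n"
    then have I: "set I \<subseteq> A" "length I = n" by (auto simp: words_def)
    have "d I powr s * (exp (- (\<epsilon>/2) * n) * d [] powr \<delta>) \<le> d I powr s * d I powr \<delta>"
      using \<delta>(2)[OF I(1)] I(2) by (intro mult_left_mono) auto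
    also have "\<dots> = d I powr \<sigma>" by (simp add: \<sigma>_def powr_add)
    finally show "d I powr s * (exp (- (\<epsilon>/2) * n) * d [] powr \<delta>) \<le> d I powr \<sigma>" .
  qed
  finally have Z: "(K * d []) powr \<sigma> \<le> Z n \<sigma>" .
  obtain z where z: "z \<in> X" using X_ne by auto
  have "ennreal \<tau> \<le> hausdorff_dim (W_set A f X d z)"
  proof (rule hausdorff_dim_W_set_ge_blocks[OF _ Z _ _ z])
    show "\<exists>q\<ge>m. \<forall>P\<in>words A (q * n). E * d P powr \<sigma> \<le> d P powr \<tau>" for E m
    proof -
      obtain m' where m': "\<And>I. set I \<subseteq> A \<Longrightarrow> m' \<le> length I \<Longrightarrow> E * d I powr \<sigma> \<le> d I powr \<tau>"
        using small_power[of \<tau> \<sigma> E] \<delta>(1) by (auto simp: \<tau>_def \<sigma>_def)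
      have "max m m' * 1 \<le> max m m' * n" using n(1) by (intro mult_le_mono2) simp
      then have "m' \<le> max m m' * n" by simp
      then show ?thesis using m' by (intro exI[of _ "max m m'"]) (auto simp: words_def)
    qed
  qed (use s \<delta> n d_pos in \<open>auto simp: \<tau>_def \<sigma>_def\<close>)
  also have "\<dots> \<le> hausdorff_dim X" by (rule hausdorff_dim_mono) (auto simp: W_set_def)
  also have "\<dots> \<le> ennreal s" by (rule s)
  finally show False using s(1) \<delta>(1) by (simp add: \<tau>_def)
qed

section \<open>The dimension of the limsup set\<close>

text \<open>For every \<open>m\<close> the balls of the words of length at least \<open>m\<close> cover the limsup set. Their diameters to the
power \<open>\<sigma> / t\<close> are at most a constant times \<open>d I powr \<sigma>\<close>, and the sums \<open>Z n \<sigma>\<close> decay geometrically, as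
\<open>Z n s\<close> grows subexponentially.\<close>
lemma hausdorff_dim_W_set_le:
  assumes s: "0 < s" "hausdorff_dim X \<le> ennreal s" "s < \<sigma>" and t: "1 \<le> t"
    and \<theta>: "\<And>n. 0 < n \<Longrightarrow> 0 \<le> \<theta> n \<and> \<theta> n \<le> B"
  shows "hausdorff_dim (W_set A f X (\<lambda>I. (d I * \<theta> (length I)) powr t) z) \<le> ennreal (\<sigma> / t)"
proof (rule hausdorff_dim_le_if_covers)
  show "0 < \<sigma> / t" using s t by simp
  fix \<delta> \<eta> :: real assume \<delta>: "0 < \<delta>" and \<eta>: "0 < \<eta>"
  define \<beta> where "\<beta> = \<sigma> - s"
  have \<beta>: "0 < \<beta>" using s by (simp add: \<beta>_def)
  \<comment> \<open>half of the decay rate \<open>- \<beta> * ln r\<close> gained from the larger exponent\<close>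
  define \<epsilon> where "\<epsilon> = - (\<beta> * ln r / 2)"
  have \<epsilon>: "0 < \<epsilon>" using \<beta> r_pos r_less by (simp add: \<epsilon>_def mult_pos_neg)
  define q where "q = exp (- \<epsilon>)"
  have q: "0 < q" "q < 1" using \<epsilon> by (auto simp: q_def)
  obtain n0 where n0: "\<And>n. n \<ge> n0 \<Longrightarrow> Z n s \<le> exp (\<epsilon> * n)" using Z_le_exp[OF s(1,2) \<epsilon>] by blast
  have Zq: "Z n \<sigma> \<le> d [] powr \<beta> * q ^ n" if "n \<ge> n0" for n
  proof -
    have rn: "(r ^ n * d []) powr \<beta> = exp (- (2 * \<epsilon>) * n) * d [] powr \<beta>"
    proof -
      have "(r ^ n * d []) powr \<beta> = (r ^ n) powr \<beta> * d [] powr \<beta>" by (rule powr_mult)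
      moreover have "(r ^ n) powr \<beta> = exp (- (2 * \<epsilon>) * n)"
        using r_pos by (simp add: powr_def ln_realpow \<epsilon>_def mult_ac)
      ultimately show ?thesis by simp
    qed
    have "Z n \<sigma> \<le> Z n s * (r ^ n * d []) powr \<beta>"
      using Z_shift[of s \<sigma> n] s by (simp add: \<beta>_def)
    also have "\<dots> \<le> exp (\<epsilon> * n) * (exp (- (2 * \<epsilon>) * n) * d [] powr \<beta>)"
      unfolding rn using n0[OF that] by (intro mult_right_mono) auto
    also have "\<dots> = (exp (\<epsilon> * n) * exp (- (2 * \<epsilon>) * n)) * d [] powr \<beta>" by (simp only: mult.assoc)
    also have "exp (\<epsilon> * n) * exp (- (2 * \<epsilon>) * n) = exp (n * - \<epsilon>)"
      by (simp add: algebra_simps flip: exp_add)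
    also have "\<dots> = q ^ n" unfolding q_def by (rule exp_of_nat_mult)
    finally show ?thesis by (simp add: mult.commute)
  qed
  define B' where "B' = max B 1"
  define C where "C = 2 powr (\<sigma> / t) * B' powr \<sigma> * d [] powr \<beta> / (1 - q)"
  have C: "0 < C" using q d_Nil_pos by (simp add: C_def B'_def)
  define e where "e = (\<delta> / 2) powr (1 / t) / B'"
  have e: "0 < e" using \<delta> by (simp add: e_def B'_def)
  obtain n1 where n1: "\<And>I. set I \<subseteq> A \<Longrightarrow> n1 \<le> length I \<Longrightarrow> d I \<le> e" using d_small[OF e] by blast
  obtain n2 where n2: "q ^ n2 < \<eta> / C" using real_arch_pow_inv[of "\<eta> / C" q] \<eta> C q by auto
  define m where "m = Suc (max n0 (max n1 n2))"
  define \<rho> where "\<rho> I = (d I * \<theta> (length I)) powr t" for I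
  define J where "J = {I. set I \<subseteq> A \<and> m \<le> length I}"
  have \<rho>0: "0 \<le> \<rho> I" for I by (simp add: \<rho>_def)
  have J: "0 \<le> d I * \<theta> (length I)" "d I * \<theta> (length I) \<le> d I * B'" "0 < d I" "d I \<le> e"
    if "I \<in> J" for I
  proof -
    have I: "set I \<subseteq> A" "m \<le> length I" using that by (auto simp: J_def)
    show "0 < d I" by (rule d_pos[OF I(1)])
    moreover have "0 < length I" using I(2) unfolding m_def by linarith
    then have "0 \<le> \<theta> (length I)" "\<theta> (length I) \<le> B'"
      using \<theta>[of "length I"] by (auto simp: B'_def)
    ultimately show "0 \<le> d I * \<theta> (length I)" "d I * \<theta> (length I) \<le> d I * B'" by auto
    show "d I \<le> e" using n1 I by (simp add: m_def)
  qed
  have diam: "diameter (cball (F I z) (\<rho> I)) \<le> 2 * \<rho> I" for I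
    using \<rho>0[of I] by (simp add: diameter_cball)
  show "\<exists>(J::'b list set) G. countable J \<and> W_set A f X (\<lambda>I. (d I * \<theta> (length I)) powr t) z \<subseteq> (\<Union>I\<in>J. G I) \<and>
        (\<forall>I\<in>J. bounded (G I) \<and> diameter (G I) \<le> \<delta>) \<and>
        (\<forall>H\<subseteq>J. finite H \<longrightarrow> (\<Sum>I\<in>H. diameter (G I) powr (\<sigma> / t)) \<le> \<eta>)"
  proof (intro exI[of _ J] exI[of _ "\<lambda>I. cball (F I z) (\<rho> I)"] conjI ballI allI impI)
    have "J \<subseteq> lists A" by (auto simp: J_def)
    moreover have "countable (lists A)" using countable_finite[OF finA] by (rule countable_lists)
    ultimately show "countable J" by (rule countable_subset)
    show "W_set A f X (\<lambda>I. (d I * \<theta> (length I)) powr t) z \<subseteq> (\<Union>I\<in>J. cball (F I z) (\<rho> I))"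
    proof
      fix x assume "x \<in> W_set A f X (\<lambda>I. (d I * \<theta> (length I)) powr t) z"
      then have inf: "infinite {I \<in> nonempty_words A. x \<in> cball (F I z) (\<rho> I)}"
        by (simp add: W_set_def \<rho>_def)
      have "finite (\<Union>n<m. words A n)" using finite_words[OF finA] by blast
      then have "\<not> {I \<in> nonempty_words A. x \<in> cball (F I z) (\<rho> I)} \<subseteq> (\<Union>n<m. words A n)"
        using inf finite_subset by metis
      then obtain I where "I \<in> nonempty_words A" "x \<in> cball (F I z) (\<rho> I)" "I \<notin> (\<Union>n<m. words A n)"
        by blast
      moreover from this have "I \<in> J" by (auto simp: J_def nonempty_words_def words_def)
      ultimately show "x \<in> (\<Union>I\<in>J. cball (F I z) (\<rho> I))" by blast
    qed
    show "bounded (cball (F I z) (\<rho> I))" for I by (rule bounded_cball)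
    fix I assume I: "I \<in> J"
    have "d I * \<theta> (length I) \<le> d I * B'" by (rule J(2)[OF I])
    also have "\<dots> \<le> e * B'" using J(4)[OF I] by (intro mult_right_mono) (auto simp: B'_def)
    also have "\<dots> = (\<delta> / 2) powr (1 / t)" by (simp add: e_def B'_def)
    finally have "\<rho> I \<le> ((\<delta> / 2) powr (1 / t)) powr t"
      unfolding \<rho>_def using J(1)[OF I] t by (intro powr_mono2) auto
    then have "\<rho> I \<le> \<delta> / 2" using t \<delta> by (simp add: powr_powr)
    then show "diameter (cball (F I z) (\<rho> I)) \<le> \<delta>" using diam[of I] by simp
  next
    fix H assume H: "H \<subseteq> J" "finite H"
    define M where "M = Max (insert m (length ` H))"
    have HM: "H \<subseteq> (\<Union>n\<in>{m..M}. words A n)"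
    proof
      fix I assume I: "I \<in> H"
      then have "length I \<le> M" using H(2) by (simp add: M_def)
      then show "I \<in> (\<Union>n\<in>{m..M}. words A n)" using I H(1) by (auto simp: J_def words_def)
    qed
    have "(\<Sum>I\<in>H. diameter (cball (F I z) (\<rho> I)) powr (\<sigma> / t))
        \<le> (\<Sum>I\<in>H. 2 powr (\<sigma> / t) * B' powr \<sigma> * d I powr \<sigma>)"
    proof (rule sum_mono)
      fix I assume "I \<in> H"
      then have I: "I \<in> J" using H by auto
      have "diameter (cball (F I z) (\<rho> I)) powr (\<sigma> / t) \<le> (2 * \<rho> I) powr (\<sigma> / t)"
        using diam[of I] s t diameter_ge_0[of "cball (F I z) (\<rho> I)"] by (intro powr_mono2) auto
      also have "\<dots> = 2 powr (\<sigma> / t) * (d I * \<theta> (length I)) powr \<sigma>"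
        using t by (simp add: powr_mult \<rho>_def powr_powr)
      also have "\<dots> \<le> 2 powr (\<sigma> / t) * (d I * B') powr \<sigma>"
        using J[OF I] s by (intro mult_left_mono powr_mono2) auto
      also have "\<dots> = 2 powr (\<sigma> / t) * B' powr \<sigma> * d I powr \<sigma>" by (simp add: powr_mult)
      finally show "diameter (cball (F I z) (\<rho> I)) powr (\<sigma> / t)
          \<le> 2 powr (\<sigma> / t) * B' powr \<sigma> * d I powr \<sigma>" .
    qed
    also have "\<dots> = 2 powr (\<sigma> / t) * B' powr \<sigma> * (\<Sum>I\<in>H. d I powr \<sigma>)" by (simp add: sum_distrib_left)
    also have "(\<Sum>I\<in>H. d I powr \<sigma>) \<le> (\<Sum>I\<in>(\<Union>n\<in>{m..M}. words A n). d I powr \<sigma>)"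
      by (rule sum_mono2[OF _ HM]) (use finite_words[OF finA] in auto)
    also have "\<dots> = (\<Sum>n\<in>{m..M}. Z n \<sigma>)"
      unfolding Z_def by (rule sum.UNION_disjoint) (use finite_words[OF finA] in \<open>auto simp: words_def\<close>)
    also have "\<dots> \<le> (\<Sum>n\<in>{m..M}. d [] powr \<beta> * q ^ n)"
      by (rule sum_mono) (use Zq in \<open>auto simp: m_def\<close>)
    also have "\<dots> = d [] powr \<beta> * (\<Sum>n\<in>{m..M}. q ^ n)" by (simp add: sum_distrib_left)
    also have "(\<Sum>n\<in>{m..M}. q ^ n) \<le> q ^ m / (1 - q)"
    proof -
      have "(\<Sum>n\<in>{m..M}. q ^ n) \<le> (\<Sum>n. q ^ (n + m))"
      proof -
        have "(\<Sum>n\<in>{m..M}. q ^ n) = (\<Sum>n<Suc M - m. q ^ (n + m))"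
          by (rule sum.reindex_bij_witness[of _ "\<lambda>n. n + m" "\<lambda>n. n - m"]) auto
        also have "\<dots> \<le> (\<Sum>n. q ^ (n + m))"
          using q by (intro sum_le_suminf) (auto simp: summable_geometric power_add intro!: summable_mult2)
        finally show ?thesis .
      qed
      also have "\<dots> = q ^ m / (1 - q)"
        using q by (simp add: power_add suminf_geometric summable_geometric flip: suminf_mult2)
      finally show ?thesis .
    qed
    also have "2 powr (\<sigma> / t) * B' powr \<sigma> * (d [] powr \<beta> * (q ^ m / (1 - q))) = C * q ^ m"
      by (simp add: C_def)
    also have "\<dots> \<le> C * q ^ n2" using C q by (intro mult_left_mono power_decreasing) (auto simp: m_def)
    also have "\<dots> \<le> \<eta>" using n2 C by (simp add: field_simps)
    finally show "(\<Sum>I\<in>H. diameter (cball (F I z) (\<rho> I)) powr (\<sigma> / t)) \<le> \<eta>"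
      by (simp add: mult_left_mono)
  qed
qed

text \<open>Choose \<open>\<sigma>\<close> between \<open>t * \<tau>\<close> and \<open>s\<close>. Since \<open>\<sigma>\<close> is below the dimension of \<open>X\<close>, blocks of some length \<open>N\<close> are
admissible. The gap between \<open>\<sigma>\<close> and \<open>t * \<tau>\<close> is an exponential gain in the length that outweighs
\<open>\<theta> powr (t * \<tau>)\<close>, provided that \<open>\<theta>\<close> is not too small; monotonicity moves a good length down to a multiple
of \<open>N\<close>.\<close>
lemma hausdorff_dim_W_set_ge_of_frequently:
  assumes s: "ennreal s \<le> hausdorff_dim X" and t: "1 \<le> t" and \<tau>: "0 < \<tau>" "\<tau> < s / t" and z: "z \<in> X"
    and \<theta>_pos: "\<And>n. 0 < \<theta> n" and \<theta>_mono: "\<And>m n. m \<le> n \<Longrightarrow> \<theta> n \<le> \<theta> m"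
    and freq: "\<And>\<epsilon> m. 0 < \<epsilon> \<Longrightarrow> \<exists>n\<ge>m. exp (- \<epsilon> * real n) \<le> \<theta> n"
  shows "ennreal \<tau> \<le> hausdorff_dim (W_set A f X (\<lambda>I. (d I * \<theta> (length I)) powr t) z)"
proof -
  have "\<tau> * t < s" using \<tau>(2) t pos_less_divide_eq[of t \<tau> s] by linarith
  then have ts: "t * \<tau> < s" by (simp only: mult.commute)
  define \<sigma> where "\<sigma> = (t * \<tau> + s) / 2"
  have "p < (p + s) / 2" "(p + s) / 2 < s" if "p < s" for p :: real using that by simp_all
  then have \<sigma>: "t * \<tau> < \<sigma>" "\<sigma> < s" using ts unfolding \<sigma>_def by blast+
  have "\<tau> \<le> t * \<tau>" using t \<tau> by simp
  then have \<tau>\<sigma>: "\<tau> < \<sigma>" using \<sigma> by simp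
  have "\<exists>N>0. (K * d []) powr \<sigma> \<le> Z N \<sigma>"
  proof (rule ccontr)
    assume "\<not> ?thesis"
    then have "\<And>n. 0 < n \<Longrightarrow> Z n \<sigma> \<le> (K * d []) powr \<sigma>" by (meson le_cases)
    then have "hausdorff_dim X \<le> ennreal ((\<sigma> + s) / 2)"
      using \<sigma> \<tau>\<sigma> \<tau> by (intro hausdorff_dim_X_le[of \<sigma>]) auto
    with s have "ennreal s \<le> ennreal ((\<sigma> + s) / 2)" by (rule order_trans)
    then show False using \<sigma> \<tau>\<sigma> \<tau> by (simp add: ennreal_le_iff)
  qed
  then obtain N where N: "0 < N" "(K * d []) powr \<sigma> \<le> Z N \<sigma>" by blast
  define \<beta> where "\<beta> = \<sigma> - t * \<tau>"
  have \<beta>: "0 < \<beta>" using \<sigma> by (simp add: \<beta>_def)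
  have t\<tau>: "0 < t * \<tau>" using t \<tau> by simp
  \<comment> \<open>chosen so that \<open>exp (- \<epsilon> * n) powr (t * \<tau>)\<close> is the square root of \<open>(r ^ n) powr \<beta>\<close>\<close>
  define \<epsilon> where "\<epsilon> = - (\<beta> * ln r / 2) / (t * \<tau>)"
  have \<epsilon>: "0 < \<epsilon>" using \<beta> r_pos r_less t\<tau> by (simp add: \<epsilon>_def mult_pos_neg divide_neg_pos)
  define g where "g = r powr (\<beta> / 2)"
  have g: "0 < g" "g < 1" using r_pos r_less \<beta> powr_less_mono2[of "\<beta>/2" r 1] by (auto simp: g_def)
  have g_exp: "exp (- \<epsilon> * real n) powr (t * \<tau>) = g ^ n" for n
  proof -
    have "exp (- \<epsilon> * real n) powr (t * \<tau>) = exp (n * (\<beta> / 2 * ln r))"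
    proof -
      have "t \<noteq> 0" "\<tau> \<noteq> 0" using t \<tau>(1) by linarith+
      then show ?thesis by (simp add: powr_def \<epsilon>_def)
    qed
    also have "\<dots> = exp (\<beta> / 2 * ln r) ^ n" by (rule exp_of_nat_mult)
    finally show ?thesis using r_pos by (simp add: g_def powr_def)
  qed
  show ?thesis
  proof (rule hausdorff_dim_W_set_ge_blocks[OF N \<tau>(1) \<tau>\<sigma> z])
    show "0 < (d P * \<theta> (length P)) powr t" if "set P \<subseteq> A" for P
      using d_pos[OF that] \<theta>_pos[of "length P"] by simp
    fix E m
    define E' where "E' = max E 1 * d [] powr \<beta>"
    have E': "0 < E'" using d_Nil_pos by (simp add: E'_def)
    obtain q0 where q0: "g ^ q0 < g ^ N / E'" using real_arch_pow_inv[of "g ^ N / E'" g] E' g by auto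
    obtain n where n: "(max m q0 + 1) * N \<le> n" "exp (- \<epsilon> * real n) \<le> \<theta> n" using freq[OF \<epsilon>] by blast
    define q where "q = n div N"
    have q: "max m q0 \<le> q" 
    proof -
      have "max m q0 * N \<le> n" using n(1) by simp
      then have "(max m q0 * N) div N \<le> n div N" by (rule div_le_mono)
      then have "max m q0 \<le> n div N" using N(1) by simp
      then show ?thesis by (simp add: q_def)
    qed
    have qn: "q * N \<le> n" "n \<le> q * N + N"
      using N(1) div_mult_mod_eq[of n N] mod_less_divisor[OF N(1), of n] unfolding q_def by linarith+
    have key: "E' * g ^ (2 * (q * N)) \<le> \<theta> (q * N) powr (t * \<tau>)"
    proof -
      have "q * 1 \<le> q * N" using N(1) by (intro mult_le_mono2) simp
      moreover have "q0 \<le> q" using q by simp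
      ultimately have "q0 \<le> q * N" by linarith
      then have "g ^ (q * N) \<le> g ^ q0" using g by (intro power_decreasing) auto
      then have "E' * g ^ (q * N) \<le> E' * g ^ q0" using E' by (intro mult_left_mono) auto
      also have "\<dots> \<le> g ^ N" using q0 E' by (simp add: pos_less_divide_eq mult.commute)
      finally have "E' * g ^ (q * N) \<le> g ^ N" .
      then have "E' * g ^ (q * N) * g ^ (q * N) \<le> g ^ N * g ^ (q * N)" using g by (intro mult_right_mono) auto
      moreover have "g ^ (2 * (q * N)) = g ^ (q * N) * g ^ (q * N)" by (simp only: mult_2 power_add)
      moreover have "g ^ (q * N + N) = g ^ N * g ^ (q * N)" by (simp only: power_add mult.commute)
      ultimately have "E' * g ^ (2 * (q * N)) \<le> g ^ (q * N + N)" by (simp only: mult.assoc)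
      also have "\<dots> \<le> g ^ n" using g qn by (intro power_decreasing) auto
      also have "\<dots> = exp (- \<epsilon> * real n) powr (t * \<tau>)" by (simp only: g_exp)
      also have "\<dots> \<le> \<theta> (q * N) powr (t * \<tau>)"
        using n(2) \<theta>_mono[OF qn(1)] t\<tau> by (intro powr_mono2) auto
      finally show ?thesis .
    qed
    show "\<exists>q\<ge>m. \<forall>P\<in>words A (q * N). E * d P powr \<sigma> \<le> ((d P * \<theta> (length P)) powr t) powr \<tau>"
    proof (intro exI[of _ q] conjI ballI)
      show "m \<le> q" using q by simp
      fix P assume "P \<in> words A (q * N)"
      then have P: "set P \<subseteq> A" "length P = q * N" by (auto simp: words_def)
      have "d P powr \<beta> \<le> (r ^ (q * N) * d []) powr \<beta>"
        using d_le[OF P(1)] d_pos[OF P(1)] P(2) \<beta> by (intro powr_mono2) auto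
      also have "\<dots> = g ^ (2 * (q * N)) * d [] powr \<beta>"
      proof -
        have "g ^ (2 * (q * N)) = (r powr (\<beta> / 2)) powr real (2 * (q * N))"
          using g(1) unfolding g_def by (rule powr_realpow[symmetric])
        also have "\<dots> = r powr (real (q * N) * \<beta>)" by (simp add: powr_powr mult_ac)
        also have "\<dots> = (r powr real (q * N)) powr \<beta>" by (simp only: powr_powr)
        also have "r powr real (q * N) = r ^ (q * N)" using r_pos by (rule powr_realpow)
        finally show ?thesis using r_pos d_Nil_pos by (simp add: powr_mult)
      qed
      finally have "max E 1 * d P powr \<beta> \<le> max E 1 * (g ^ (2 * (q * N)) * d [] powr \<beta>)"
        by (intro mult_left_mono) auto
      then have "max E 1 * d P powr \<beta> \<le> E' * g ^ (2 * (q * N))" by (simp add: E'_def mult_ac)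
      then have le: "max E 1 * d P powr \<beta> \<le> \<theta> (q * N) powr (t * \<tau>)" using key by simp
      have "E * d P powr \<sigma> \<le> max E 1 * d P powr \<sigma>" by (intro mult_right_mono) auto
      also have "\<dots> = d P powr (t * \<tau>) * (max E 1 * d P powr \<beta>)"
        by (simp add: \<beta>_def mult.left_commute flip: powr_add)
      also have "\<dots> \<le> d P powr (t * \<tau>) * \<theta> (q * N) powr (t * \<tau>)" using le by (intro mult_left_mono) auto
      also have "\<dots> = ((d P * \<theta> (length P)) powr t) powr \<tau>"
        by (simp add: P(2) powr_mult powr_powr)
      finally show "E * d P powr \<sigma> \<le> ((d P * \<theta> (length P)) powr t) powr \<tau>" .
    qed
  qed
qed

text \<open>If \<open>\<theta> n < exp (- \<epsilon> * n)\<close> from some point on, then the subexponential growth of \<open>Z n s\<close> makes the series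
converge.\<close>
lemma frequently_subexponential:
  assumes s: "0 < s" "hausdorff_dim X \<le> ennreal s"
    and \<theta>: "\<And>n. 0 < n \<Longrightarrow> 0 \<le> \<theta> n"
    and div: "filterlim (\<lambda>N. \<Sum>n=1..N. \<Sum>I\<in>words A n. (d I * \<theta> n) powr s) at_top sequentially"
    and \<epsilon>: "0 < \<epsilon>"
  shows "\<exists>n\<ge>m. exp (- \<epsilon> * real n) \<le> \<theta> n"
proof (rule ccontr)
  assume "\<not> ?thesis"
  then have small: "\<And>n. m \<le> n \<Longrightarrow> \<theta> n < exp (- \<epsilon> * real n)" by (metis not_le)
  define q where "q = exp (- (\<epsilon> * s / 2))"
  have q: "0 < q" "q < 1" using \<epsilon> s by (auto simp: q_def)
  have "0 < \<epsilon> * s / 2" using \<epsilon> s by simp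
  then obtain n0 where n0: "\<And>n. n \<ge> n0 \<Longrightarrow> Z n s \<le> exp (\<epsilon> * s / 2 * n)"
    using Z_le_exp[OF s, of "\<epsilon> * s / 2"] by blast
  define a where "a n = (\<Sum>I\<in>words A n. (d I * \<theta> n) powr s)" for n
  have a0: "0 \<le> a n" for n by (simp add: a_def sum_nonneg)
  have aq: "a n \<le> q ^ n" if n: "n \<ge> Suc (max m n0)" for n
  proof -
    have n': "n0 \<le> n" "m \<le> n" "0 < n" using n by auto
    have "a n = Z n s * \<theta> n powr s" by (simp add: a_def Z_def powr_mult sum_distrib_right)
    also have "\<dots> \<le> exp (\<epsilon> * s / 2 * n) * exp (- \<epsilon> * real n) powr s"
      using n0[OF n'(1)] less_imp_le[OF small[OF n'(2)]] \<theta>[OF n'(3)] s(1) Z_nonneg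
      by (intro mult_mono powr_mono2) auto
    also have "exp (- \<epsilon> * real n) powr s = exp (- \<epsilon> * real n * s)" by (simp add: powr_def mult.commute)
    also have "exp (\<epsilon> * s / 2 * n) * exp (- \<epsilon> * real n * s) = exp (n * - (\<epsilon> * s / 2))"
      by (simp add: algebra_simps flip: exp_add)
    also have "\<dots> = q ^ n" unfolding q_def by (rule exp_of_nat_mult)
    finally show ?thesis .
  qed
  have "summable a"
    by (rule summable_comparison_test'[of "\<lambda>n. q ^ n" "Suc (max m n0)"])
      (use q aq a0 in \<open>auto simp: summable_geometric\<close>)
  then have "(\<Sum>n=1..N. a n) \<le> suminf a" for N
    using a0 by (intro sum_le_suminf) auto
  moreover have "eventually (\<lambda>N. suminf a + 1 \<le> (\<Sum>n=1..N. a n)) sequentially"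
    using div unfolding a_def filterlim_at_top by blast
  then obtain N where "suminf a + 1 \<le> (\<Sum>n=1..N. a n)"
    by (auto simp: eventually_sequentially)
  ultimately show False by (metis add_le_same_cancel1 not_one_le_zero order_trans)
qed

theorem hausdorff_dim_W_set:
  assumes s: "0 < s" "hausdorff_dim X = ennreal s" and t: "1 \<le> t" and z: "z \<in> X"
    and \<theta>_nonneg: "\<And>n. 0 < n \<Longrightarrow> 0 \<le> \<theta> n"
    and \<theta>_mono: "\<And>m n. 0 < m \<Longrightarrow> m \<le> n \<Longrightarrow> \<theta> n \<le> \<theta> m"
    and div: "filterlim (\<lambda>N. \<Sum>n=1..N. \<Sum>I\<in>words A n. (d I * \<theta> n) powr s) at_top sequentially"
  shows "hausdorff_dim (W_set A f X (\<lambda>I. (d I * \<theta> (length I)) powr t) z) = ennreal (s / t)"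
    (is "hausdorff_dim ?W = _")
proof (rule antisym)
  have sX: "hausdorff_dim X \<le> ennreal s" "ennreal s \<le> hausdorff_dim X" using s by auto
  show "hausdorff_dim ?W \<le> ennreal (s / t)"
  proof (rule ennreal_le_epsilon)
    fix e :: real assume e: "0 < e"
    have "hausdorff_dim ?W \<le> ennreal ((s + e * t) / t)"
      by (rule hausdorff_dim_W_set_le[OF s(1) sX(1) _ t, where B = "\<theta> 1"])
        (use e t \<theta>_nonneg \<theta>_mono in auto)
    also have "(s + e * t) / t = s / t + e" using t by (simp add: add_divide_distrib)
    also have "ennreal (s / t + e) = ennreal (s / t) + ennreal e" using s t e by (intro ennreal_plus) auto
    finally show "hausdorff_dim ?W \<le> ennreal (s / t) + ennreal e" .
  qed
  have freq: "\<exists>n\<ge>m. exp (- \<epsilon> * real n) \<le> \<theta> n" if "0 < \<epsilon>" for \<epsilon> m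
    by (rule frequently_subexponential[OF s(1) sX(1) \<theta>_nonneg div that])
  have \<theta>_pos: "0 < \<theta> n" if "0 < n" for n
  proof -
    obtain n' where "n' \<ge> n" "exp (- 1 * real n') \<le> \<theta> n'" using freq[of 1 n] by auto
    then show ?thesis using \<theta>_mono[OF that \<open>n' \<ge> n\<close>] by (meson exp_gt_zero less_le_trans)
  qed
  \<comment> \<open>the limsup set involves words of positive length; \<open>\<theta>'\<close> is positive and decreasing at \<open>0\<close> too\<close>
  define \<theta>' where "\<theta>' n = \<theta> (max n 1)" for n
  have W: "?W = W_set A f X (\<lambda>I. (d I * \<theta>' (length I)) powr t) z"
  proof -
    have "\<theta> (length I) = \<theta>' (length I)" if "I \<in> nonempty_words A" for I
      using that by (auto simp: nonempty_words_def words_def \<theta>'_def max_def)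
    then have "{I \<in> nonempty_words A. x \<in> cball (F I z) ((d I * \<theta> (length I)) powr t)}
        = {I \<in> nonempty_words A. x \<in> cball (F I z) ((d I * \<theta>' (length I)) powr t)}" for x
      by auto
    then show ?thesis by (simp only: W_set_def)
  qed
  have low: "ennreal \<tau> \<le> hausdorff_dim ?W" if "0 < \<tau>" "\<tau> < s / t" for \<tau>
    unfolding W
  proof (rule hausdorff_dim_W_set_ge_of_frequently[OF sX(2) t that z])
    show "0 < \<theta>' n" for n using \<theta>_pos by (simp add: \<theta>'_def)
    show "\<theta>' n \<le> \<theta>' m" if "m \<le> n" for m n using that by (auto simp: \<theta>'_def intro!: \<theta>_mono)
    show "\<exists>n\<ge>m. exp (- \<epsilon> * real n) \<le> \<theta>' n" if "0 < \<epsilon>" for \<epsilon> m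
    proof -
      obtain n where "n \<ge> max m 1" "exp (- \<epsilon> * real n) \<le> \<theta> n"
        using freq[OF \<open>0 < \<epsilon>\<close>, of "max m 1"] by blast
      moreover from this have "max n 1 = n" by simp
      ultimately show ?thesis unfolding \<theta>'_def by (intro exI[of _ n]) simp
    qed
  qed
  show "ennreal (s / t) \<le> hausdorff_dim ?W"
  proof (rule ccontr)
    assume "\<not> ?thesis"
    then have less: "hausdorff_dim ?W < ennreal (s / t)" by simp
    then obtain w where w: "hausdorff_dim ?W = ennreal w" "0 \<le> w"
      by (cases "hausdorff_dim ?W") auto
    define v where "v = s / t"
    have "w < v" using less w by (simp add: ennreal_less_iff v_def)
    then have "0 < (w + v) / 2" "(w + v) / 2 < v" using w(2) by simp_all
    then have "ennreal ((w + v) / 2) \<le> ennreal w" using low[of "(w + v) / 2"] w(1) by (simp add: v_def)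
    then show False using w(2) \<open>w < v\<close> by (simp add: ennreal_le_iff)
  qed
qed

end

section \<open>Conformal systems with the open set condition\<close>

lemma orbit_enters:
  fixes f :: "'a::metric_space \<Rightarrow> 'a"
  assumes "f ` T \<subseteq> T" "r-lipschitz_on T f" "r < 1" "x \<in> T" "y \<in> T" "0 < \<epsilon>"
  shows "\<exists>n. dist ((f ^^ n) x) ((f ^^ n) y) < \<epsilon>"
proof -
  have r: "0 \<le> r" using assms(2) by (rule lipschitz_on_nonneg)
  have *: "(f ^^ n) x \<in> T \<and> (f ^^ n) y \<in> T \<and> dist ((f ^^ n) x) ((f ^^ n) y) \<le> r ^ n * dist x y" for n
  proof (induction n)
    case (Suc n)
    have "dist (f ((f ^^ n) x)) (f ((f ^^ n) y)) \<le> r * dist ((f ^^ n) x) ((f ^^ n) y)"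
      using Suc by (intro lipschitz_onD[OF assms(2)]) auto
    also have "\<dots> \<le> r * (r ^ n * dist x y)" using Suc r by (intro mult_left_mono) auto
    finally show ?case using Suc assms(1) by (auto simp: mult.assoc)
  qed (use assms in auto)
  obtain n where n: "r ^ n < \<epsilon> / (dist x y + 1)"
    using real_arch_pow_inv[of "\<epsilon> / (dist x y + 1)" r] assms by (auto simp: add_nonneg_pos)
  have pos: "0 < dist x y + 1" by (simp add: add_nonneg_pos)
  have "dist ((f ^^ n) x) ((f ^^ n) y) \<le> r ^ n * dist x y" using * by blast
  also have "\<dots> \<le> r ^ n * (dist x y + 1)" using r by (intro mult_left_mono) auto
  also have "\<dots> < \<epsilon>" using n pos by (simp add: pos_less_divide_eq)
  finally show ?thesis by blast
qed

text \<open>Although the maps need not send \<open>V\<close> into itself, a closed neighbourhood \<open>S\<close> of \<open>X\<close> inside \<open>V\<close> is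
invariant because the maps are contractions on \<open>V\<close>, and the distortion estimates hold there. The open
set \<open>U\<close> of the open set condition may lie far away from \<open>X\<close>, but orbits of points of \<open>U\<close> stay in \<open>U\<close>
and approach \<open>X\<close>; so \<open>U\<close> meets the interior of \<open>S\<close>.\<close>
lemma conformal_ifs_distorted_ifs:
  fixes \<phi> :: "'i \<Rightarrow> 'a \<Rightarrow> 'a::euclidean_space"
  assumes conf: "conformal_ifs D \<phi> Y V" and osc: "open_set_condition D \<phi> V"
    and attr: "is_attractor D \<phi> Y X" and diam: "0 < diameter X"
  shows "\<exists>S U r K a u. distorted_ifs D \<phi> X S U r K a u"
proof -
  have finD: "finite D" and V: "open V" "Y \<subseteq> V" and injV: "\<And>i. i \<in> D \<Longrightarrow> inj_on (\<phi> i) V"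
    using conf by (auto simp: conformal_ifs_def ifs_def)
  have "\<forall>i\<in>D. \<exists>r. r < 1 \<and> r-lipschitz_on V (\<phi> i)" using conf by (auto simp: conformal_ifs_def)
  then obtain rr where rr: "\<And>i. i \<in> D \<Longrightarrow> rr i < 1" "\<And>i. i \<in> D \<Longrightarrow> (rr i)-lipschitz_on V (\<phi> i)"
    by (metis bchoice)
  obtain \<phi>' where \<phi>': "\<And>i. i \<in> D \<Longrightarrow> conformal_on V (\<phi> i) (\<phi>' i)"
    "\<And>i. i \<in> D \<Longrightarrow> \<exists>a b. 0 < a \<and> b < 1 \<and> (\<forall>x\<in>V. a \<le> norm (\<phi>' i x) \<and> norm (\<phi>' i x) \<le> b)"
    "\<exists>\<alpha>>0. \<exists>c>0. \<forall>i\<in>D. \<forall>x\<in>V. \<forall>y\<in>V. \<bar>norm (\<phi>' i x) - norm (\<phi>' i y)\<bar> \<le> c * norm (x - y) powr \<alpha>"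
    using conf unfolding conformal_ifs_def by blast
  obtain \<alpha> c where \<alpha>: "0 < \<alpha>" "0 < c"
    "\<And>i x y. i \<in> D \<Longrightarrow> x \<in> V \<Longrightarrow> y \<in> V \<Longrightarrow> \<bar>norm (\<phi>' i x) - norm (\<phi>' i y)\<bar> \<le> c * norm (x - y) powr \<alpha>"
    using \<phi>'(3) by blast
  obtain U where U': "U \<noteq> {} \<and> open U \<and> U \<subseteq> V \<and> (\<forall>i\<in>D. \<phi> i ` U \<subseteq> U) \<and>
      (\<forall>i\<in>D. \<forall>j\<in>D. i \<noteq> j \<longrightarrow> \<phi> i ` U \<inter> \<phi> j ` U = {})"
    using osc unfolding open_set_condition_def by (rule exE)
  then have U: "U \<noteq> {}" "open U" "U \<subseteq> V" "\<And>i. i \<in> D \<Longrightarrow> \<phi> i ` U \<subseteq> U"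
    "\<And>i j. i \<in> D \<Longrightarrow> j \<in> D \<Longrightarrow> i \<noteq> j \<Longrightarrow> \<phi> i ` U \<inter> \<phi> j ` U = {}"
    by simp_all
  have X: "X \<noteq> {}" "compact X" "X \<subseteq> V" "X = (\<Union>i\<in>D. \<phi> i ` X)"
    using attr V(2) unfolding is_attractor_def by blast+
  then have Dne: "D \<noteq> {}" by blast
  define r where "r = Max (insert (1/2) (rr ` D))"
  have r: "0 < r" "r < 1" "\<And>i. i \<in> D \<Longrightarrow> rr i \<le> r"
    using finD rr(1) by (auto simp: r_def less_max_iff_disj Max_gr_iff)
  have lip: "r-lipschitz_on V (\<phi> i)" if "i \<in> D" for i
    using lipschitz_on_le[OF rr(2)[OF that] r(3)[OF that]] .

  obtain \<epsilon> where \<epsilon>: "0 < \<epsilon>" "(\<Union>x\<in>X. cball x \<epsilon>) \<subseteq> V"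
    using compact_subset_open_imp_cball_epsilon_subset[OF X(2) V(1) X(3)] by blast
  define S where "S = (\<Union>x\<in>X. cball x \<epsilon>)"
  have SV: "S \<subseteq> V" using \<epsilon> by (simp add: S_def)
  have "S = {x + y |x y. x \<in> X \<and> y \<in> cball 0 \<epsilon>}"
  proof (intro equalityI subsetI)
    fix w assume "w \<in> S"
    then obtain x where "x \<in> X" "dist x w \<le> \<epsilon>" by (auto simp: S_def)
    then have "w = x + (w - x)" "w - x \<in> cball 0 \<epsilon>" by (auto simp: dist_norm norm_minus_commute)
    then show "w \<in> {x + y |x y. x \<in> X \<and> y \<in> cball 0 \<epsilon>}" using \<open>x \<in> X\<close> by blast
  next
    fix w assume "w \<in> {x + y |x y. x \<in> X \<and> y \<in> cball 0 \<epsilon>}"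
    then obtain x y where "w = x + y" "x \<in> X" "norm y \<le> \<epsilon>" by auto
    then have "w \<in> cball x \<epsilon>" by (simp add: dist_norm)
    then show "w \<in> S" using \<open>x \<in> X\<close> unfolding S_def by blast
  qed
  then have S: "compact S" using compact_sums[OF X(2) compact_cball[of 0 \<epsilon>]] by (simp only:)
  have XS: "X \<subseteq> S" using \<epsilon>(1) by (force simp: S_def)
  have maps_S: "\<phi> i ` S \<subseteq> S" if i: "i \<in> D" for i
  proof (rule image_subsetI)
    fix w assume w: "w \<in> S"
    then obtain x where x: "x \<in> X" "dist x w \<le> \<epsilon>" by (auto simp: S_def)
    have "dist (\<phi> i x) (\<phi> i w) \<le> r * dist x w"
      using x w SV X(3) by (intro lipschitz_onD[OF lip[OF i]]) auto
    also have "\<dots> \<le> 1 * dist x w" using r by (intro mult_right_mono) auto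
    finally have "dist (\<phi> i x) (\<phi> i w) \<le> \<epsilon>" using x by simp
    moreover have "\<phi> i x \<in> X" using X(4) i x by blast
    ultimately show "\<phi> i w \<in> S" by (auto simp: S_def)
  qed

  have "\<exists>C\<ge>0. \<forall>x\<in>S. \<forall>y\<in>S. x \<noteq> y \<longrightarrow>
     \<bar>ln (dist (\<phi> i x) (\<phi> i y) / dist x y) - ln (norm (\<phi>' i x))\<bar> \<le> C * dist x y powr \<alpha>"
    if i: "i \<in> D" for i
  proof -
    obtain a b where ab: "0 < a" "b < 1" "\<And>x. x \<in> V \<Longrightarrow> a \<le> norm (\<phi>' i x) \<and> norm (\<phi>' i x) \<le> b"
      using \<phi>'(2)[OF i] by blast
    show ?thesis
    proof (rule conformal_log_ratio[OF \<phi>'(1)[OF i] V(1) injV[OF i] _ ab(1) _ \<alpha>(1)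
          less_imp_le[OF \<alpha>(2)] \<alpha>(3)[OF i] S SV])
      show "1-lipschitz_on V (\<phi> i)" using lipschitz_on_le[OF lip[OF i]] r(2) by simp
      show "a \<le> norm (\<phi>' i x) \<and> norm (\<phi>' i x) \<le> 1" if "x \<in> V" for x
        using ab(2) ab(3)[OF that] by linarith
    qed
  qed
  then obtain CC where CC: "\<And>i. i \<in> D \<Longrightarrow> 0 \<le> CC i"
    "\<And>i x y. i \<in> D \<Longrightarrow> x \<in> S \<Longrightarrow> y \<in> S \<Longrightarrow> x \<noteq> y \<Longrightarrow>
     \<bar>ln (dist (\<phi> i x) (\<phi> i y) / dist x y) - ln (norm (\<phi>' i x))\<bar> \<le> CC i * dist x y powr \<alpha>"
    by metis
  define C where "C = (\<Sum>i\<in>D. CC i)"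
  have C: "0 \<le> C" "\<And>i. i \<in> D \<Longrightarrow> CC i \<le> C"
    using CC(1) finD by (auto simp: C_def intro: sum_nonneg member_le_sum)
  have contr: "dist (\<phi> i x) (\<phi> i y) \<le> r * dist x y" if "i \<in> D" "x \<in> S" "y \<in> S" for i x y
    using that SV by (intro lipschitz_onD[OF lip]) auto
  have inj_S: "inj_on (\<phi> i) S" if "i \<in> D" for i using injV[OF that] SV by (rule inj_on_subset)
  have bdd: "bounded S" using S by (rule compact_imp_bounded)
  have "\<exists>K\<ge>1. \<forall>I x y x' y'. set I \<subseteq> D \<longrightarrow> x \<in> S \<longrightarrow> y \<in> S \<longrightarrow> x' \<in> S \<longrightarrow> y' \<in> S \<longrightarrow>
     dist (word_map \<phi> I x) (word_map \<phi> I y) * dist x' y'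
       \<le> K * dist (word_map \<phi> I x') (word_map \<phi> I y') * dist x y"
  proof (rule bounded_distortion[OF maps_S inj_S r(1,2) contr bdd \<alpha>(1) C(1)])
    fix i x y assume *: "i \<in> D" "x \<in> S" "y \<in> S" "x \<noteq> y"
    have "CC i * dist x y powr \<alpha> \<le> C * dist x y powr \<alpha>" using C(2)[OF *(1)] by (intro mult_right_mono) auto
    then show "\<bar>ln (dist (\<phi> i x) (\<phi> i y) / dist x y) - ln (norm (\<phi>' i x))\<bar> \<le> C * dist x y powr \<alpha>"
      using CC(2)[OF *] by linarith
  qed
  then obtain K where K: "1 \<le> K" "\<And>I x y x' y'. set I \<subseteq> D \<Longrightarrow> x \<in> S \<Longrightarrow> y \<in> S \<Longrightarrow> x' \<in> S \<Longrightarrow> y' \<in> S \<Longrightarrow>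
     dist (word_map \<phi> I x) (word_map \<phi> I y) * dist x' y'
       \<le> K * dist (word_map \<phi> I x') (word_map \<phi> I y') * dist x y"
    by blast

  obtain i where i: "i \<in> D" using Dne by blast
  obtain x y where x: "x \<in> X" and y: "y \<in> U" using X(1) U(1) by blast
  have "\<phi> i ` (X \<union> U) \<subseteq> X \<union> U" using X(4) U(4)[OF i] i by blast
  moreover have "r-lipschitz_on (X \<union> U) (\<phi> i)"
    using lipschitz_on_subset[OF lip[OF i]] X(3) U(3) by blast
  ultimately obtain n where n: "dist ((\<phi> i ^^ n) x) ((\<phi> i ^^ n) y) < \<epsilon>"
    using orbit_enters[of "\<phi> i" "X \<union> U" r x y \<epsilon>] r(2) x y \<epsilon>(1) by blast
  define u where "u = (\<phi> i ^^ n) y"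
  have "(\<phi> i ^^ k) x \<in> X" "(\<phi> i ^^ k) y \<in> U" for k
    by (induction k) (use x y X(4) U(4)[OF i] i in auto)
  then have un: "u \<in> U" and xn: "(\<phi> i ^^ n) x \<in> X" by (simp_all add: u_def)
  have "cball ((\<phi> i ^^ n) x) \<epsilon> \<subseteq> S" using xn unfolding S_def by blast
  then have "ball ((\<phi> i ^^ n) x) \<epsilon> \<subseteq> S" using ball_subset_cball by (rule order_trans[rotated])
  moreover have "u \<in> U \<inter> ball ((\<phi> i ^^ n) x) \<epsilon>" using un n by (simp add: u_def)
  moreover have "open (U \<inter> ball ((\<phi> i ^^ n) x) \<epsilon>)" using U(2) by auto
  ultimately obtain a where a: "0 < a" "cball u a \<subseteq> U \<inter> S"
    unfolding open_contains_cball by blast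

  have "distorted_ifs D \<phi> X S U r K a u"
  proof
    show "inj_on (\<phi> i) U" if "i \<in> D" for i using injV[OF that] U(3) by (rule inj_on_subset)
  qed (fact finD X diam XS bdd maps_S inj_S r contr K U a)+
  then show ?thesis by blast
qed

lemma hausdorff_dim_diameter_0:
  fixes X :: "'a::metric_space set"
  assumes "bounded X" "diameter X = 0"
  shows "hausdorff_dim X = 0"
proof -
  have "hausdorff_dim X \<le> ennreal s" if s: "0 < s" for s
  proof (rule hausdorff_dim_le_if_countable_covers[OF s])
    fix \<delta> \<eta> :: real assume "0 < \<delta>" "0 < \<eta>"
    then show "\<exists>U::nat \<Rightarrow> 'a set. X \<subseteq> (\<Union>n. U n) \<and> (\<forall>n. bounded (U n) \<and> diameter (U n) \<le> \<delta>) \<and>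
        (\<Sum>n. ennreal (diameter (U n) powr s)) \<le> ennreal \<eta>"
      using assms by (intro exI[of _ "\<lambda>_. X"]) auto
  qed
  then have "hausdorff_dim X \<le> 0 + ennreal s" if "0 < s" for s using that by simp
  then have "hausdorff_dim X \<le> 0" by (rule ennreal_le_epsilon)
  then show ?thesis by simp
qed

theorem corollary5p3:
  fixes D :: "'i set"
    and \<phi> :: "'i \<Rightarrow> 'a \<Rightarrow> 'a::euclidean_space"
    and X Y V :: "'a set"
    and \<theta> :: "nat \<Rightarrow> real"
  assumes "conformal_ifs D \<phi> Y V"
    and "open_set_condition D \<phi> V"
    and "is_attractor D \<phi> Y X"
    and "\<forall>n\<ge>1. 0 \<le> \<theta> n"
    and "antimono_on {1..} \<theta>"
    and "filterlim
           (\<lambda>N. \<Sum>n=1..N. \<Sum>I\<in>words D n.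
              nn_power (diameter (word_map \<phi> I ` X) * \<theta> n) (enn2real (hausdorff_dim X)))
           at_top sequentially"
  shows "\<forall>z\<in>X. \<forall>t::real. t \<ge> 1 \<longrightarrow>
           hausdorff_dim
             (W_set D \<phi> X (\<lambda>I. (diameter (word_map \<phi> I ` X) * \<theta> (length I)) powr t) z)
           = hausdorff_dim X / ennreal t"
proof (intro ballI allI impI)
  fix z and t :: real assume z: "z \<in> X" and t: "1 \<le> t"
  let ?W = "W_set D \<phi> X (\<lambda>I. (diameter (word_map \<phi> I ` X) * \<theta> (length I)) powr t) z"
  show "hausdorff_dim ?W = hausdorff_dim X / ennreal t"
  proof (cases "hausdorff_dim X = 0")
    case True
    have "hausdorff_dim ?W \<le> hausdorff_dim X" by (rule hausdorff_dim_mono) (auto simp: W_set_def)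
    then show ?thesis using True by simp
  next
    case False
    have "bounded X" using assms(3) by (auto simp: is_attractor_def compact_imp_bounded)
    then have "0 < diameter X"
      using False hausdorff_dim_diameter_0[of X] diameter_ge_0[of X] by fastforce
    then obtain S U r K a u where "distorted_ifs D \<phi> X S U r K a u"
      using conformal_ifs_distorted_ifs[OF assms(1-3)] by blast
    then interpret distorted_ifs D \<phi> X S U r K a u .
    obtain s where s: "hausdorff_dim X = ennreal s" "0 < s"
      using False hausdorff_dim_X_finite by (cases "hausdorff_dim X") (auto simp: less_le)
    have "hausdorff_dim ?W = ennreal (s / t)"
      unfolding d_def[symmetric]
    proof (rule hausdorff_dim_W_set[OF s(2,1) t z])
      show "0 \<le> \<theta> n" if "0 < n" for n using assms(4) that by simp
      show "\<theta> n \<le> \<theta> m" if "0 < m" "m \<le> n" for m n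
        using monotone_onD[OF assms(5), of m n] that by simp
      show "filterlim (\<lambda>N. \<Sum>n=1..N. \<Sum>I\<in>words D n. (d I * \<theta> n) powr s) at_top sequentially"
        using assms(6) s by (simp add: nn_power_def d_def)
    qed
    also have "\<dots> = hausdorff_dim X / ennreal t" using s t by (simp add: divide_ennreal)
    finally show ?thesis .
  qed
qed

end
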